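(* Let $f$ be a nonconstant real analytic (real-valued) function on a neighborhood of a ball $\{x\in\mathbb{R}^n:|x|\le b\}$, where $0<b\le 1$, such that $\nabla f(0)=0$. Then there is a constant $C$ depending on $f$ such that the following holds. Let $m_0$ be an integer with $2^{-m_0+1}<b$ and let $\phi$ be a $C^1$ function supported on $|x|<2^{-m_0+1}$. For real $\lambda\ne 0$ let $$I(\lambda)=\int_{\mathbb{R}^n} e^{i\lambda f(x)}\phi(x)\,dx .$$ For an integer $m\ge m_0$ and an $x$ with $|x|\in[2^{-m-1},2^{-m+1}]$, let $J_m(x)$ denote the line segment from $2^{-m-1}\frac{x}{|x|}$ to $2^{-m+1}\frac{x}{|x|}$. Then $$|I(\lambda)|\le C\big(\|\phi\|_{L^\infty}+\|\nabla\phi\|_{L^\infty}\big)\int_{|x|<2^{-m_0+1}}\min\left(1,\left|\frac{f_{rr}(x)}{\lambda (f_r(x))^2}\right|\right)dx$$ $$\qquad+\ C\big(\|\phi\|_{L^\infty}+\|\nabla\phi\|_{L^\infty}\big)\sum_{m\ge m_0}\int_{2^{-m-1}<|x|<2^{-m+1}}\min\left(1,\frac{1}{|\lambda|\,|x|\,\sup_{y\in J_m(x)}|f_r(y)|}\right)dx .$$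
   Context: For $x\neq 0$, $f_r(x)=\frac{x}{|x|}\cdot\nabla f(x)$ denotes the derivative of $f$ in the radial direction and $f_{rr}$ the second derivative in the radial direction, i.e. for $|\omega|=1$ and $r>0$, $f_r(r\omega)=\frac{d}{dr}f(r\omega)$ and $f_{rr}(r\omega)=\frac{d^2}{dr^2}f(r\omega)$. Each minimum is interpreted as $1$ where the denominator of its second entry is zero. *)

theory Defs
  imports "HOL-Analysis.Analysis" "HOL-Probability.Essential_Supremum"
begin

text \<open>Multi-indices are functions \<open>'n \<Rightarrow> nat\<close>; \<open>has_sum\<close> is unconditional (equivalently, absolute)
  convergence of the power series.\<close>

definition real_analytic_on :: "(real ^ 'n \<Rightarrow> real) \<Rightarrow> (real ^ 'n) set \<Rightarrow> bool"
    (infixl \<open>(real'_analytic'_on)\<close> 50)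
  where "f real_analytic_on U \<longleftrightarrow>
    (\<forall>a\<in>U. \<exists>r>0. \<exists>c :: ('n \<Rightarrow> nat) \<Rightarrow> real. \<forall>x\<in>ball a r.
       ((\<lambda>\<alpha>. c \<alpha> * (\<Prod>i\<in>UNIV. (x $ i - a $ i) ^ \<alpha> i)) has_sum f x) UNIV)"

definition grad :: "(real ^ 'n \<Rightarrow> 'b::real_normed_vector) \<Rightarrow> real ^ 'n \<Rightarrow> 'b ^ 'n"
  where "grad f x = (\<chi> i. frechet_derivative f (at x) (axis i 1))"

definition continuously_differentiable :: "(real ^ 'n \<Rightarrow> 'b::real_normed_vector) \<Rightarrow> bool"
  where "continuously_differentiable f \<longleftrightarrow>
    (\<forall>x. f differentiable (at x)) \<and> continuous_on UNIV (grad f)"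

text \<open>The value is a real number, so this is the \<open>L\<^sup>\<infinity>\<close> norm only for essentially bounded
  measurable \<open>g\<close>.\<close>

definition Linfty_norm :: "(real ^ 'n \<Rightarrow> 'b::real_normed_vector) \<Rightarrow> real"
  where "Linfty_norm g = real_of_ereal (esssup lborel (\<lambda>x. ereal (norm (g x))))"

text \<open>Radial derivatives, meaningful for \<open>x \<noteq> 0\<close>; note that \<open>sgn x = x /\<^sub>R norm x\<close>.\<close>

definition radial_deriv :: "(real ^ 'n \<Rightarrow> real) \<Rightarrow> real ^ 'n \<Rightarrow> real"
  where "radial_deriv f x = sgn x \<bullet> grad f x"

definition radial_deriv2 :: "(real ^ 'n \<Rightarrow> real) \<Rightarrow> real ^ 'n \<Rightarrow> real"
  where "radial_deriv2 f x = (deriv ^^ 2) (\<lambda>r. f (r *\<^sub>R sgn x)) (norm x)"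

definition radial_segment :: "int \<Rightarrow> real ^ 'n \<Rightarrow> (real ^ 'n) set"
  where "radial_segment m x =
    closed_segment ((2 powi (- m - 1)) *\<^sub>R sgn x) ((2 powi (- m + 1)) *\<^sub>R sgn x)"

text \<open>The minimum of \<open>1\<close> and \<open>\<bar>p / q\<bar>\<close>, read as \<open>1\<close> for \<open>q = 0\<close>, where HOL has \<open>p / q = 0\<close>.\<close>

definition min_one_quot :: "real \<Rightarrow> real \<Rightarrow> real"
  where "min_one_quot p q = (if q = 0 then 1 else min 1 \<bar>p / q\<bar>)"

definition osc_integral :: "(real ^ 'n \<Rightarrow> real) \<Rightarrow> (real ^ 'n \<Rightarrow> complex) \<Rightarrow> real \<Rightarrow> complex"
  where "osc_integral f \<phi> lam =
    (LINT x|lborel. exp (\<i> * complex_of_real (lam * f x)) * \<phi> x)"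

end

theory Submission
  imports Defs "HOL-Real_Asymp.Real_Asymp"
begin

text \<open>
  On a dyadic piece of a ray, rescaled to \<open>[1, 4]\<close>, let \<open>h\<close> be the derivative of the phase. Near every point
  of the ball the functions \<open>r\<^sup>k (d/dr)\<^sup>k f\<close>, \<open>k \<ge> 1\<close>, are controlled by finitely many of them, because
  convergent power series form a Noetherian ring. By compactness there are \<open>N\<close> and \<open>A\<close>, independent of the ray and of
  the scale, such that \<open>\<bar>h\<^sup>(\<^sup>N\<^sup>)\<bar>\<close> is at most \<open>A\<close> times the sum of the lower derivatives of \<open>h\<close>. By Gronwall's
  inequality, near each point some derivative of \<open>h\<close> of order less than \<open>N\<close> is comparable to \<open>sup \<bar>h\<bar>\<close>.

  Where this is \<open>h\<close> itself, one integration by parts gives \<open>1 / (\<bar>\<lambda>\<bar> sup \<bar>h\<bar>)\<close>. Elsewhere \<open>h\<close> has boundedly many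
  monotone pieces. Let \<open>\<kappa>\<close> be a large multiple of \<open>\<integral> min(1, \<bar>h' / (\<lambda> h\<^sup>2)\<bar>) + 1 / \<bar>\<lambda>\<bar>\<close>. On each piece integrate by
  parts where \<open>\<bar>h\<bar> \<ge> 1 / (\<bar>\<lambda>\<bar> \<kappa>)\<close>, and estimate trivially on the rest, which has length at most \<open>\<kappa>\<close>. Integration
  over the rays and summation over the scales give the theorem.
\<close>

section \<open>Weighted power series and Hironaka division\<close>

text \<open>The order to which the phase degenerates along a ray varies with the direction, with no
  evident bound, and it is infinite on rays where \<open>f\<close> is constant. So no fixed
  nonvanishing derivative can be assumed. What survives uniformly is a linear differential
  inequality between radial derivatives, which also admits \<open>h = 0\<close>. It needs only size
  estimates, so pointwise bounds take the place of ideal membership and no algebra of convergent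
  series is built up.

  The operators \<open>r^k (d/dr)^k\<close> are invariant under dilation. Hence one inequality near
  the origin serves all scales, and every dyadic piece reduces to \<open>{1..4}\<close>: there
  \<open>{2..4}\<close> carries the integral and all of \<open>{1..4}\<close> is the segment of the
  supremum. Dividing the phase by the size of its jet at \<open>1\<close> and moving that factor
  into \<lambda> leaves the first minimum unchanged, so only phases with normalised jet remain.

  The summand \<open>1/|\<lambda>|\<close> of \<kappa> keeps the level
  \<open>1/(|\<lambda>| \<kappa>)\<close> below a fixed fraction of the maximum of
  \<open>|h|\<close>. An interval where \<open>|h|\<close> is below this level can therefore be
  enlarged until \<open>|h|\<close> reaches twice the level, and that excursion is what the integral
  of the first minimum detects.\<close>

definition index_prime :: "'n::finite \<Rightarrow> nat"
  where "index_prime = (SOME p. inj p \<and> (\<forall>i. prime (p i)))"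

lemma index_prime: "inj (index_prime :: 'n::finite \<Rightarrow> nat)" "prime (index_prime (i::'n))"
proof -
  obtain P :: "nat set" where P: "P \<subseteq> {p. prime p}" "finite P" "card P = CARD('n)"
    using infinite_arbitrarily_large[OF primes_infinite] by blast
  then obtain p where "bij_betw p (UNIV::'n set) P"
    using finite_same_card_bij[of "UNIV::'n set" P] by auto
  hence "inj p \<and> (\<forall>i. prime (p i))" using P by (auto simp: bij_betw_def)
  hence "\<exists>p::'n \<Rightarrow> nat. inj p \<and> (\<forall>i. prime (p i))" by (rule exI[of _ p])
  hence "inj (index_prime :: 'n \<Rightarrow> nat) \<and> (\<forall>i. prime (index_prime (i::'n)))"
    unfolding index_prime_def by (rule someI_ex)
  thus "inj (index_prime :: 'n::finite \<Rightarrow> nat)" "prime (index_prime (i::'n))" by auto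
qed

text \<open>Multi-indices are encoded by integers whose prime factors are \<open>index_prime i\<close>: this orders
  monomials totally, compatibly with multiplication, and \<open>index_code \<alpha> powr (- s)\<close> is the size of the monomial
  on a polydisc on which, as \<open>s\<close> grows, the smallest monomial of a series dominates all others.\<close>

definition index_code :: "('n::finite \<Rightarrow> nat) \<Rightarrow> nat"
  where "index_code \<alpha> = (\<Prod>i\<in>UNIV. index_prime i ^ \<alpha> i)"

lemma index_prime_pos: "0 < index_prime i"
  using index_prime(2) by (rule prime_gt_0_nat)

lemma index_code_pos: "0 < index_code \<alpha>"
  unfolding index_code_def by (simp add: index_prime_pos)

lemma index_code_ge_1: "1 \<le> index_code \<alpha>" using index_code_pos[of \<alpha>] by linarith

lemma inj_index_code: "inj (index_code :: ('n::finite \<Rightarrow> nat) \<Rightarrow> nat)"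
proof (rule injI, rule ext)
  fix \<alpha> \<beta> :: "'n \<Rightarrow> nat" and i
  have *: "multiplicity (index_prime i) (index_code \<gamma>) = \<gamma> i" for \<gamma> :: "'n \<Rightarrow> nat"
  proof -
    have "index_code \<gamma> = (\<Prod>p\<in>range (index_prime::'n\<Rightarrow>nat). p ^ \<gamma> (inv index_prime p))"
      unfolding index_code_def by (subst prod.reindex) (auto simp: index_prime)
    also have "multiplicity (index_prime i) \<dots> = \<gamma> i"
      by (subst multiplicity_prod_prime_powers) (auto simp: index_prime)
    finally show ?thesis .
  qed
  assume "index_code \<alpha> = index_code \<beta>"
  thus "\<alpha> i = \<beta> i" using *[of \<alpha>] *[of \<beta>] by simp
qed

lemma index_code_add: "index_code (\<lambda>i. \<alpha> i + \<beta> i) = index_code \<alpha> * index_code \<beta>"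
  unfolding index_code_def by (simp add: power_add prod.distrib)

lemma finite_index_code_le: "finite {\<alpha>. index_code \<alpha> \<le> M}"
  using finite_vimageI[OF finite_atMost[of M] inj_index_code] by (simp add: vimage_def)

lemma finite_index_code_less: "finite {\<alpha>. index_code \<alpha> < M}"
  by (rule finite_subset[OF _ finite_index_code_le[of M]]) auto

definition weight :: "real \<Rightarrow> ('n::finite \<Rightarrow> nat) \<Rightarrow> real"
  where "weight s \<alpha> = real (index_code \<alpha>) powr (- s)"

lemma weight_pos: "0 < weight s \<alpha>" unfolding weight_def using index_code_pos[of \<alpha>] by simp

lemma weight_add: "weight s (\<lambda>i. \<alpha> i + \<beta> i) = weight s \<alpha> * weight s \<beta>"
  unfolding weight_def by (simp add: index_code_add powr_mult)

lemma weight_antimono: "s \<le> t \<Longrightarrow> weight t \<alpha> \<le> weight s \<alpha>"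
  unfolding weight_def using index_code_ge_1[of \<alpha>] by (intro powr_mono) auto

definition monomial :: "real^'n \<Rightarrow> ('n::finite \<Rightarrow> nat) \<Rightarrow> real"
  where "monomial y \<alpha> = (\<Prod>i\<in>UNIV. (y $ i) ^ \<alpha> i)"

lemma monomial_add: "monomial y (\<lambda>i. \<alpha> i + \<beta> i) = monomial y \<alpha> * monomial y \<beta>"
  unfolding monomial_def by (simp add: power_add prod.distrib)

text \<open>With radii \<open>p^(-s)\<close> for the primes \<open>p\<close> of the encoding, the
  largest value of a monomial on the polydisc is exactly its weight. Growing \<open>s\<close>
  shrinks the polydisc to the origin.\<close>

definition polydisc :: "real \<Rightarrow> (real^'n) set"
  where "polydisc s = {y. \<forall>i. \<bar>y $ i\<bar> \<le> real (index_prime i) powr (- s)}"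

lemma weight_prod: "weight s \<alpha> = (\<Prod>i\<in>UNIV. (real (index_prime i) powr (- s)) ^ \<alpha> i)"
proof -
  have "weight s \<alpha> = (\<Prod>i\<in>UNIV. (real (index_prime i) ^ \<alpha> i) powr (- s))"
    unfolding weight_def index_code_def of_nat_prod of_nat_power by (subst prod_powr_distrib) auto
  also have "\<dots> = (\<Prod>i\<in>UNIV. (real (index_prime i) powr (- s)) ^ \<alpha> i)"
    by (intro prod.cong refl) (simp add: powr_power powr_powr index_prime_pos mult.commute powr_realpow[symmetric])
  finally show ?thesis .
qed

lemma monomial_le_weight: "y \<in> polydisc s \<Longrightarrow> \<bar>monomial y \<alpha>\<bar> \<le> weight s \<alpha>"
  unfolding monomial_def weight_prod abs_prod power_abs polydisc_def
  by (intro prod_mono) (auto intro!: power_mono)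

lemma polydisc_mono:
  assumes "s \<le> t" shows "(polydisc t :: (real^'n::finite) set) \<subseteq> polydisc s"
proof -
  have "real (index_prime i) powr (- t) \<le> real (index_prime i) powr (- s)" for i :: 'n
    using assms index_prime_pos[of i] by (intro powr_mono) auto
  thus ?thesis unfolding polydisc_def by (blast intro: order_trans)
qed

section \<open>Dickson's lemma\<close>

lemma Dickson_chain:
  fixes a :: "nat \<Rightarrow> 'n \<Rightarrow> nat" and A :: "'n set"
  assumes "finite A"
  shows "\<exists>r. strict_mono r \<and> (\<forall>i\<in>A. incseq (\<lambda>k. a (r k) i))"
  using assms
proof induction
  case empty
  show ?case by (rule exI[of _ "\<lambda>k. k"]) (simp add: strict_mono_def)
next
  case (insert i A)
  then obtain r where r: "strict_mono r" "\<forall>i\<in>A. incseq (\<lambda>k. a (r k) i)" by blast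
  obtain q where q: "strict_mono q" "monoseq (\<lambda>k. a (r (q k)) i)"
    using seq_monosub[of "\<lambda>k. a (r k) i"] by blast
  have *: "\<exists>q'. strict_mono q' \<and> incseq (\<lambda>k. a (r (q' k)) i)"
  proof (cases "incseq (\<lambda>k. a (r (q k)) i)")
    case False
    hence dec: "decseq (\<lambda>k. a (r (q k)) i)" using q(2) by (simp add: monoseq_iff)
    \<comment> \<open>A decreasing sequence of naturals is constant once it attains its least value,
      so its tail from \<open>k0\<close> on is also increasing.\<close>
    define L where "L = (LEAST v. \<exists>k. v = a (r (q k)) i)"
    have "\<exists>k. L = a (r (q k)) i" unfolding L_def by (rule LeastI_ex) auto
    then obtain k0 where k0: "L = a (r (q k0)) i" by blast
    have "a (r (q (k + k0))) i = L" for k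
    proof (rule antisym)
      show "a (r (q (k + k0))) i \<le> L" using dec k0 by (simp add: decseq_def)
      show "L \<le> a (r (q (k + k0))) i" unfolding L_def by (rule Least_le) auto
    qed
    hence "incseq (\<lambda>k. a (r (q (k + k0))) i)" by (simp add: incseq_def)
    moreover have "strict_mono (\<lambda>k. q (k + k0))" using q(1) by (simp add: strict_mono_def)
    ultimately show ?thesis by (intro exI[of _ "\<lambda>k. q (k + k0)"] conjI)
  next
    case True
    thus ?thesis using q(1) by (intro exI[of _ q] conjI)
  qed
  then obtain q' where q': "strict_mono q'" "incseq (\<lambda>k. a (r (q' k)) i)" by (elim exE conjE)
  have "incseq (\<lambda>k. a (r (q' k)) j)" if "j \<in> A" for j
    using r(2) that q'(1) unfolding incseq_def by (meson strict_mono_less_eq)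
  moreover have "strict_mono (\<lambda>k. r (q' k))" using r(1) q'(1) by (simp add: strict_mono_def)
  ultimately show ?case using q'(2) by (intro exI[of _ "\<lambda>k. r (q' k)"] conjI ballI) auto
qed

text \<open>If no finite \<open>B\<close> works, choosing greedily produces an infinite sequence in
  \<open>L\<close> in which no term lies above an earlier one. By \<open>Dickson_chain\<close> with
  all coordinates, some subsequence is increasing, a contradiction.\<close>

lemma Dickson:
  fixes L :: "('n::finite \<Rightarrow> nat) set"
  shows "\<exists>B. finite B \<and> B \<subseteq> L \<and> (\<forall>\<alpha>\<in>L. \<exists>\<beta>\<in>B. \<beta> \<le> \<alpha>)"
proof (rule ccontr)
  assume neg: "\<not> ?thesis"
  define g where "g B = (SOME \<alpha>. \<alpha> \<in> L \<and> (\<forall>\<beta>\<in>B. \<not> \<beta> \<le> \<alpha>))" for B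
  have g: "g B \<in> L \<and> (\<forall>\<beta>\<in>B. \<not> \<beta> \<le> g B)" if "finite B" "B \<subseteq> L" for B
  proof -
    have "\<not> (\<forall>\<alpha>\<in>L. \<exists>\<beta>\<in>B. \<beta> \<le> \<alpha>)" using neg that by simp
    hence "\<exists>\<alpha>. \<alpha> \<in> L \<and> (\<forall>\<beta>\<in>B. \<not> \<beta> \<le> \<alpha>)" by blast
    thus ?thesis unfolding g_def by (rule someI_ex)
  qed
  define S where "S = rec_nat {} (\<lambda>_ B. insert (g B) B)"
  have S0: "S 0 = {}" and SSuc: "S (Suc k) = insert (g (S k)) (S k)" for k
    by (simp_all add: S_def)
  have S: "finite (S k) \<and> S k \<subseteq> L" for k
    by (induction k) (simp_all add: S0 SSuc g)
  define a where "a k = g (S k)" for k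
  have Sa: "a k \<in> S m" if "k < m" for k m
    using that by (induction m) (auto simp: SSuc a_def less_Suc_eq)
  have bad: "\<not> a k \<le> a m" if "k < m" for k m
    using g[of "S m"] S[of m] Sa[OF that] by (auto simp: a_def)
  obtain r where r: "strict_mono r" "\<forall>i\<in>(UNIV::'n set). incseq (\<lambda>k. a (r k) i)"
    using Dickson_chain[of UNIV a] finite by blast
  have "a (r 0) \<le> a (r 1)" using r(2) by (auto simp: le_fun_def incseq_def)
  moreover have "r 0 < r 1" using r(1) by (simp add: strict_mono_less)
  ultimately show False using bad by blast
qed

section \<open>Power series with weighted absolutely summable coefficients\<close>

no_notation Infinite_Set_Sum.abs_summable_on (infix "abs'_summable'_on" 50)

definition ell1 :: "real \<Rightarrow> (('n::finite \<Rightarrow> nat) \<Rightarrow> real) \<Rightarrow> bool"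
  where "ell1 s c \<longleftrightarrow> (\<lambda>\<alpha>. \<bar>c \<alpha>\<bar> * weight s \<alpha>) summable_on UNIV"

definition wnorm :: "real \<Rightarrow> (('n::finite \<Rightarrow> nat) \<Rightarrow> real) \<Rightarrow> real"
  where "wnorm s c = (\<Sum>\<^sub>\<infinity>\<alpha>. \<bar>c \<alpha>\<bar> * weight s \<alpha>)"

definition pseries :: "(('n::finite \<Rightarrow> nat) \<Rightarrow> real) \<Rightarrow> real^'n \<Rightarrow> real"
  where "pseries c y = (\<Sum>\<^sub>\<infinity>\<alpha>. c \<alpha> * monomial y \<alpha>)"

lemma ell1_mono:
  assumes "s \<le> t" "ell1 s c" shows "ell1 t c"
  using assms(2) unfolding ell1_def
  by (rule summable_on_comparison_test)
     (auto intro!: mult_left_mono weight_antimono assms(1) simp: less_imp_le[OF weight_pos])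

lemma pseries_abs_summable:
  assumes "ell1 s c" "y \<in> polydisc s"
  shows "(\<lambda>\<alpha>. c \<alpha> * monomial y \<alpha>) abs_summable_on UNIV"
  using assms(1) unfolding ell1_def
  by (rule summable_on_comparison_test)
     (auto intro!: mult_left_mono monomial_le_weight assms(2) simp: abs_mult)

lemma pseries_has_sum:
  assumes "ell1 s c" "y \<in> polydisc s"
  shows "((\<lambda>\<alpha>. c \<alpha> * monomial y \<alpha>) has_sum pseries c y) UNIV"
  unfolding pseries_def
  by (rule has_sum_infsum) (rule abs_summable_summable[OF pseries_abs_summable[OF assms]])

section \<open>Expansion in a unitriangular family of series\<close>

lemma triangular_solve:
  fixes c :: "('n::finite \<Rightarrow> nat) \<Rightarrow> real"
  shows "\<exists>D. \<forall>\<gamma>. D \<gamma> = c \<gamma> - (\<Sum>\<alpha> | index_code \<alpha> < index_code \<gamma>. D \<alpha> * K \<alpha> \<gamma>)"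
proof -
  \<comment> \<open>\<open>D\<close> will be the coefficients of \<open>c\<close> in the family
    \<open>K\<close>, whose members have leading coefficient 1. Comparing coefficients at \<gamma>
    expresses \<open>D \<gamma>\<close> by the finitely many \<open>D \<alpha>\<close> of smaller
    code, so recursion along \<open>index_code\<close> defines it.\<close>
  define R :: "('n \<Rightarrow> nat) rel" where "R = Wellfounded.measure index_code"
  define F where "F D \<gamma> = c \<gamma> - (\<Sum>\<alpha> | index_code \<alpha> < index_code \<gamma>. D \<alpha> * K \<alpha> \<gamma>)" for D \<gamma>
  have "wfrec R F \<gamma> = c \<gamma> - (\<Sum>\<alpha> | index_code \<alpha> < index_code \<gamma>. wfrec R F \<alpha> * K \<alpha> \<gamma>)" for \<gamma>
  proof -
    have "wfrec R F \<gamma> = F (cut (wfrec R F) R \<gamma>) \<gamma>" by (rule wfrec) (simp add: R_def)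
    also have "\<dots> = c \<gamma> - (\<Sum>\<alpha> | index_code \<alpha> < index_code \<gamma>. wfrec R F \<alpha> * K \<alpha> \<gamma>)"
      unfolding F_def by (intro arg_cong2[where f=minus] sum.cong refl) (simp add: cut_def R_def)
    finally show ?thesis .
  qed
  thus ?thesis by blast
qed

text \<open>Since \<open>K \<alpha> \<alpha> = 1\<close>, the rest of \<open>K \<alpha>\<close> has
  norm at most half of \<open>weight s \<alpha>\<close>. In the sum of the triangular equations
  these tails cost at most half of the norm of \<open>D\<close>, which is absorbed on the left.
  Absorption requires a finite quantity, hence the truncation at codes up to
  \<open>M\<close>.\<close>

lemma triangular_ell1:
  fixes c D :: "('n::finite \<Rightarrow> nat) \<Rightarrow> real"
  assumes D: "\<And>\<gamma>. D \<gamma> = c \<gamma> - (\<Sum>\<alpha> | index_code \<alpha> < index_code \<gamma>. D \<alpha> * K \<alpha> \<gamma>)"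
    and c: "ell1 s c" and K: "\<And>\<alpha>. ell1 s (K \<alpha>)" "\<And>\<alpha>. wnorm s (K \<alpha>) \<le> 3/2 * weight s \<alpha>"
    and K1: "\<And>\<alpha>. K \<alpha> \<alpha> = 1"
  shows "ell1 s D"
  unfolding ell1_def
proof (rule nonneg_bdd_above_summable_on)
  show "0 \<le> \<bar>D \<gamma>\<bar> * weight s \<gamma>" for \<gamma> using weight_pos[of s \<gamma>] by simp
  have partial: "(\<Sum>\<gamma> | index_code \<gamma> \<le> M. \<bar>D \<gamma>\<bar> * weight s \<gamma>) \<le> 2 * wnorm s c" for M
  proof -
    let ?F = "{\<gamma>::'n\<Rightarrow>nat. index_code \<gamma> \<le> M}"
    have fin: "finite ?F" by (rule finite_index_code_le)
    have w0: "0 \<le> weight s \<gamma>" for \<gamma> :: "'n\<Rightarrow>nat" using weight_pos[of s \<gamma>] by simp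
    have "(\<Sum>\<gamma>\<in>?F. \<bar>D \<gamma>\<bar> * weight s \<gamma>) \<le> (\<Sum>\<gamma>\<in>?F. \<bar>c \<gamma>\<bar> * weight s \<gamma> +
        (\<Sum>\<alpha> | \<alpha> \<in> ?F \<and> index_code \<alpha> < index_code \<gamma>. \<bar>D \<alpha>\<bar> * (\<bar>K \<alpha> \<gamma>\<bar> * weight s \<gamma>)))"
    proof (rule sum_mono)
      fix \<gamma> assume "\<gamma> \<in> ?F"
      hence eq: "{\<alpha>. \<alpha> \<in> ?F \<and> index_code \<alpha> < index_code \<gamma>} = {\<alpha>. index_code \<alpha> < index_code \<gamma>}" by auto
      have "\<bar>D \<gamma>\<bar> \<le> \<bar>c \<gamma>\<bar> + (\<Sum>\<alpha> | index_code \<alpha> < index_code \<gamma>. \<bar>D \<alpha> * K \<alpha> \<gamma>\<bar>)"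
        by (subst D) (rule order_trans[OF abs_triangle_ineq4 add_left_mono[OF sum_abs]])
      hence "\<bar>D \<gamma>\<bar> * weight s \<gamma> \<le> (\<bar>c \<gamma>\<bar> + (\<Sum>\<alpha> | index_code \<alpha> < index_code \<gamma>. \<bar>D \<alpha> * K \<alpha> \<gamma>\<bar>)) * weight s \<gamma>"
        by (rule mult_right_mono) (rule w0)
      thus "\<bar>D \<gamma>\<bar> * weight s \<gamma> \<le> \<bar>c \<gamma>\<bar> * weight s \<gamma> +
        (\<Sum>\<alpha> | \<alpha> \<in> ?F \<and> index_code \<alpha> < index_code \<gamma>. \<bar>D \<alpha>\<bar> * (\<bar>K \<alpha> \<gamma>\<bar> * weight s \<gamma>))"
        unfolding eq by (simp add: distrib_right sum_distrib_right abs_mult mult.assoc)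
    qed
    also have "\<dots> = (\<Sum>\<gamma>\<in>?F. \<bar>c \<gamma>\<bar> * weight s \<gamma>) +
        (\<Sum>\<alpha>\<in>?F. \<Sum>\<gamma> | \<gamma> \<in> ?F \<and> index_code \<alpha> < index_code \<gamma>. \<bar>D \<alpha>\<bar> * (\<bar>K \<alpha> \<gamma>\<bar> * weight s \<gamma>))"
      unfolding sum.distrib by (rule arg_cong2[where f=plus, OF refl sum.swap_restrict[OF fin fin]])
    also have "\<dots> \<le> wnorm s c + (\<Sum>\<alpha>\<in>?F. \<bar>D \<alpha>\<bar> * (weight s \<alpha> / 2))"
    proof (intro add_mono sum_mono)
      show "(\<Sum>\<gamma>\<in>?F. \<bar>c \<gamma>\<bar> * weight s \<gamma>) \<le> wnorm s c"
        unfolding wnorm_def using c[unfolded ell1_def] fin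
        by (intro finite_sum_le_infsum) (auto simp: w0)
      fix \<alpha> assume "\<alpha> \<in> ?F"
      let ?G = "{\<gamma> \<in> ?F. index_code \<alpha> < index_code \<gamma>}"
      have finG: "finite ?G" using fin by simp
      have "(\<Sum>\<gamma>\<in>insert \<alpha> ?G. \<bar>K \<alpha> \<gamma>\<bar> * weight s \<gamma>) \<le> wnorm s (K \<alpha>)"
        unfolding wnorm_def using K(1)[unfolded ell1_def] finG
        by (intro finite_sum_le_infsum) (auto simp: w0)
      hence "weight s \<alpha> + (\<Sum>\<gamma>\<in>?G. \<bar>K \<alpha> \<gamma>\<bar> * weight s \<gamma>) \<le> 3/2 * weight s \<alpha>"
        using K(2)[of \<alpha>] finG by (simp add: K1)
      hence "(\<Sum>\<gamma>\<in>?G. \<bar>K \<alpha> \<gamma>\<bar> * weight s \<gamma>) \<le> weight s \<alpha> / 2" by simp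
      hence "\<bar>D \<alpha>\<bar> * (\<Sum>\<gamma>\<in>?G. \<bar>K \<alpha> \<gamma>\<bar> * weight s \<gamma>) \<le> \<bar>D \<alpha>\<bar> * (weight s \<alpha> / 2)"
        by (rule mult_left_mono) simp
      thus "(\<Sum>\<gamma>\<in>?G. \<bar>D \<alpha>\<bar> * (\<bar>K \<alpha> \<gamma>\<bar> * weight s \<gamma>)) \<le> \<bar>D \<alpha>\<bar> * (weight s \<alpha> / 2)"
        by (simp add: sum_distrib_left)
    qed
    also have "(\<Sum>\<alpha>\<in>?F. \<bar>D \<alpha>\<bar> * (weight s \<alpha> / 2)) = (\<Sum>\<alpha>\<in>?F. \<bar>D \<alpha>\<bar> * weight s \<alpha>) / 2"
      by (simp add: sum_divide_distrib)
    finally show ?thesis by simp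
  qed
  show "bdd_above (sum (\<lambda>\<gamma>. \<bar>D \<gamma>\<bar> * weight s \<gamma>) ` {F. F \<subseteq> UNIV \<and> finite F})"
  proof (rule bdd_aboveI2)
    fix F :: "('n \<Rightarrow> nat) set" assume "F \<in> {F. F \<subseteq> UNIV \<and> finite F}"
    hence fin: "finite F" by simp
    define M where "M = Max (insert 0 (index_code ` F))"
    have "F \<subseteq> {\<gamma>. index_code \<gamma> \<le> M}" using fin by (auto simp: M_def)
    hence "sum (\<lambda>\<gamma>. \<bar>D \<gamma>\<bar> * weight s \<gamma>) F \<le> (\<Sum>\<gamma> | index_code \<gamma> \<le> M. \<bar>D \<gamma>\<bar> * weight s \<gamma>)"
      by (intro sum_mono2 finite_index_code_le) (auto simp: less_imp_le[OF weight_pos])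
    thus "sum (\<lambda>\<gamma>. \<bar>D \<gamma>\<bar> * weight s \<gamma>) F \<le> 2 * wnorm s c" using partial[of M] by simp
  qed
qed

text \<open>The double series of
  \<open>D \<alpha> * K \<alpha> \<gamma> * monomial y \<gamma>\<close> converges absolutely. Its
  row sums are the terms \<open>D \<alpha> * pseries (K \<alpha>) y\<close>, and its column sums are
  the terms of \<open>pseries c y\<close> by the triangular equations. Interchanging the order of
  summation gives the expansion.\<close>

lemma triangular_division:
  fixes c :: "('n::finite \<Rightarrow> nat) \<Rightarrow> real"
  assumes c: "ell1 s c" and K: "\<And>\<alpha>. ell1 s (K \<alpha>)" "\<And>\<alpha>. wnorm s (K \<alpha>) \<le> 3/2 * weight s \<alpha>"
    and K1: "\<And>\<alpha>. K \<alpha> \<alpha> = 1" and K0: "\<And>\<alpha> \<gamma>. \<gamma> \<noteq> \<alpha> \<Longrightarrow> K \<alpha> \<gamma> \<noteq> 0 \<Longrightarrow> index_code \<alpha> < index_code \<gamma>"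
  shows "\<exists>D. ell1 s D \<and> (\<forall>y\<in>polydisc s. ((\<lambda>\<alpha>. D \<alpha> * pseries (K \<alpha>) y) has_sum pseries c y) UNIV)"
proof -
  obtain D where D: "\<And>\<gamma>. D \<gamma> = c \<gamma> - (\<Sum>\<alpha> | index_code \<alpha> < index_code \<gamma>. D \<alpha> * K \<alpha> \<gamma>)"
    using triangular_solve[of c K] by blast
  have Dl: "ell1 s D" by (rule triangular_ell1[OF D c K K1])
  have w0: "0 \<le> weight s \<gamma>" for \<gamma> :: "'n\<Rightarrow>nat" using weight_pos[of s \<gamma>] by simp
  have "((\<lambda>\<alpha>. D \<alpha> * pseries (K \<alpha>) y) has_sum pseries c y) UNIV" if y: "y \<in> polydisc s" for y
  proof -
    define f where "f \<alpha> \<gamma> = D \<alpha> * K \<alpha> \<gamma> * monomial y \<gamma>" for \<alpha> \<gamma>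
    have "(\<lambda>(\<alpha>,\<gamma>). \<bar>D \<alpha>\<bar> * (\<bar>K \<alpha> \<gamma>\<bar> * weight s \<gamma>)) summable_on UNIV \<times> UNIV"
    proof (rule summable_on_SigmaI)
      show "((\<lambda>\<gamma>. case (\<alpha>,\<gamma>) of (\<alpha>,\<gamma>) \<Rightarrow> \<bar>D \<alpha>\<bar> * (\<bar>K \<alpha> \<gamma>\<bar> * weight s \<gamma>)) has_sum (\<bar>D \<alpha>\<bar> * wnorm s (K \<alpha>))) UNIV" for \<alpha>
        using K(1)[of \<alpha>] by (auto simp: ell1_def wnorm_def intro!: has_sum_cmult_right)
      have "(\<lambda>\<alpha>. 3/2 * (\<bar>D \<alpha>\<bar> * weight s \<alpha>)) summable_on UNIV"
        by (rule summable_on_cmult_right[OF Dl[unfolded ell1_def]])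
      thus "(\<lambda>\<alpha>. \<bar>D \<alpha>\<bar> * wnorm s (K \<alpha>)) summable_on UNIV"
      proof (rule summable_on_comparison_test)
        fix \<alpha>
        have "\<bar>D \<alpha>\<bar> * wnorm s (K \<alpha>) \<le> \<bar>D \<alpha>\<bar> * (3/2 * weight s \<alpha>)" by (intro mult_left_mono K) auto
        thus "\<bar>D \<alpha>\<bar> * wnorm s (K \<alpha>) \<le> 3/2 * (\<bar>D \<alpha>\<bar> * weight s \<alpha>)" by simp
        show "0 \<le> \<bar>D \<alpha>\<bar> * wnorm s (K \<alpha>)"
          unfolding wnorm_def by (auto intro!: mult_nonneg_nonneg infsum_nonneg w0)
      qed
    qed (auto intro!: mult_nonneg_nonneg w0)
    hence "(\<lambda>p. f (fst p) (snd p)) abs_summable_on UNIV \<times> UNIV"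
      by (rule summable_on_comparison_test)
         (auto simp: f_def abs_mult mult.assoc intro!: mult_left_mono monomial_le_weight[OF y])
    hence sm: "(\<lambda>(\<alpha>,\<gamma>). f \<alpha> \<gamma>) abs_summable_on UNIV \<times> UNIV" by (simp add: case_prod_beta)
    have row: "(\<Sum>\<^sub>\<infinity>\<gamma>. f \<alpha> \<gamma>) = D \<alpha> * pseries (K \<alpha>) y" for \<alpha>
      unfolding f_def pseries_def by (simp add: mult.assoc infsum_cmult_right')
    have col: "(\<Sum>\<^sub>\<infinity>\<alpha>. f \<alpha> \<gamma>) = c \<gamma> * monomial y \<gamma>" for \<gamma>
    proof -
      let ?A = "insert \<gamma> {\<alpha>. index_code \<alpha> < index_code \<gamma>}"
      have fin: "finite {\<alpha>::'n \<Rightarrow> nat. index_code \<alpha> < index_code \<gamma>}" by (rule finite_index_code_less)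
      have "K \<alpha> \<gamma> = 0" if "\<alpha> \<notin> ?A" for \<alpha> using K0[of \<gamma> \<alpha>] that by blast
      hence "(\<Sum>\<^sub>\<infinity>\<alpha>. f \<alpha> \<gamma>) = (\<Sum>\<^sub>\<infinity>\<alpha>\<in>?A. f \<alpha> \<gamma>)"
        by (intro infsum_cong_neutral) (simp_all add: f_def)
      also have "\<dots> = (\<Sum>\<alpha>\<in>?A. f \<alpha> \<gamma>)" using fin by simp
      also have "\<dots> = (D \<gamma> + (\<Sum>\<alpha> | index_code \<alpha> < index_code \<gamma>. D \<alpha> * K \<alpha> \<gamma>)) * monomial y \<gamma>"
        using fin
        by (simp add: f_def K1 distrib_right sum_distrib_right)
      also have "\<dots> = c \<gamma> * monomial y \<gamma>" using D[of \<gamma>] by simp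
      finally show ?thesis .
    qed
    have sm': "(\<lambda>(\<alpha>,\<gamma>). f \<alpha> \<gamma>) summable_on UNIV \<times> UNIV" by (rule abs_summable_summable[OF sm])
    have "(\<lambda>\<alpha>. \<Sum>\<^sub>\<infinity>\<gamma>. f \<alpha> \<gamma>) summable_on UNIV"
      using summable_on_Sigma_banach[OF sm'] by simp
    hence "((\<lambda>\<alpha>. \<Sum>\<^sub>\<infinity>\<gamma>. f \<alpha> \<gamma>) has_sum (\<Sum>\<^sub>\<infinity>\<alpha>. \<Sum>\<^sub>\<infinity>\<gamma>. f \<alpha> \<gamma>)) UNIV" by (rule has_sum_infsum)
    also have "(\<Sum>\<^sub>\<infinity>\<alpha>. \<Sum>\<^sub>\<infinity>\<gamma>. f \<alpha> \<gamma>) = pseries c y"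
      by (subst infsum_swap_banach[OF sm']) (simp add: col pseries_def)
    finally show ?thesis by (simp add: row)
  qed
  thus ?thesis using Dl by blast
qed

section \<open>Multiplication by monomials and the Noetherian bound\<close>

definition shift :: "('n \<Rightarrow> nat) \<Rightarrow> (('n \<Rightarrow> nat) \<Rightarrow> real) \<Rightarrow> ('n \<Rightarrow> nat) \<Rightarrow> real"
  where "shift \<delta> g \<gamma> = (if \<delta> \<le> \<gamma> then g (\<lambda>i. \<gamma> i - \<delta> i) else 0)"

lemma shift_has_sum:
  assumes "((\<lambda>\<gamma>. g \<gamma> * F (\<lambda>i. \<delta> i + \<gamma> i)) has_sum S) UNIV"
  shows "((\<lambda>\<gamma>. shift \<delta> g \<gamma> * F \<gamma>) has_sum S) UNIV"
proof -
  define h where "h \<gamma> = (\<lambda>i. \<delta> i + \<gamma> i)" for \<gamma> :: "'a \<Rightarrow> nat"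
  have inj: "inj h" unfolding h_def inj_def by (auto simp: fun_eq_iff)
  have "((\<lambda>\<gamma>. shift \<delta> g \<gamma> * F \<gamma>) has_sum S) (range h)"
    unfolding has_sum_reindex[OF inj] using assms
    by (simp add: o_def h_def shift_def le_fun_def)
  moreover have "shift \<delta> g \<gamma> = 0" if "\<gamma> \<notin> range h" for \<gamma>
  proof -
    have "\<not> \<delta> \<le> \<gamma>"
    proof
      assume "\<delta> \<le> \<gamma>"
      hence "\<gamma> = h (\<lambda>i. \<gamma> i - \<delta> i)" by (auto simp: h_def fun_eq_iff le_fun_def)
      thus False using that by blast
    qed
    thus ?thesis by (simp add: shift_def)
  qed
  ultimately show ?thesis
    by (subst has_sum_cong_neutral[where T = "range h" and g = "\<lambda>\<gamma>. shift \<delta> g \<gamma> * F \<gamma>"]) auto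
qed

lemma shift_wnorm:
  assumes "ell1 s g"
  shows "ell1 s (shift \<delta> g)" "wnorm s (shift \<delta> g) = weight s \<delta> * wnorm s g"
proof -
  have "((\<lambda>\<gamma>. weight s \<delta> * (\<bar>g \<gamma>\<bar> * weight s \<gamma>)) has_sum (weight s \<delta> * wnorm s g)) UNIV"
    using assms unfolding ell1_def wnorm_def by (intro has_sum_cmult_right has_sum_infsum)
  hence "((\<lambda>\<gamma>. \<bar>g \<gamma>\<bar> * weight s (\<lambda>i. \<delta> i + \<gamma> i)) has_sum (weight s \<delta> * wnorm s g)) UNIV"
    by (simp add: weight_add mult_ac)
  hence "((\<lambda>\<gamma>. shift \<delta> (\<lambda>\<gamma>. \<bar>g \<gamma>\<bar>) \<gamma> * weight s \<gamma>) has_sum (weight s \<delta> * wnorm s g)) UNIV"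
    by (rule shift_has_sum)
  moreover have "shift \<delta> (\<lambda>\<gamma>. \<bar>g \<gamma>\<bar>) \<gamma> = \<bar>shift \<delta> g \<gamma>\<bar>" for \<gamma> by (simp add: shift_def)
  ultimately have "((\<lambda>\<gamma>. \<bar>shift \<delta> g \<gamma>\<bar> * weight s \<gamma>) has_sum (weight s \<delta> * wnorm s g)) UNIV" by simp
  thus "ell1 s (shift \<delta> g)" "wnorm s (shift \<delta> g) = weight s \<delta> * wnorm s g"
    unfolding ell1_def wnorm_def by (auto simp: has_sum_iff)
qed

lemma pseries_shift:
  assumes "ell1 s g" "y \<in> polydisc s"
  shows "pseries (shift \<delta> g) y = monomial y \<delta> * pseries g y"
proof -
  have "((\<lambda>\<gamma>. monomial y \<delta> * (g \<gamma> * monomial y \<gamma>)) has_sum (monomial y \<delta> * pseries g y)) UNIV"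
    by (intro has_sum_cmult_right pseries_has_sum[OF assms])
  hence "((\<lambda>\<gamma>. g \<gamma> * monomial y (\<lambda>i. \<delta> i + \<gamma> i)) has_sum (monomial y \<delta> * pseries g y)) UNIV"
    by (simp add: monomial_add mult_ac)
  hence "((\<lambda>\<gamma>. shift \<delta> g \<gamma> * monomial y \<gamma>) has_sum (monomial y \<delta> * pseries g y)) UNIV"
    by (rule shift_has_sum)
  thus ?thesis unfolding pseries_def by (rule infsumI)
qed

lemma ell1_scale: "ell1 s c \<Longrightarrow> ell1 s (\<lambda>\<alpha>. k * c \<alpha>)"
  unfolding ell1_def abs_mult mult.assoc by (rule summable_on_cmult_right)

lemma pseries_scale: "pseries (\<lambda>\<alpha>. k * c \<alpha>) y = k * pseries c y"
  unfolding pseries_def mult.assoc by (rule infsum_cmult_right')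

text \<open>Codes are integers, so beyond the leading code \<open>m\<close> they are at least
  \<open>m + 1\<close>. Raising \<open>s\<close> thus shrinks the tail like
  \<open>(m + 1) powr (- s)\<close>, faster than the leading weight
  \<open>m powr (- s)\<close>.\<close>

lemma wnorm_leading_term:
  assumes g: "ell1 s0 g" "g \<beta> = 1" and supp: "\<And>\<gamma>. \<gamma> \<noteq> \<beta> \<Longrightarrow> g \<gamma> \<noteq> 0 \<Longrightarrow> index_code \<beta> < index_code \<gamma>"
  shows "\<forall>\<^sub>F s in at_top. wnorm s g \<le> 3/2 * weight s \<beta>"
proof -
  define m where "m = real (index_code \<beta>)"
  have m: "m \<ge> 1" unfolding m_def using index_code_ge_1[of \<beta>] by simp
  \<comment> \<open>\<open>A * (m / (m + 1)) powr s\<close> is the resulting bound for the ratio of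
    the tail to the leading weight. Once it is below 1/2, the norm is at most 3/2 of that
    weight.\<close>
  define A where "A = wnorm s0 g * (m + 1) powr s0"
  have "((\<lambda>s. A * (m / (m + 1)) powr s) \<longlongrightarrow> 0) at_top"
    using m by real_asymp
  hence "\<forall>\<^sub>F s in at_top. A * (m / (m + 1)) powr s < 1/2"
    by (rule order_tendstoD) simp
  moreover have "\<forall>\<^sub>F s in at_top. s \<ge> s0" by (rule eventually_ge_at_top)
  ultimately show ?thesis
  proof eventually_elim
    case (elim s)
    let ?q = "(m + 1) powr (- (s - s0))"
    have le: "\<bar>g \<gamma>\<bar> * weight s \<gamma> \<le> (if \<gamma> = \<beta> then weight s \<beta> else 0) + ?q * (\<bar>g \<gamma>\<bar> * weight s0 \<gamma>)" for \<gamma>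
    proof (cases "\<gamma> = \<beta> \<or> g \<gamma> = 0")
      case True
      thus ?thesis using g(2) weight_pos[of s0 \<gamma>] by auto
    next
      case False
      hence "m + 1 \<le> real (index_code \<gamma>)" using supp[of \<gamma>] unfolding m_def by linarith
      hence "real (index_code \<gamma>) powr (- (s - s0)) \<le> ?q"
        using m elim(2) by (intro powr_mono2') auto
      moreover have "weight s \<gamma> = real (index_code \<gamma>) powr (- (s - s0)) * weight s0 \<gamma>"
        unfolding weight_def by (simp flip: powr_add)
      ultimately have "weight s \<gamma> \<le> ?q * weight s0 \<gamma>" using weight_pos[of s0 \<gamma>] by simp
      hence "\<bar>g \<gamma>\<bar> * weight s \<gamma> \<le> \<bar>g \<gamma>\<bar> * (?q * weight s0 \<gamma>)" by (rule mult_left_mono) simp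
      thus ?thesis using False by (simp add: mult_ac)
    qed
    have single: "((\<lambda>\<gamma>. if \<gamma> = \<beta> then weight s \<beta> else 0) has_sum weight s \<beta>) UNIV"
      by (rule has_sum_finite_neutralI[of "{\<beta>}"]) auto
    have tail: "((\<lambda>\<gamma>. ?q * (\<bar>g \<gamma>\<bar> * weight s0 \<gamma>)) has_sum (?q * wnorm s0 g)) UNIV"
      unfolding wnorm_def using g(1)[unfolded ell1_def] by (intro has_sum_cmult_right has_sum_infsum)
    have "((\<lambda>\<gamma>. \<bar>g \<gamma>\<bar> * weight s \<gamma>) has_sum wnorm s g) UNIV"
      unfolding wnorm_def using ell1_mono[OF elim(2) g(1)] by (simp add: ell1_def)
    hence "wnorm s g \<le> weight s \<beta> + ?q * wnorm s0 g"
      by (rule has_sum_mono[OF _ has_sum_add[OF single tail]]) (rule le)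
    also have "?q * wnorm s0 g = (A * (m / (m + 1)) powr s) * weight s \<beta>"
    proof -
      have "(m / (m + 1)) powr s * m powr (- s) = (m + 1) powr (- s)"
        using m by (simp add: powr_divide powr_minus field_simps)
      moreover have "?q = (m + 1) powr (- s) * (m + 1) powr s0" by (simp flip: powr_add)
      ultimately show ?thesis unfolding A_def weight_def m_def[symmetric] by simp
    qed
    also have "\<dots> \<le> 1/2 * weight s \<beta>" using elim(1) weight_pos[of s \<beta>] by (intro mult_right_mono) auto
    finally show ?case by simp
  qed
qed

lemma leading_index:
  assumes "R \<gamma> \<noteq> (0::real)"
  obtains \<alpha> where "R \<alpha> \<noteq> 0" "\<And>\<gamma>. \<gamma> \<noteq> \<alpha> \<Longrightarrow> R \<gamma> \<noteq> 0 \<Longrightarrow> index_code \<alpha> < index_code \<gamma>"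
proof -
  obtain \<alpha> where "R \<alpha> \<noteq> 0" "\<And>\<gamma>. R \<gamma> \<noteq> 0 \<Longrightarrow> index_code \<alpha> \<le> index_code \<gamma>"
    using ex_has_least_nat[of "\<lambda>\<alpha>. R \<alpha> \<noteq> 0" \<gamma> index_code] assms by auto
  thus ?thesis using that inj_index_code by (metis injD le_neq_implies_less)
qed

lemma finite_upper_bound: "finite B \<Longrightarrow> \<exists>M::'a::linorder. M \<ge> a \<and> (\<forall>b\<in>B. f b \<le> M)"
  by (rule exI[of _ "Max (insert a (f ` B))"]) auto

text \<open>Hironaka division, with the ideal generated by the \<open>c k\<close> replaced by the set of all series that are
  bounded near \<open>0\<close> by finitely many \<open>\<bar>pseries (c j) y\<bar>\<close>. Dickson's lemma yields finitely many members \<open>g \<beta>\<close> whose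
  leading monomials divide the leading monomial of every other member. Dividing \<open>c k\<close> by them leaves a
  remainder with no monomial divisible by these; being itself a member, it vanishes.\<close>

lemma pseries_noetherian:
  fixes c :: "nat \<Rightarrow> ('n::finite \<Rightarrow> nat) \<Rightarrow> real"
  assumes c: "\<And>k s. s > s1 \<Longrightarrow> ell1 s (c k)"
  shows "\<exists>N s. s > s1 \<and> (\<forall>k. \<exists>C. \<forall>y\<in>polydisc s. \<bar>pseries (c k) y\<bar> \<le> C * (\<Sum>j<N. \<bar>pseries (c j) y\<bar>))"
proof -
  define S where "S N y = (\<Sum>j<N. \<bar>pseries (c j) y\<bar>)" for N y
  have S0: "0 \<le> S N y" for N y unfolding S_def by (rule sum_nonneg) simp
  have S_mono: "S N y \<le> S M y" if "N \<le> M" for N M y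
    unfolding S_def using that by (intro sum_mono2) auto
  define dom where "dom s g N C \<longleftrightarrow> s > s1 \<and> ell1 s g \<and> C \<ge> 0 \<and> (\<forall>y\<in>polydisc s. \<bar>pseries g y\<bar> \<le> C * S N y)"
    for s g N C
  define L where "L = {\<alpha>. \<exists>g. (\<exists>s N C. dom s g N C) \<and> g \<alpha> = 1 \<and>
     (\<forall>\<gamma>. \<gamma> \<noteq> \<alpha> \<longrightarrow> g \<gamma> \<noteq> 0 \<longrightarrow> index_code \<alpha> < index_code \<gamma>)}"
  obtain B where B: "finite B" "B \<subseteq> L" "\<And>\<alpha>. \<alpha> \<in> L \<Longrightarrow> \<exists>\<beta>\<in>B. \<beta> \<le> \<alpha>"
    using Dickson[of L] by blast
  have "\<forall>\<beta>\<in>B. \<exists>g s N C. dom s g N C \<and> g \<beta> = 1 \<and> (\<forall>\<gamma>. \<gamma> \<noteq> \<beta> \<longrightarrow> g \<gamma> \<noteq> 0 \<longrightarrow> index_code \<beta> < index_code \<gamma>)"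
    using B(2) unfolding L_def by blast
  then obtain g s' N' C' where g: "\<And>\<beta>. \<beta> \<in> B \<Longrightarrow> dom (s' \<beta>) (g \<beta>) (N' \<beta>) (C' \<beta>)"
      "\<And>\<beta>. \<beta> \<in> B \<Longrightarrow> g \<beta> \<beta> = 1"
      "\<And>\<beta> \<gamma>. \<beta> \<in> B \<Longrightarrow> \<gamma> \<noteq> \<beta> \<Longrightarrow> g \<beta> \<gamma> \<noteq> 0 \<Longrightarrow> index_code \<beta> < index_code \<gamma>"
    by metis
  obtain s0 where s0: "s0 \<ge> s1" "\<And>\<beta>. \<beta> \<in> B \<Longrightarrow> s' \<beta> \<le> s0"
    using finite_upper_bound[OF B(1), of s1 s'] by blast
  obtain N where N: "\<And>\<beta>. \<beta> \<in> B \<Longrightarrow> N' \<beta> \<le> N"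
    using finite_upper_bound[OF B(1), of 0 N'] by blast
  obtain C0 where C0: "C0 \<ge> 0" "\<And>\<beta>. \<beta> \<in> B \<Longrightarrow> C' \<beta> \<le> C0"
    using finite_upper_bound[OF B(1), of 0 C'] by blast
  have "\<forall>\<^sub>F s in at_top. \<forall>\<beta>\<in>B. wnorm s (g \<beta>) \<le> 3/2 * weight s \<beta>"
  proof (intro eventually_ball_finite B ballI)
    fix \<beta> assume "\<beta> \<in> B"
    thus "\<forall>\<^sub>F s in at_top. wnorm s (g \<beta>) \<le> 3/2 * weight s \<beta>"
      using g[of \<beta>] by (intro wnorm_leading_term[of "s' \<beta>"]) (auto simp: dom_def)
  qed
  moreover have "\<forall>\<^sub>F s in at_top. s > s0" by (rule eventually_gt_at_top)
  ultimately have "\<forall>\<^sub>F s in at_top. s > s0 \<and> (\<forall>\<beta>\<in>B. wnorm s (g \<beta>) \<le> 3/2 * weight s \<beta>)"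
    by eventually_elim auto
  then obtain s where s: "s > s0" "\<And>\<beta>. \<beta> \<in> B \<Longrightarrow> wnorm s (g \<beta>) \<le> 3/2 * weight s \<beta>"
    unfolding eventually_at_top_linorder by blast
  have gl: "ell1 s (g \<beta>)" if "\<beta> \<in> B" for \<beta>
    using g(1)[OF that] s0(2)[OF that] s(1) by (auto simp: dom_def intro: ell1_mono[of "s' \<beta>"])
  have gS: "\<bar>pseries (g \<beta>) y\<bar> \<le> C0 * S N y" if "\<beta> \<in> B" "y \<in> polydisc s" for \<beta> y
  proof -
    have "y \<in> polydisc (s' \<beta>)" using that s0(2)[of \<beta>] s(1) polydisc_mono[of "s' \<beta>" s] by auto
    hence "\<bar>pseries (g \<beta>) y\<bar> \<le> C' \<beta> * S (N' \<beta>) y" using g(1)[OF that(1)] by (auto simp: dom_def)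
    also have "\<dots> \<le> C0 * S N y" using C0 N that(1) S_mono S0 by (intro mult_mono) auto
    finally show ?thesis .
  qed
  define \<Delta> where "\<Delta> = {\<alpha>. \<exists>\<beta>\<in>B. \<beta> \<le> \<alpha>}"
  define b where "b \<alpha> = (SOME \<beta>. \<beta> \<in> B \<and> \<beta> \<le> \<alpha>)" for \<alpha>
  have b: "b \<alpha> \<in> B" "b \<alpha> \<le> \<alpha>" if "\<alpha> \<in> \<Delta>" for \<alpha>
    using someI_ex[of "\<lambda>\<beta>. \<beta> \<in> B \<and> \<beta> \<le> \<alpha>"] that unfolding \<Delta>_def b_def by blast+
  define d where "d \<alpha> = (\<lambda>i. \<alpha> i - b \<alpha> i)" for \<alpha>
  have d: "(\<lambda>i. d \<alpha> i + b \<alpha> i) = \<alpha>" "(\<lambda>i. \<alpha> i - d \<alpha> i) = b \<alpha>" "d \<alpha> \<le> \<alpha>" if "\<alpha> \<in> \<Delta>" for \<alpha>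
    using b(2)[OF that] by (auto simp: d_def le_fun_def fun_eq_iff)
  define one where "one \<gamma> = (if \<gamma> = (\<lambda>_. 0) then 1 else (0::real))" for \<gamma> :: "'n \<Rightarrow> nat"
  have one: "((\<lambda>\<gamma>. one \<gamma> * F \<gamma>) has_sum F (\<lambda>_. 0)) UNIV" for F
    by (rule has_sum_finite_neutralI[of "{\<lambda>_. 0}"]) (auto simp: one_def)
  have one_abs: "\<bar>one \<gamma>\<bar> = one \<gamma>" for \<gamma> by (simp add: one_def)
  have ell1_one: "ell1 s one" "wnorm s one = 1"
    using one[of "weight s"] by (simp_all add: ell1_def wnorm_def one_abs has_sum_iff weight_prod)
  have pseries_one: "pseries one y = 1" for y
    using one[of "monomial y"] by (simp add: pseries_def has_sum_iff monomial_def)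
  \<comment> \<open>Every exponent \<alpha> gets a series with leading monomial \<alpha>: a monomial
    multiple of a chosen member \<open>g (b \<alpha>)\<close> if \<alpha> is divisible by a
    generator, the bare monomial otherwise. Expanding \<open>c k\<close> in this family splits it
    into a divisible part and a remainder \<open>R\<close>.\<close>
  define K where "K \<alpha> = (if \<alpha> \<in> \<Delta> then shift (d \<alpha>) (g (b \<alpha>)) else shift \<alpha> one)" for \<alpha>
  have Kl: "ell1 s (K \<alpha>)" for \<alpha>
    by (simp add: K_def shift_wnorm(1)[OF gl[OF b(1)]] shift_wnorm(1)[OF ell1_one(1)])
  have Kn: "wnorm s (K \<alpha>) \<le> 3/2 * weight s \<alpha>" for \<alpha>
  proof (cases "\<alpha> \<in> \<Delta>")
    case True
    have "wnorm s (K \<alpha>) = weight s (d \<alpha>) * wnorm s (g (b \<alpha>))"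
      using True shift_wnorm(2)[OF gl[OF b(1)[OF True]]] by (simp add: K_def)
    also have "\<dots> \<le> weight s (d \<alpha>) * (3/2 * weight s (b \<alpha>))"
      using s(2)[OF b(1)[OF True]] weight_pos[of s "d \<alpha>"] by (intro mult_left_mono) auto
    also have "\<dots> = 3/2 * weight s \<alpha>" using weight_add[of s "d \<alpha>" "b \<alpha>"] d(1)[OF True] by simp
    finally show ?thesis .
  next
    case False
    thus ?thesis using shift_wnorm(2)[OF ell1_one(1)] ell1_one(2) weight_pos[of s \<alpha>] by (simp add: K_def)
  qed
  have K1: "K \<alpha> \<alpha> = 1" for \<alpha>
    using g(2)[OF b(1)] d(2,3) by (auto simp: K_def shift_def one_def)
  have K0: "index_code \<alpha> < index_code \<gamma>" if "\<gamma> \<noteq> \<alpha>" "K \<alpha> \<gamma> \<noteq> 0" for \<alpha> \<gamma>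
  proof (cases "\<alpha> \<in> \<Delta>")
    case True
    define \<gamma>' where "\<gamma>' = (\<lambda>i. \<gamma> i - d \<alpha> i)"
    have le: "d \<alpha> \<le> \<gamma>" and nz: "g (b \<alpha>) \<gamma>' \<noteq> 0"
      using that(2) True by (auto simp: K_def shift_def \<gamma>'_def split: if_splits)
    have \<gamma>: "(\<lambda>i. d \<alpha> i + \<gamma>' i) = \<gamma>" using le by (auto simp: \<gamma>'_def le_fun_def)
    have "\<gamma>' \<noteq> b \<alpha>" using that(1) \<gamma> d(1)[OF True] by auto
    hence "index_code (b \<alpha>) < index_code \<gamma>'" using g(3)[OF b(1)[OF True]] nz by blast
    hence "index_code (d \<alpha>) * index_code (b \<alpha>) < index_code (d \<alpha>) * index_code \<gamma>'" using index_code_pos[of "d \<alpha>"] by simp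
    thus ?thesis using index_code_add[of "d \<alpha>" "b \<alpha>"] index_code_add[of "d \<alpha>" \<gamma>'] \<gamma> d(1)[OF True] by simp
  next
    case False
    hence "\<alpha> \<le> \<gamma>" "(\<lambda>i. \<gamma> i - \<alpha> i) = (\<lambda>_. 0)"
      using that(2) by (auto simp: K_def shift_def one_def split: if_splits)
    hence "\<gamma> = \<alpha>" by (auto simp: fun_eq_iff le_fun_def intro: antisym)
    thus ?thesis using that(1) by simp
  qed
  have "\<exists>C. \<forall>y\<in>polydisc s. \<bar>pseries (c k) y\<bar> \<le> C * S N y" for k
  proof -
    have ck: "ell1 s (c k)" using c s(1) s0(1) by simp
    obtain D where D: "ell1 s D" "\<And>y. y \<in> polydisc s \<Longrightarrow> ((\<lambda>\<alpha>. D \<alpha> * pseries (K \<alpha>) y) has_sum pseries (c k) y) UNIV"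
      using triangular_division[OF ck Kl Kn K1 K0] by blast
    define R where "R \<alpha> = (if \<alpha> \<in> \<Delta> then 0 else D \<alpha>)" for \<alpha>
    have Rl: "ell1 s R"
      using D(1) unfolding ell1_def
      by (rule summable_on_comparison_test) (auto simp: R_def less_imp_le[OF weight_pos])
    \<comment> \<open>A divisible term has size at most
      \<open>weight s (d \<alpha>) * C0 * S N y\<close>, and \<open>weight s (d \<alpha>)\<close> is
      \<open>weight s \<alpha> / weight s (b \<alpha>)\<close>. The sum over \<open>B\<close> bounds
      the reciprocal independently of \<alpha>, and the remaining sum over \<alpha> is
      \<open>wnorm s D\<close>.\<close>
    define Q where "Q = (\<Sum>\<beta>\<in>B. inverse (weight s \<beta>)) * C0 * wnorm s D"
    have Q: "\<bar>pseries (c k) y - pseries R y\<bar> \<le> Q * S N y" if y: "y \<in> polydisc s" for y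
    proof -
      have "((\<lambda>\<alpha>. D \<alpha> * pseries (K \<alpha>) y - R \<alpha> * monomial y \<alpha>) has_sum (pseries (c k) y - pseries R y)) UNIV"
        using has_sum_add[OF D(2)[OF y] has_sum_uminusI[OF pseries_has_sum[OF Rl y]]] by simp
      moreover have "((\<lambda>\<alpha>. ((\<Sum>\<beta>\<in>B. inverse (weight s \<beta>)) * C0 * S N y) * (\<bar>D \<alpha>\<bar> * weight s \<alpha>)) has_sum
          (((\<Sum>\<beta>\<in>B. inverse (weight s \<beta>)) * C0 * S N y) * wnorm s D)) UNIV" (is "(?f has_sum ?b) UNIV")
        unfolding wnorm_def using D(1)[unfolded ell1_def] by (intro has_sum_cmult_right has_sum_infsum)
      moreover have "norm (D \<alpha> * pseries (K \<alpha>) y - R \<alpha> * monomial y \<alpha>) \<le> ?f \<alpha>" for \<alpha>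
      proof (cases "\<alpha> \<in> \<Delta>")
        case True
        have "\<bar>pseries (K \<alpha>) y\<bar> = \<bar>monomial y (d \<alpha>)\<bar> * \<bar>pseries (g (b \<alpha>)) y\<bar>"
          using True pseries_shift[OF gl[OF b(1)[OF True]] y] by (simp add: K_def abs_mult)
        also have "\<dots> \<le> weight s (d \<alpha>) * (C0 * S N y)"
          using monomial_le_weight[OF y] gS[OF b(1)[OF True] y] less_imp_le[OF weight_pos] by (intro mult_mono) auto
        also have "weight s (d \<alpha>) = inverse (weight s (b \<alpha>)) * weight s \<alpha>"
          using weight_add[of s "d \<alpha>" "b \<alpha>"] d(1)[OF True] weight_pos[of s "b \<alpha>"] by (simp add: field_simps)
        also have "\<dots> \<le> (\<Sum>\<beta>\<in>B. inverse (weight s \<beta>)) * weight s \<alpha>"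
          using b(1)[OF True] B(1) by (intro mult_right_mono member_le_sum) (auto simp: less_imp_le[OF weight_pos])
        finally have "\<bar>pseries (K \<alpha>) y\<bar> \<le> (\<Sum>\<beta>\<in>B. inverse (weight s \<beta>)) * weight s \<alpha> * (C0 * S N y)"
          using C0(1) S0[of N y] by (simp add: mult_right_mono)
        hence "\<bar>D \<alpha>\<bar> * \<bar>pseries (K \<alpha>) y\<bar> \<le> \<bar>D \<alpha>\<bar> * ((\<Sum>\<beta>\<in>B. inverse (weight s \<beta>)) * weight s \<alpha> * (C0 * S N y))"
          by (rule mult_left_mono) simp
        thus ?thesis using True by (simp add: R_def abs_mult mult_ac)
      next
        case False
        hence "pseries (K \<alpha>) y = monomial y \<alpha>" using pseries_shift[OF ell1_one(1) y] pseries_one by (simp add: K_def)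
        hence "norm (D \<alpha> * pseries (K \<alpha>) y - R \<alpha> * monomial y \<alpha>) = 0" using False by (simp add: R_def)
        also have "0 \<le> ?f \<alpha>" using C0(1) S0[of N y]
          by (auto intro!: mult_nonneg_nonneg sum_nonneg simp: less_imp_le[OF weight_pos])
        finally show ?thesis .
      qed
      ultimately have "norm (pseries (c k) y - pseries R y) \<le> ?b"
        by (rule norm_infsum_le)
      thus ?thesis by (simp add: Q_def mult_ac)
    qed
    have "R = (\<lambda>_. 0)"
    proof (rule ccontr)
      assume "R \<noteq> (\<lambda>_. 0)"
      then obtain \<gamma> where "R \<gamma> \<noteq> 0" by auto
      then obtain \<alpha> where \<alpha>: "R \<alpha> \<noteq> 0" "\<And>\<gamma>. \<gamma> \<noteq> \<alpha> \<Longrightarrow> R \<gamma> \<noteq> 0 \<Longrightarrow> index_code \<alpha> < index_code \<gamma>"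
        by (rule leading_index) blast
      let ?h = "\<lambda>\<gamma>. inverse (R \<alpha>) * R \<gamma>"
      have Q0: "0 \<le> Q" unfolding Q_def wnorm_def using C0(1)
        by (auto intro!: mult_nonneg_nonneg sum_nonneg infsum_nonneg simp: less_imp_le[OF weight_pos])
      \<comment> \<open>The remainder differs from \<open>c k\<close> by at most
        \<open>Q * S N y\<close>, and \<open>\<bar>pseries (c k) y\<bar>\<close> is itself a summand
        once the sum runs past \<open>k\<close>. So the normalised remainder is a member, its
        leading exponent lies in \<open>L\<close> and is divisible by an element of
        \<open>B\<close>; but \<open>R\<close> vanishes at all such exponents.\<close>
      have "dom s ?h (max N (Suc k)) (\<bar>inverse (R \<alpha>)\<bar> * (Q + 1))"
        unfolding dom_def
      proof (intro conjI ballI)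
        show "s > s1" using s(1) s0(1) by simp
        show "ell1 s ?h" by (rule ell1_scale[OF Rl])
        show "0 \<le> \<bar>inverse (R \<alpha>)\<bar> * (Q + 1)" using Q0 by simp
        fix y :: "real^'n" assume y: "y \<in> polydisc s"
        have "\<bar>pseries (c k) y\<bar> \<le> S (Suc k) y" unfolding S_def by (rule member_le_sum) auto
        also have "\<dots> \<le> S (max N (Suc k)) y" by (rule S_mono) simp
        finally have 1: "\<bar>pseries (c k) y\<bar> \<le> S (max N (Suc k)) y" .
        have "Q * S N y \<le> Q * S (max N (Suc k)) y" using Q0 by (intro mult_left_mono S_mono) auto
        hence "\<bar>pseries R y\<bar> \<le> (Q + 1) * S (max N (Suc k)) y"
          using Q[OF y] 1 by (simp add: distrib_right)
        hence "\<bar>inverse (R \<alpha>)\<bar> * \<bar>pseries R y\<bar> \<le> \<bar>inverse (R \<alpha>)\<bar> * ((Q + 1) * S (max N (Suc k)) y)"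
          by (rule mult_left_mono) simp
        thus "\<bar>pseries ?h y\<bar> \<le> \<bar>inverse (R \<alpha>)\<bar> * (Q + 1) * S (max N (Suc k)) y"
          by (simp add: pseries_scale abs_mult mult.assoc)
      qed
      hence "\<alpha> \<in> L" unfolding L_def mem_Collect_eq
        using \<alpha> by (intro exI[of _ ?h] conjI) auto
      hence "\<alpha> \<in> \<Delta>" using B(3) by (auto simp: \<Delta>_def)
      thus False using \<alpha>(1) by (simp add: R_def)
    qed
    hence "pseries R y = 0" for y by (simp add: pseries_def)
    thus ?thesis using Q by auto
  qed
  thus ?thesis using s(1) s0(1) unfolding S_def by (intro exI[of _ N] exI[of _ s]) auto
qed

section \<open>Radial derivatives of analytic functions\<close>

text \<open>Coefficients of the partial derivative in direction \<open>i\<close>;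
  \<open>shift_pd\<close> says that multiplying back by the coordinate gives the Euler
  operator.\<close>

definition pd :: "'n \<Rightarrow> (('n \<Rightarrow> nat) \<Rightarrow> real) \<Rightarrow> ('n \<Rightarrow> nat) \<Rightarrow> real"
  where "pd i c \<alpha> = real (\<alpha> i + 1) * c (\<alpha>(i := \<alpha> i + 1))"

definition unit_index :: "'n \<Rightarrow> 'n \<Rightarrow> nat"
  where "unit_index i = (\<lambda>j. if j = i then 1 else 0)"

lemma shift_pd: "shift (unit_index i) (pd i c) = (\<lambda>\<alpha>. real (\<alpha> i) * c \<alpha>)"
proof
  fix \<alpha> :: "'a \<Rightarrow> nat"
  show "shift (unit_index i) (pd i c) \<alpha> = real (\<alpha> i) * c \<alpha>"
  proof (cases "\<alpha> i")
    case 0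
    hence "\<not> unit_index i \<le> \<alpha>" by (auto simp: le_fun_def unit_index_def)
    thus ?thesis using 0 by (simp add: shift_def)
  next
    case (Suc k)
    hence "unit_index i \<le> \<alpha>" by (auto simp: le_fun_def unit_index_def)
    moreover have "(\<lambda>j. \<alpha> j - unit_index i j)(i := \<alpha> i) = \<alpha>" by (auto simp: fun_eq_iff unit_index_def)
    ultimately show ?thesis using Suc by (simp add: shift_def pd_def unit_index_def)
  qed
qed

lemma monomial_unit_index: "monomial y (unit_index i) = y $ i"
  unfolding monomial_def unit_index_def by (simp add: if_distrib[of "\<lambda>k. _ ^ k"] prod.delta cong: if_cong)

lemma index_code_ge_power: "2 ^ \<alpha> i \<le> index_code \<alpha>"
proof -
  have "2 ^ \<alpha> i \<le> index_prime i ^ \<alpha> i"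
    using index_prime(2)[of i] by (intro power_mono prime_ge_2_nat) auto
  also have "\<dots> \<le> index_prime i ^ \<alpha> i * (\<Prod>j\<in>UNIV - {i}. index_prime j ^ \<alpha> j)"
  proof -
    have "1 \<le> (\<Prod>j\<in>UNIV - {i}. index_prime j ^ \<alpha> j)"
      by (intro prod_ge_1 one_le_power) (simp add: Suc_le_eq index_prime_pos)
    thus ?thesis by simp
  qed
  also have "\<dots> = index_code \<alpha>" unfolding index_code_def by (rule prod.remove[symmetric]) auto
  finally show ?thesis .
qed

text \<open>The code is at least \<open>2 ^ \<alpha> i\<close>, so the factor
  \<open>\<alpha> i\<close> is only logarithmic in the code and is paid for by any increase of
  \<open>s\<close>. This plays the part of a Cauchy estimate for derivatives.\<close>

lemma weight_times_index:
  assumes "s < t"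
  shows "real (\<alpha> i) * weight t \<alpha> \<le> weight s \<alpha> / ((t - s) * ln 2)"
proof -
  have "(t - s) * ln 2 * real (\<alpha> i) \<le> exp ((t - s) * ln 2 * real (\<alpha> i))"
    using exp_ge_add_one_self[of "(t - s) * ln 2 * real (\<alpha> i)"] by linarith
  also have "\<dots> = real (2 ^ \<alpha> i) powr (t - s)" by (simp add: powr_def ln_realpow mult_ac)
  also have "\<dots> \<le> real (index_code \<alpha>) powr (t - s)"
    by (rule powr_mono2[OF _ _ of_nat_mono[OF index_code_ge_power]]) (use assms in simp_all)
  finally have "(t - s) * ln 2 * real (\<alpha> i) * weight t \<alpha> \<le> real (index_code \<alpha>) powr (t - s) * weight t \<alpha>"
    using weight_pos[of t \<alpha>] by (intro mult_right_mono) auto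
  also have "\<dots> = weight s \<alpha>" unfolding weight_def by (simp flip: powr_add)
  finally show ?thesis using assms by (simp add: field_simps)
qed

lemma ell1_times_index:
  assumes "ell1 s c" "s < t" shows "ell1 t (\<lambda>\<alpha>. real (\<alpha> i) * c \<alpha>)"
proof -
  have "(\<lambda>\<alpha>. inverse ((t - s) * ln 2) * (\<bar>c \<alpha>\<bar> * weight s \<alpha>)) summable_on UNIV"
    using assms(1) unfolding ell1_def by (rule summable_on_cmult_right)
  thus ?thesis unfolding ell1_def
  proof (rule summable_on_comparison_test)
    fix \<alpha> :: "'a \<Rightarrow> nat"
    have "\<bar>c \<alpha>\<bar> * (real (\<alpha> i) * weight t \<alpha>) \<le> \<bar>c \<alpha>\<bar> * (weight s \<alpha> / ((t - s) * ln 2))"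
      by (intro mult_left_mono weight_times_index assms) auto
    thus "\<bar>real (\<alpha> i) * c \<alpha>\<bar> * weight t \<alpha> \<le> inverse ((t - s) * ln 2) * (\<bar>c \<alpha>\<bar> * weight s \<alpha>)"
      by (simp add: abs_mult field_simps)
    show "0 \<le> \<bar>real (\<alpha> i) * c \<alpha>\<bar> * weight t \<alpha>" using weight_pos[of t \<alpha>] by simp
  qed
qed

lemma inj_incr: "inj (\<lambda>\<alpha>::'n \<Rightarrow> nat. \<alpha>(i := \<alpha> i + 1))"
proof (rule injI)
  fix \<alpha> \<beta> :: "'n \<Rightarrow> nat" assume eq: "\<alpha>(i := \<alpha> i + 1) = \<beta>(i := \<beta> i + 1)"
  show "\<alpha> = \<beta>"
  proof
    fix j show "\<alpha> j = \<beta> j" using fun_cong[OF eq, of j] by (cases "j = i") auto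
  qed
qed

lemma add_unit_index: "(\<lambda>j. unit_index i j + \<alpha> j) = \<alpha>(i := \<alpha> i + 1)"
  by (auto simp: unit_index_def fun_eq_iff)

lemma ell1_pd:
  assumes "ell1 s c" "s < t" shows "ell1 t (pd i c)"
proof -
  let ?h = "\<lambda>\<alpha>::'a \<Rightarrow> nat. \<alpha>(i := \<alpha> i + 1)"
  let ?F = "\<lambda>\<alpha>. inverse (weight t (unit_index i)) * (\<bar>real (\<alpha> i) * c \<alpha>\<bar> * weight t \<alpha>)"
  have "?F summable_on UNIV"
    using ell1_times_index[OF assms] unfolding ell1_def by (rule summable_on_cmult_right)
  hence "?F summable_on range ?h" by (rule summable_on_subset_banach) simp
  hence "(?F \<circ> ?h) summable_on UNIV" by (rule summable_on_reindex[OF inj_incr, THEN iffD1])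
  moreover have "?F \<circ> ?h = (\<lambda>\<alpha>. \<bar>pd i c \<alpha>\<bar> * weight t \<alpha>)"
  proof
    fix \<alpha> :: "'a \<Rightarrow> nat"
    have "weight t (?h \<alpha>) = weight t (unit_index i) * weight t \<alpha>"
      using weight_add[of t "unit_index i" \<alpha>] unfolding add_unit_index .
    thus "(?F \<circ> ?h) \<alpha> = \<bar>pd i c \<alpha>\<bar> * weight t \<alpha>"
      using weight_pos[of t "unit_index i"] by (simp add: pd_def)
  qed
  ultimately show ?thesis unfolding ell1_def by (simp only:)
qed

text \<open>Reindexes the series by the exponent before differentiation. The truncated
  \<open>\<alpha> i - 1\<close> is harmless: at \<open>\<alpha> i = 0\<close> the factor
  \<open>real (\<alpha> i)\<close> vanishes.\<close>

lemma pseries_pd_has_sum: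
  assumes "ell1 t (pd i c)" "y \<in> polydisc t"
  shows "((\<lambda>\<alpha>. c \<alpha> * (real (\<alpha> i) * monomial y (\<alpha>(i := \<alpha> i - 1)))) has_sum pseries (pd i c) y) UNIV"
proof -
  let ?h = "\<lambda>\<alpha>::'a \<Rightarrow> nat. \<alpha>(i := \<alpha> i + 1)"
  let ?f = "\<lambda>\<alpha>. c \<alpha> * (real (\<alpha> i) * monomial y (\<alpha>(i := \<alpha> i - 1)))"
  have "((?f \<circ> ?h) has_sum pseries (pd i c) y) UNIV"
    using pseries_has_sum[OF assms] by (simp add: o_def pd_def mult_ac)
  hence "(?f has_sum pseries (pd i c) y) (range ?h)" by (rule has_sum_reindex[OF inj_incr, THEN iffD2])
  moreover have "?f \<alpha> = 0" if "\<alpha> \<notin> range ?h" for \<alpha>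
  proof -
    have "\<alpha> i = 0"
    proof (rule ccontr)
      assume "\<alpha> i \<noteq> 0"
      hence "\<alpha> = ?h (\<alpha>(i := \<alpha> i - 1))" by simp
      hence "\<alpha> \<in> range ?h" by (rule range_eqI[of _ ?h])
      thus False using that by contradiction
    qed
    thus ?thesis by simp
  qed
  ultimately show ?thesis
    by (subst has_sum_cong_neutral[where T = "range ?h" and g = ?f]) blast+
qed

lemma has_derivative_monomial:
  "((\<lambda>y. monomial y \<alpha>) has_derivative (\<lambda>h. \<Sum>i\<in>UNIV. h $ i * (real (\<alpha> i) * monomial y (\<alpha>(i := \<alpha> i - 1))))) (at y within S)"
proof -
  have "((\<lambda>y. monomial y \<alpha>) has_derivative
      (\<lambda>h. \<Sum>i\<in>UNIV. (real (\<alpha> i) * h $ i * y $ i ^ (\<alpha> i - 1)) * (\<Prod>j\<in>UNIV - {i}. y $ j ^ \<alpha> j))) (at y within S)"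
    unfolding monomial_def
    by (intro has_derivative_prod has_derivative_power bounded_linear_imp_has_derivative bounded_linear_vec_nth)
  moreover have "monomial y (\<alpha>(i := \<alpha> i - 1)) = y $ i ^ (\<alpha> i - 1) * (\<Prod>j\<in>UNIV - {i}. y $ j ^ \<alpha> j)" for i
    unfolding monomial_def by (subst prod.remove[of UNIV i]) (auto intro: prod.cong)
  ultimately show ?thesis by (simp add: mult_ac)
qed

text \<open>Termwise differentiation needs a convex set, and passing from a derivative within the
  set to a full one needs an open set.\<close>

definition opolydisc :: "real \<Rightarrow> (real^'n::finite) set"
  where "opolydisc s = {y. \<forall>i. y $ i \<in> {- (real (index_prime i) powr (- s)) <..< real (index_prime i) powr (- s)}}"

lemma opolydisc:
  fixes s :: real
  defines "D \<equiv> (opolydisc s :: (real^'n::finite) set)"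
  shows "open D" "convex D" "D \<subseteq> polydisc s" "0 \<in> D"
  unfolding D_def
proof -
  show "open (opolydisc s :: (real^'n) set)" unfolding opolydisc_def by (rule open_vector_box) auto
  have "(opolydisc s :: (real^'n) set) = (\<Inter>i. (\<lambda>y. y $ i) -` {- (real (index_prime i) powr (- s)) <..< real (index_prime i) powr (- s)})"
    by (auto simp: opolydisc_def)
  moreover have "convex \<dots>"
    by (intro convex_INT convex_linear_vimage bounded_linear.linear[OF bounded_linear_vec_nth] convex_real_interval)
  ultimately show "convex (opolydisc s :: (real^'n) set)" by simp
  show "(opolydisc s :: (real^'n) set) \<subseteq> polydisc s"
  proof
    fix y :: "real^'n" assume "y \<in> opolydisc s"
    hence *: "y $ i \<in> {- (real (index_prime i) powr (- s)) <..< real (index_prime i) powr (- s)}" for i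
      unfolding opolydisc_def by blast
    have "\<bar>y $ i\<bar> \<le> real (index_prime i) powr (- s)" for i using *[of i] by auto
    thus "y \<in> polydisc s" by (simp add: polydisc_def)
  qed
  show "0 \<in> (opolydisc s :: (real^'n) set)" by (simp add: opolydisc_def index_prime_pos)
qed

lemma countably_infinite_indices: "\<exists>e::nat \<Rightarrow> ('n::finite \<Rightarrow> nat). bij e"
proof -
  have "infinite (UNIV :: ('n \<Rightarrow> nat) set)"
  proof
    assume "finite (UNIV :: ('n \<Rightarrow> nat) set)"
    moreover have "inj (\<lambda>k::nat. \<lambda>i::'n. k)" by (auto simp: inj_def fun_eq_iff)
    ultimately show False by (metis finite_subset infinite_UNIV_nat finite_imageD subset_UNIV)
  qed
  thus ?thesis using bij_betw_from_nat_into[of "UNIV :: ('n \<Rightarrow> nat) set"] by auto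
qed

text \<open>The multi-indices are enumerated by the naturals, so that termwise differentiation of
  sequential series applies. The partial derivatives converge uniformly by the Weierstrass test; the
  gap between \<open>s\<close> and \<open>t\<close> makes the majorants summable.\<close>

lemma has_derivative_pseries:
  fixes c :: "('n::finite \<Rightarrow> nat) \<Rightarrow> real"
  assumes c: "ell1 s c" "s < t" and y: "y \<in> opolydisc t"
  shows "(pseries c has_derivative (\<lambda>h. \<Sum>i\<in>UNIV. h $ i * pseries (pd i c) y)) (at y)"
proof -
  obtain e :: "nat \<Rightarrow> ('n \<Rightarrow> nat)" where e: "bij e" using countably_infinite_indices by blast
  define u where "u i n y = c (e n) * (real (e n i) * monomial y ((e n)(i := e n i - 1)))" for i n y
  have ct: "ell1 t c" and cp: "ell1 t (pd i c)" for i
    using ell1_mono[of s t c] ell1_pd[of s c t i] c by auto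
  have sub: "y \<in> polydisc t" if "y \<in> opolydisc t" for y :: "real^'n" using opolydisc(3) that by blast
  have unif: "uniform_limit (opolydisc t) (\<lambda>n y. \<Sum>k<n. u i k y) (\<lambda>y. pseries (pd i c) y) sequentially" for i
  proof -
    \<comment> \<open>Lowering one exponent divides the weight of the monomial by that of a single
      variable, hence the reciprocal of \<open>weight t (unit_index i)\<close>.\<close>
    define M where "M n = inverse (weight t (unit_index i)) * (\<bar>real (e n i) * c (e n)\<bar> * weight t (e n))" for n
    have "((\<lambda>\<alpha>. \<bar>real (\<alpha> i) * c \<alpha>\<bar> * weight t \<alpha>) has_sum wnorm t (\<lambda>\<alpha>. real (\<alpha> i) * c \<alpha>)) UNIV"
      unfolding wnorm_def using ell1_times_index[OF c] by (simp add: ell1_def)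
    hence "((\<lambda>n. \<bar>real (e n i) * c (e n)\<bar> * weight t (e n)) has_sum wnorm t (\<lambda>\<alpha>. real (\<alpha> i) * c \<alpha>)) UNIV"
      by (rule has_sum_reindex_bij_betw[OF e, THEN iffD2])
    hence "summable M" unfolding M_def
      by (intro summable_mult summable_on_imp_summable) (rule has_sum_imp_summable)
    moreover have "norm (u i n y) \<le> M n" if "y \<in> opolydisc t" for n y
    proof (cases "e n i = 0")
      case True
      thus ?thesis by (simp add: u_def M_def)
    next
      case False
      let ?\<alpha> = "(e n)(i := e n i - 1)"
      have "(\<lambda>j. unit_index i j + ?\<alpha> j) = e n" using False by (auto simp: unit_index_def fun_eq_iff)
      hence "weight t (e n) = weight t (unit_index i) * weight t ?\<alpha>"
        using weight_add[of t "unit_index i" ?\<alpha>] by metis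
      hence "weight t ?\<alpha> = inverse (weight t (unit_index i)) * weight t (e n)"
        using weight_pos[of t "unit_index i"] by (simp add: field_simps)
      hence le: "\<bar>monomial y ?\<alpha>\<bar> \<le> inverse (weight t (unit_index i)) * weight t (e n)"
        using monomial_le_weight[OF sub[OF that], of ?\<alpha>] by simp
      have "\<bar>real (e n i) * c (e n)\<bar> * \<bar>monomial y ?\<alpha>\<bar> \<le>
          \<bar>real (e n i) * c (e n)\<bar> * (inverse (weight t (unit_index i)) * weight t (e n))"
        by (rule mult_left_mono[OF le]) simp
      thus ?thesis by (simp add: u_def M_def abs_mult mult_ac)
    qed
    ultimately have "uniform_limit (opolydisc t) (\<lambda>n y. \<Sum>k<n. u i k y) (\<lambda>y. suminf (\<lambda>k. u i k y)) sequentially"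
      by (intro Weierstrass_m_test)
    moreover have "suminf (\<lambda>k. u i k y) = pseries (pd i c) y" if "y \<in> opolydisc t" for y
    proof -
      have "((\<lambda>k. u i k y) has_sum pseries (pd i c) y) UNIV"
        using pseries_pd_has_sum[OF cp sub[OF that], of i] unfolding u_def
        by (rule has_sum_reindex_bij_betw[OF e, THEN iffD2])
      hence "(\<lambda>k. u i k y) sums pseries (pd i c) y" by (rule has_sum_imp_sums)
      thus ?thesis by (rule sums_unique[symmetric])
    qed
    ultimately show ?thesis by (rule uniform_limit_cong'[OF refl, THEN iffD1, rotated])
  qed
  have evs: "(\<lambda>n. c (e n) * monomial z (e n)) sums pseries c z" if "z \<in> opolydisc t" for z
    using has_sum_reindex_bij_betw[OF e, THEN iffD2, OF pseries_has_sum[OF ct sub[OF that]]]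
    by (rule has_sum_imp_sums)
  have "\<exists>g. \<forall>z\<in>opolydisc t. (\<lambda>n. c (e n) * monomial z (e n)) sums g z \<and>
      (g has_derivative (\<lambda>h. \<Sum>i\<in>UNIV. h $ i * pseries (pd i c) z)) (at z within opolydisc t)"
  proof (rule has_derivative_series[where x = y and l = "pseries c y" and
      f' = "\<lambda>n z h. c (e n) * (\<Sum>i\<in>UNIV. h $ i * (real (e n i) * monomial z ((e n)(i := e n i - 1))))",
      OF opolydisc(2)])
    fix n and z :: "real^'n"
    show "((\<lambda>z. c (e n) * monomial z (e n)) has_derivative
        (\<lambda>h. c (e n) * (\<Sum>i\<in>UNIV. h $ i * (real (e n i) * monomial z ((e n)(i := e n i - 1)))))) (at z within opolydisc t)"
      by (rule has_derivative_mult_right[OF has_derivative_monomial])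
  next
    fix \<epsilon> :: real assume "\<epsilon> > 0"
    have "\<forall>\<^sub>F n in sequentially. \<forall>i\<in>UNIV. \<forall>z\<in>opolydisc t. dist (\<Sum>k<n. u i k z) (pseries (pd i c) z) < \<epsilon> / CARD('n)"
    proof (rule eventually_ball_finite, simp, rule ballI)
      show "\<forall>\<^sub>F n in sequentially. \<forall>z\<in>opolydisc t. dist (\<Sum>k<n. u i k z) (pseries (pd i c) z) < \<epsilon> / CARD('n)" for i
        using unif[of i] \<open>\<epsilon> > 0\<close> unfolding uniform_limit_iff by simp
    qed
    thus "\<forall>\<^sub>F n in sequentially. \<forall>z\<in>opolydisc t. \<forall>h.
        norm ((\<Sum>k<n. c (e k) * (\<Sum>i\<in>UNIV. h $ i * (real (e k i) * monomial z ((e k)(i := e k i - 1))))) -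
          (\<Sum>i\<in>UNIV. h $ i * pseries (pd i c) z)) \<le> \<epsilon> * norm h"
    proof eventually_elim
      case (elim n)
      show ?case
      proof (intro ballI allI)
        fix z h :: "real^'n" assume z: "z \<in> opolydisc t"
        have "(\<Sum>k<n. c (e k) * (\<Sum>i\<in>UNIV. h $ i * (real (e k i) * monomial z ((e k)(i := e k i - 1)))))
            = (\<Sum>i\<in>UNIV. h $ i * (\<Sum>k<n. u i k z))"
          unfolding sum_distrib_left u_def by (subst sum.swap) (simp add: mult_ac)
        hence "norm ((\<Sum>k<n. c (e k) * (\<Sum>i\<in>UNIV. h $ i * (real (e k i) * monomial z ((e k)(i := e k i - 1))))) -
            (\<Sum>i\<in>UNIV. h $ i * pseries (pd i c) z)) = norm (\<Sum>i\<in>UNIV. h $ i * ((\<Sum>k<n. u i k z) - pseries (pd i c) z))"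
          by (simp add: right_diff_distrib sum_subtractf)
        also have "\<dots> \<le> (\<Sum>i\<in>(UNIV::'n set). norm h * (\<epsilon> / CARD('n)))"
        proof (rule sum_norm_le)
          fix i :: 'n
          have "\<bar>(\<Sum>k<n. u i k z) - pseries (pd i c) z\<bar> \<le> \<epsilon> / CARD('n)"
            using bspec[OF bspec[OF elim UNIV_I[of i]] z] by (simp add: dist_real_def)
          thus "norm (h $ i * ((\<Sum>k<n. u i k z) - pseries (pd i c) z)) \<le> norm h * (\<epsilon> / CARD('n))"
            unfolding real_norm_def abs_mult using component_le_norm_cart[of h i] by (intro mult_mono) auto
        qed
        also have "\<dots> = \<epsilon> * norm h" by simp
        finally show "norm ((\<Sum>k<n. c (e k) * (\<Sum>i\<in>UNIV. h $ i * (real (e k i) * monomial z ((e k)(i := e k i - 1))))) -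
            (\<Sum>i\<in>UNIV. h $ i * pseries (pd i c) z)) \<le> \<epsilon> * norm h" .
      qed
    qed
  next
    show "y \<in> opolydisc t" by (rule y)
    show "(\<lambda>n. c (e n) * monomial y (e n)) sums pseries c y" by (rule evs[OF y])
  qed
  then obtain g where g: "\<And>z. z \<in> opolydisc t \<Longrightarrow> (\<lambda>n. c (e n) * monomial z (e n)) sums g z"
    "(g has_derivative (\<lambda>h. \<Sum>i\<in>UNIV. h $ i * pseries (pd i c) y)) (at y within opolydisc t)"
    using y by blast
  have "pseries c z = g z" if "z \<in> opolydisc t" for z using sums_unique2[OF evs[OF that] g(1)[OF that]] .
  hence "(pseries c has_derivative (\<lambda>h. \<Sum>i\<in>UNIV. h $ i * pseries (pd i c) y)) (at y within opolydisc t)"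
    by (rule has_derivative_transform[OF y _ g(2)])
  thus ?thesis unfolding at_within_open[OF y opolydisc(1)] .
qed

section \<open>Power series of the iterated radial derivatives\<close>

lemma ell1_add: "ell1 s c \<Longrightarrow> ell1 s d \<Longrightarrow> ell1 s (\<lambda>\<alpha>. c \<alpha> + d \<alpha>)"
  unfolding ell1_def
  by (rule summable_on_comparison_test[OF summable_on_add[of "\<lambda>\<alpha>. \<bar>c \<alpha>\<bar> * weight s \<alpha>" UNIV "\<lambda>\<alpha>. \<bar>d \<alpha>\<bar> * weight s \<alpha>"]])
     (auto simp: less_imp_le[OF weight_pos] simp flip: distrib_right intro!: mult_right_mono)

lemma ell1_zero: "ell1 s (\<lambda>_. 0)" by (simp add: ell1_def)

lemma ell1_sum: "finite I \<Longrightarrow> (\<And>i. i \<in> I \<Longrightarrow> ell1 s (c i)) \<Longrightarrow> ell1 s (\<lambda>\<alpha>. \<Sum>i\<in>I. c i \<alpha>)"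
  by (induction I rule: finite_induct) (auto simp: ell1_zero intro: ell1_add)

lemma pseries_add:
  assumes "ell1 s c" "ell1 s d" "y \<in> polydisc s"
  shows "pseries (\<lambda>\<alpha>. c \<alpha> + d \<alpha>) y = pseries c y + pseries d y"
  using has_sum_add[OF pseries_has_sum[OF assms(1,3)] pseries_has_sum[OF assms(2,3)]]
  unfolding pseries_def[of "\<lambda>\<alpha>. c \<alpha> + d \<alpha>"] distrib_right by (rule infsumI)

lemma pseries_sum:
  assumes "finite I" "\<And>i. i \<in> I \<Longrightarrow> ell1 s (c i)" "y \<in> polydisc s"
  shows "pseries (\<lambda>\<alpha>. \<Sum>i\<in>I. c i \<alpha>) y = (\<Sum>i\<in>I. pseries (c i) y)"
  using assms(1,2)
proof (induction I rule: finite_induct)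
  case empty
  show ?case by (simp add: pseries_def)
next
  case (insert i I)
  thus ?case using assms(3) by (simp add: pseries_add[where s=s] ell1_sum)
qed

text \<open>Taylor coefficients at \<open>a\<close> of the functions \<open>r^k (d/dr)^k f\<close>.
  With \<open>x = a + y\<close> the operator \<open>x \<bullet> grad\<close> splits into the
  \<open>a $ i\<close> times partial derivatives and the Euler operator in \<open>y\<close>, which
  multiplies the coefficient at \<alpha> by the \<open>\<alpha> i\<close>. The last summand comes
  from commuting \<open>d/dr\<close> past \<open>r^k\<close>.\<close>

primrec hcoef :: "real^'n::finite \<Rightarrow> (('n \<Rightarrow> nat) \<Rightarrow> real) \<Rightarrow> nat \<Rightarrow> ('n \<Rightarrow> nat) \<Rightarrow> real" where
  "hcoef a c 0 = c"
| "hcoef a c (Suc k) = (\<lambda>\<alpha>. (\<Sum>i\<in>UNIV. a $ i * pd i (hcoef a c k) \<alpha> + real (\<alpha> i) * hcoef a c k \<alpha>)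
     + - real k * hcoef a c k \<alpha>)"

text \<open>In polar coordinates \<open>rad f k\<close> is \<open>r\<^sup>k (d/dr)\<^sup>k f\<close>; the recursion uses that \<open>x \<bullet> grad\<close> is \<open>r d/dr\<close>. Unlike the
  radial derivatives themselves, these functions are analytic at \<open>0\<close>.\<close>

primrec rad :: "(real^'n \<Rightarrow> real) \<Rightarrow> nat \<Rightarrow> real^'n \<Rightarrow> real" where
  "rad f 0 = f"
| "rad f (Suc k) = (\<lambda>x. x \<bullet> grad (rad f k) x - real k * rad f k x)"

text \<open>Each differentiation loses an arbitrarily small amount of \<open>s\<close>. On the open
  range \<open>s > s1\<close> nothing accumulates, and all orders \<open>k\<close> share the same
  range.\<close>

lemma ell1_hcoef:
  assumes c: "\<And>s. s > s1 \<Longrightarrow> ell1 s c" and "s > s1"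
  shows "ell1 s (hcoef a c k)"
  using assms(2)
proof (induction k arbitrary: s)
  case 0
  thus ?case using c by simp
next
  case (Suc k)
  obtain s' where s': "s1 < s'" "s' < s" using dense[OF Suc.prems] by blast
  note l = Suc.IH[OF s'(1)]
  show ?case unfolding hcoef.simps
    by (intro ell1_add ell1_sum ell1_scale ell1_pd[OF l s'(2)] ell1_times_index[OF l s'(2)] Suc.IH Suc.prems) simp
qed

lemma pseries_hcoef_Suc:
  assumes l: "ell1 s (hcoef a c k)" and st: "s < t" and y: "y \<in> polydisc t"
  shows "pseries (hcoef a c (Suc k)) y =
    (\<Sum>i\<in>UNIV. (a + y) $ i * pseries (pd i (hcoef a c k)) y) - real k * pseries (hcoef a c k) y"
proof -
  have l': "ell1 t (hcoef a c k)" using ell1_mono[OF less_imp_le[OF st] l] .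
  have index: "pseries (\<lambda>\<alpha>. real (\<alpha> i) * hcoef a c k \<alpha>) y = y $ i * pseries (pd i (hcoef a c k)) y" for i
    using pseries_shift[OF ell1_pd[OF l st] y, of "unit_index i" i] by (simp add: shift_pd monomial_unit_index)
  have sum_l: "ell1 t (\<lambda>\<alpha>. a $ i * pd i (hcoef a c k) \<alpha> + real (\<alpha> i) * hcoef a c k \<alpha>)" for i
    by (intro ell1_add ell1_scale ell1_pd[OF l st] ell1_times_index[OF l st])
  show ?thesis unfolding hcoef.simps
    by (subst pseries_add[OF ell1_sum ell1_scale y], simp, rule sum_l, rule l')
       (simp add: pseries_sum[OF _ sum_l y] pseries_add[OF ell1_scale ell1_times_index y, OF ell1_pd[OF l st] l st]
          index distrib_right pseries_scale pseries_scale[of "- real k", simplified])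
qed

text \<open>Value and derivative go through one induction: the next value involves the gradient of
  the previous function, and that gradient is known only once the previous function is
  differentiable.\<close>

lemma rad_power_series:
  fixes f :: "real^'n::finite \<Rightarrow> real"
  assumes c: "\<And>s. s > s1 \<Longrightarrow> ell1 s c" and f: "\<And>s y. s > s1 \<Longrightarrow> y \<in> opolydisc s \<Longrightarrow> f (a + y) = pseries c y"
    and s: "s > s1" and y: "y \<in> opolydisc s"
  shows "rad f k (a + y) = pseries (hcoef a c k) y \<and>
    (rad f k has_derivative (\<lambda>h. \<Sum>i\<in>UNIV. h $ i * pseries (pd i (hcoef a c k)) y)) (at (a + y))"
  using s y
proof (induction k arbitrary: s y)
  have l: "ell1 s (hcoef a c k)" if "s > s1" for s k
    by (rule ell1_hcoef[of s1]) (rule c, assumption, rule that)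
  have der: "(rad f k has_derivative (\<lambda>h. \<Sum>i\<in>UNIV. h $ i * pseries (pd i (hcoef a c k)) y)) (at (a + y))"
    if s: "s > s1" and y: "y \<in> opolydisc s" and eq: "\<And>y. y \<in> opolydisc s \<Longrightarrow> rad f k (a + y) = pseries (hcoef a c k) y"
    for k s y
  proof -
    obtain s' where s': "s1 < s'" "s' < s" using dense[OF s] by blast
    have "(pseries (hcoef a c k) has_derivative (\<lambda>h. \<Sum>i\<in>UNIV. h $ i * pseries (pd i (hcoef a c k)) y)) (at ((a + y) - a))"
      using has_derivative_pseries[OF l[OF s'(1)] s'(2) y] by simp
    hence "((\<lambda>x. pseries (hcoef a c k) (x - a)) has_derivative (\<lambda>h. \<Sum>i\<in>UNIV. h $ i * pseries (pd i (hcoef a c k)) y)) (at (a + y))"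
      by (rule has_derivative_compose[OF has_derivative_diff[OF has_derivative_ident has_derivative_const], simplified])
    thus ?thesis
    proof (rule has_derivative_transform_within_open)
      show "open ((\<lambda>y. a + y) ` opolydisc s)" by (rule open_translation[OF opolydisc(1)])
      show "a + y \<in> (\<lambda>y. a + y) ` opolydisc s" using y by (rule imageI)
      fix x assume "x \<in> (\<lambda>y. a + y) ` opolydisc s"
      then obtain z where "z \<in> opolydisc s" "x = a + z" by blast
      thus "pseries (hcoef a c k) (x - a) = rad f k x" using eq[of z] by simp
    qed
  qed
  {
    case (0 s y)
    have eq: "rad f 0 (a + z) = pseries (hcoef a c 0) z" if "z \<in> opolydisc s" for z
      using f[OF 0(1) that] by simp
    show ?case using der[OF 0 eq] eq[OF 0(2)] by blast
  next
    case (Suc k s y)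
    have eq: "rad f (Suc k) (a + y) = pseries (hcoef a c (Suc k)) y" if y: "y \<in> opolydisc s" for y
    proof -
      obtain s' where s': "s1 < s'" "s' < s" using dense[OF Suc.prems(1)] by blast
      have d: "frechet_derivative (rad f k) (at (a + y)) = (\<lambda>h. \<Sum>i\<in>UNIV. h $ i * pseries (pd i (hcoef a c k)) y)"
        by (rule frechet_derivative_at[symmetric], rule Suc.IH[OF Suc.prems(1) y, THEN conjunct2])
      have g: "grad (rad f k) (a + y) $ i = pseries (pd i (hcoef a c k)) y" for i
      proof -
        have "(\<Sum>j\<in>UNIV. axis i 1 $ j * pseries (pd j (hcoef a c k)) y)
            = (\<Sum>j\<in>UNIV. if j = i then pseries (pd j (hcoef a c k)) y else 0)"
          by (rule sum.cong) (auto simp: axis_def)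
        thus ?thesis unfolding grad_def d by simp
      qed
      have "(a + y) \<bullet> grad (rad f k) (a + y) = (\<Sum>i\<in>UNIV. (a + y) $ i * pseries (pd i (hcoef a c k)) y)"
        unfolding inner_vec_def g inner_real_def ..
      thus ?thesis
        unfolding pseries_hcoef_Suc[OF l[OF s'(1)] s'(2) subsetD[OF opolydisc(3) y]] rad.simps
          Suc.IH[OF Suc.prems(1) y, THEN conjunct1] by (rule arg_cong)
    qed
    show ?case using eq[OF Suc.prems(2)] der[OF Suc.prems eq] by blast
  }
qed

text \<open>\<open>V\<close> and \<open>N\<close> serve all orders \<open>k\<close> at once; only
  the constant depends on \<open>k\<close>. The index starts at \<open>Suc 0\<close> because the
  phase derivative, not the phase, has to be controlled.\<close>

lemma rad_local:
  fixes f :: "real^'n::finite \<Rightarrow> real"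
  assumes f: "f real_analytic_on U" and a: "a \<in> U"
  shows "\<exists>V N. open V \<and> a \<in> V \<and> (\<forall>k. \<forall>x\<in>V. rad f k differentiable (at x)) \<and>
    (\<forall>k. \<exists>C. \<forall>x\<in>V. \<bar>rad f (Suc k) x\<bar> \<le> C * (\<Sum>j<N. \<bar>rad f (Suc j) x\<bar>))"
proof -
  obtain r c where r: "r > 0" and
    fs: "\<And>x. x \<in> ball a r \<Longrightarrow> ((\<lambda>\<alpha>. c \<alpha> * (\<Prod>i\<in>UNIV. (x $ i - a $ i) ^ \<alpha> i)) has_sum f x) UNIV"
    using f a unfolding real_analytic_on_def by blast
  define v :: "real \<Rightarrow> real^'n" where "v s = (\<chi> i. real (index_prime i) powr (- s))" for s
  have "((\<lambda>s. v s) \<longlongrightarrow> 0) at_top"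
  proof (rule vec_tendstoI)
    fix i :: 'n
    have "real (index_prime i) > 1" using prime_gt_1_nat[OF index_prime(2)[of i]] by simp
    hence "((\<lambda>s. real (index_prime i) powr (- s)) \<longlongrightarrow> 0) at_top" by real_asymp
    thus "((\<lambda>s. v s $ i) \<longlongrightarrow> 0 $ i) at_top" by (simp add: v_def)
  qed
  hence "((\<lambda>s. norm (v s)) \<longlongrightarrow> 0) at_top" by (rule tendsto_norm_zero)
  hence "\<forall>\<^sub>F s in at_top. norm (v s) < r" using r by (rule order_tendstoD)
  then obtain s1 where s1: "\<And>s. s \<ge> s1 \<Longrightarrow> norm (v s) < r" by (auto simp: eventually_at_top_linorder)
  have sub: "norm y < r" if "y \<in> polydisc s" "s > s1" for y :: "real^'n" and s
  proof -
    have "norm y \<le> norm (v s)"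
      by (rule norm_le_componentwise_cart) (use that(1) in \<open>auto simp: polydisc_def v_def\<close>)
    thus ?thesis using s1[of s] that(2) by simp
  qed
  \<comment> \<open>At the corner \<open>a + v s\<close> of the polydisc the monomials equal their
    weights, and unconditional convergence of a real series there is absolute convergence.\<close>
  have cl: "ell1 s c" if "s > s1" for s
  proof -
    have "a + v s \<in> ball a r" using s1[of s] that by (simp add: dist_norm)
    hence "((\<lambda>\<alpha>. c \<alpha> * weight s \<alpha>) has_sum f (a + v s)) UNIV"
      using fs[of "a + v s"] by (simp add: v_def weight_prod)
    hence "(\<lambda>\<alpha>. norm (c \<alpha> * weight s \<alpha>)) summable_on UNIV"
      by (intro summable_on_iff_abs_summable_on_real[THEN iffD1]) (rule has_sum_imp_summable)
    thus ?thesis unfolding ell1_def by (simp add: abs_mult less_imp_le[OF weight_pos] abs_of_pos[OF weight_pos])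
  qed
  have fe: "f (a + y) = pseries c y" if "s > s1" "y \<in> opolydisc s" for s y
  proof -
    have "a + y \<in> ball a r" using sub[of y s] that opolydisc(3)[of s] by (auto simp: dist_norm)
    thus ?thesis using fs[of "a + y"] unfolding pseries_def monomial_def by (simp add: has_sum_iff)
  qed
  have "\<exists>N s. s > s1 \<and> (\<forall>k. \<exists>C. \<forall>y\<in>polydisc s.
      \<bar>pseries (hcoef a c (Suc k)) y\<bar> \<le> C * (\<Sum>j<N. \<bar>pseries (hcoef a c (Suc j)) y\<bar>))"
    by (rule pseries_noetherian, rule ell1_hcoef[of s1]) (rule cl, assumption+)
  then obtain N s where s: "s > s1" and
    N: "\<forall>k. \<exists>C. \<forall>y\<in>polydisc s. \<bar>pseries (hcoef a c (Suc k)) y\<bar> \<le> C * (\<Sum>j<N. \<bar>pseries (hcoef a c (Suc j)) y\<bar>)"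
    by (elim exE conjE)
  let ?V = "(\<lambda>y. a + y) ` opolydisc s"
  have ps: "rad f k (a + y) = pseries (hcoef a c k) y \<and>
    (rad f k has_derivative (\<lambda>h. \<Sum>i\<in>UNIV. h $ i * pseries (pd i (hcoef a c k)) y)) (at (a + y))"
    if "y \<in> opolydisc s" for y k
  proof (rule rad_power_series[of s1 c f a s y k])
    show "ell1 s c" if "s > s1" for s by (rule cl[OF that])
    show "f (a + y) = pseries c y" if "s > s1" "y \<in> opolydisc s" for s y by (rule fe[OF that])
  qed (fact s that)+
  have v1: "open ?V" by (rule open_translation[OF opolydisc(1)])
  have v2: "a \<in> ?V" by (rule image_eqI[of _ _ 0]) (simp_all add: opolydisc(4))
  have v3: "\<forall>k. \<forall>x\<in>?V. rad f k differentiable (at x)"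
  proof (intro allI ballI)
    fix k x assume "x \<in> ?V"
    then obtain y where "y \<in> opolydisc s" "x = a + y" by blast
    thus "rad f k differentiable (at x)" using ps[of y k] unfolding differentiable_def by blast
  qed
  have v4: "\<exists>C. \<forall>x\<in>?V. \<bar>rad f (Suc k) x\<bar> \<le> C * (\<Sum>j<N. \<bar>rad f (Suc j) x\<bar>)" for k
  proof -
    obtain C where C: "\<And>y. y \<in> polydisc s \<Longrightarrow> \<bar>pseries (hcoef a c (Suc k)) y\<bar> \<le> C * (\<Sum>j<N. \<bar>pseries (hcoef a c (Suc j)) y\<bar>)"
      using spec[OF N, of k] by blast
    have "\<bar>rad f (Suc k) (a + y)\<bar> \<le> C * (\<Sum>j<N. \<bar>rad f (Suc j) (a + y)\<bar>)" if "y \<in> opolydisc s" for y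
      using C[OF subsetD[OF opolydisc(3) that]] ps[OF that, THEN conjunct1] by (simp del: rad.simps hcoef.simps)
    thus ?thesis by (intro exI[of _ C]) (auto simp del: rad.simps)
  qed
  show ?thesis by (intro exI[of _ ?V] exI[of _ N] conjI v1 v2 v3 allI[OF v4])
qed

text \<open>Finitely many of the neighbourhoods of \<open>rad_local\<close> cover \<open>K\<close>,
  and \<open>N\<close> is the largest number of derivatives needed in any of them. Squares replace
  absolute values because the sum of squares of the jet is differentiable, as Gronwall's argument
  requires.\<close>

lemma rad_finite_order:
  fixes f :: "real^'n::finite \<Rightarrow> real"
  assumes f: "f real_analytic_on U" and K: "compact K" "K \<subseteq> U"
  shows "\<exists>N\<ge>1. \<exists>A\<ge>0. \<forall>x\<in>K. (rad f (Suc N) x)\<^sup>2 \<le> A * (\<Sum>j<N. (rad f (Suc j) x)\<^sup>2)"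
proof -
  define bnd where "bnd k V M C \<longleftrightarrow> (\<forall>x\<in>V. \<bar>rad f (Suc k) x\<bar> \<le> C * (\<Sum>j<M. \<bar>rad f (Suc j) x\<bar>))" for k V M C
  have "\<forall>a\<in>K. \<exists>V. \<exists>M. open V \<and> a \<in> V \<and> (\<forall>k. \<exists>C. bnd k V M C)"
    using rad_local[OF f] K(2) unfolding bnd_def by (metis subsetD)
  from bchoice[OF this] obtain V where "\<forall>a\<in>K. \<exists>M. open (V a) \<and> a \<in> V a \<and> (\<forall>k. \<exists>C. bnd k (V a) M C)" by blast
  from bchoice[OF this] obtain M where V: "\<forall>a\<in>K. open (V a) \<and> a \<in> V a \<and> (\<forall>k. \<exists>C. bnd k (V a) (M a) C)" by blast
  have "\<And>a. a \<in> K \<Longrightarrow> open (V a)" "K \<subseteq> (\<Union>a\<in>K. V a)" using V by auto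
  then obtain F where F: "F \<subseteq> K" "finite F" "K \<subseteq> (\<Union>a\<in>F. V a)"
    by (rule compactE_image[OF K(1)])
  obtain N where N: "N \<ge> 1" "\<And>a. a \<in> F \<Longrightarrow> M a \<le> N" using finite_upper_bound[OF F(2), of 1 M] by blast
  \<comment> \<open>\<open>N\<close> is fixed before the constants are chosen: only the order just
    beyond the first \<open>N\<close> ones has to be dominated.\<close>
  have "\<forall>a\<in>F. \<exists>C. bnd N (V a) (M a) C" using V F(1) by blast
  from bchoice[OF this] obtain C where "\<forall>a\<in>F. bnd N (V a) (M a) (C a)" by blast
  hence C: "\<bar>rad f (Suc N) x\<bar> \<le> C a * (\<Sum>j<M a. \<bar>rad f (Suc j) x\<bar>)" if "a \<in> F" "x \<in> V a" for a x
    using that unfolding bnd_def by blast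
  obtain C0 where C0: "C0 \<ge> 0" "\<And>a. a \<in> F \<Longrightarrow> C a \<le> C0" using finite_upper_bound[OF F(2), of 0 C] by blast
  have "(rad f (Suc N) x)\<^sup>2 \<le> (C0\<^sup>2 * real N) * (\<Sum>j<N. (rad f (Suc j) x)\<^sup>2)" if "x \<in> K" for x
  proof -
    obtain a where a: "a \<in> F" "x \<in> V a" using F(3) \<open>x \<in> K\<close> by blast
    have "(\<Sum>j<M a. \<bar>rad f (Suc j) x\<bar>) \<le> (\<Sum>j<N. \<bar>rad f (Suc j) x\<bar>)"
      using N(2)[OF a(1)] by (intro sum_mono2) auto
    hence "C a * (\<Sum>j<M a. \<bar>rad f (Suc j) x\<bar>) \<le> C0 * (\<Sum>j<N. \<bar>rad f (Suc j) x\<bar>)"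
      using C0(1) C0(2)[OF a(1)] by (intro mult_mono sum_nonneg) auto
    hence "\<bar>rad f (Suc N) x\<bar> \<le> C0 * (\<Sum>j<N. \<bar>rad f (Suc j) x\<bar>)" using C[OF a] by linarith
    hence "\<bar>rad f (Suc N) x\<bar>\<^sup>2 \<le> (C0 * (\<Sum>j<N. \<bar>rad f (Suc j) x\<bar>))\<^sup>2" by (rule power_mono) simp
    also have "\<dots> \<le> C0\<^sup>2 * ((\<Sum>j<N. \<bar>rad f (Suc j) x\<bar>\<^sup>2) * real (card {..<N}))"
      unfolding power_mult_distrib by (intro mult_left_mono sum_squared_le_sum_of_squares) auto
    finally show ?thesis by (simp add: mult_ac del: rad.simps)
  qed
  thus ?thesis using N(1) by (intro exI[of _ N] conjI exI[of _ "C0\<^sup>2 * real N"] ballI) simp_all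
qed

section \<open>One-dimensional oscillatory integrals\<close>

lemma mvt_ex:
  fixes f f' :: "real \<Rightarrow> real"
  assumes der: "\<And>x. x \<in> {p..q} \<Longrightarrow> (f has_real_derivative f' x) (at x within {p..q})"
    and "x \<in> {p..q}" "y \<in> {p..q}"
  shows "\<exists>z\<in>{p..q}. f y - f x = (y - x) * f' z"
proof -
  have main: "\<exists>z\<in>{p..q}. f y - f x = (y - x) * f' z" if xy: "x < y" "x \<in> {p..q}" "y \<in> {p..q}" for x y
  proof -
    have "(f has_derivative (*) (f' z)) (at z within {x..y})" if "x \<le> z" "z \<le> y" for z
    proof -
      have "(f has_real_derivative f' z) (at z within {x..y})"
        by (rule has_field_derivative_subset[OF der]) (use that xy in auto)
      thus ?thesis by (simp only: has_field_derivative_def)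
    qed
    from mvt_simple[OF xy(1) this] obtain z where "z \<in> {x<..<y}" "f y - f x = f' z * (y - x)" by blast
    thus ?thesis using xy by (intro bexI[of _ z]) auto
  qed
  consider "x < y" | "y < x" | "x = y" by linarith
  thus ?thesis
  proof cases
    case 1
    thus ?thesis using main assms(2,3) by blast
  next
    case 2
    then obtain z where z: "z \<in> {p..q}" "f x - f y = (x - y) * f' z" using main[OF 2 assms(3,2)] by blast
    have "f y - f x = (y - x) * f' z" using z(2) by (simp add: algebra_simps)
    thus ?thesis using z(1) by blast
  next
    case 3
    thus ?thesis using assms(2) by (intro bexI[of _ x]) auto
  qed
qed

section \<open>Derivative estimates on an interval\<close>

definition derivs_on :: "real \<Rightarrow> real \<Rightarrow> (nat \<Rightarrow> real \<Rightarrow> real) \<Rightarrow> bool"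
  where "derivs_on p q g \<longleftrightarrow>
    (\<forall>k. \<forall>x\<in>{p..q}. (g k has_real_derivative g (Suc k) x) (at x within {p..q}))"

lemma derivs_onD:
  "derivs_on p q g \<Longrightarrow> x \<in> {p..q} \<Longrightarrow> (g k has_real_derivative g (Suc k) x) (at x within {p..q})"
  unfolding derivs_on_def by blast

lemma derivs_on_subset:
  assumes "derivs_on p q g" "p \<le> u" "v \<le> q" shows "derivs_on u v g"
  unfolding derivs_on_def
proof (intro allI ballI)
  fix k x assume "x \<in> {u..v}"
  hence "x \<in> {p..q}" using assms by auto
  from derivs_onD[OF assms(1) this, of k] show "(g k has_real_derivative g (Suc k) x) (at x within {u..v})"
    by (rule has_field_derivative_subset) (use assms in auto)
qed

lemma derivs_on_Suc: "derivs_on p q g \<Longrightarrow> derivs_on p q (\<lambda>k. g (Suc k))"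
  unfolding derivs_on_def by blast

lemma derivs_on_continuous: "derivs_on p q g \<Longrightarrow> continuous_on {p..q} (g k)"
  unfolding derivs_on_def by (meson DERIV_continuous continuous_on_eq_continuous_within)

text \<open>Where the next derivative is at least \<open>V\<close> in size, \<open>g i\<close>
  changes by at least \<open>2 * l * V\<close> between the two outer quarters of length
  \<open>l\<close>. So it is at least \<open>l * V\<close> in size throughout one of them, and the
  induction continues there. The factors 4 record the shrinking of the interval.\<close>

lemma large_derivative_imp_large:
  "\<exists>\<kappa>>0. \<forall>g p q V. p < q \<longrightarrow> derivs_on p q g \<longrightarrow> (\<forall>x\<in>{p..q}. V \<le> \<bar>g i x\<bar>) \<longrightarrow>
     (\<exists>x\<in>{p..q}. \<kappa> * V * (q - p) ^ i \<le> \<bar>g 0 x\<bar>)"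
proof (induction i)
  case 0
  show ?case by (intro exI[of _ 1]) force
next
  case (Suc i)
  then obtain \<kappa> where \<kappa>: "\<kappa> > 0" and IH: "\<And>g p q V. p < q \<Longrightarrow> derivs_on p q g \<Longrightarrow> (\<forall>x\<in>{p..q}. V \<le> \<bar>g i x\<bar>) \<Longrightarrow>
     (\<exists>x\<in>{p..q}. \<kappa> * V * (q - p) ^ i \<le> \<bar>g 0 x\<bar>)" by blast
  have "\<exists>x\<in>{p..q}. \<kappa> / 4 ^ Suc i * V * (q - p) ^ Suc i \<le> \<bar>g 0 x\<bar>"
    if pq: "p < q" and g: "derivs_on p q g" and V: "\<forall>x\<in>{p..q}. V \<le> \<bar>g (Suc i) x\<bar>"
    for g :: "nat \<Rightarrow> real \<Rightarrow> real" and p q V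
  proof (cases "V \<le> 0")
    case True
    have "\<kappa> / 4 ^ Suc i * V * (q - p) ^ Suc i \<le> 0"
      using True \<kappa> pq by (intro mult_nonpos_nonneg mult_nonneg_nonpos) auto
    also have "0 \<le> \<bar>g 0 p\<bar>" by simp
    finally show ?thesis using pq by force
  next
    case False
    define l where "l = (q - p) / 4"
    have l: "l > 0" "q = p + 4 * l" using pq by (auto simp: l_def field_simps)
    have diff: "2 * l * V \<le> \<bar>g i y - g i x\<bar>" if "x \<in> {p..p+l}" "y \<in> {q-l..q}" for x y
    proof -
      have "x \<in> {p..q}" "y \<in> {p..q}" using that l by auto
      then obtain z where z: "z \<in> {p..q}" "g i y - g i x = (y - x) * g (Suc i) z"
        using mvt_ex[where f = "g i" and f' = "g (Suc i)", OF derivs_onD[OF g]] by blast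
      have "2 * l \<le> y - x" using that l by auto
      hence "(2 * l) * V \<le> (y - x) * \<bar>g (Suc i) z\<bar>"
        using V z(1) l False by (intro mult_mono) auto
      also have "\<dots> = \<bar>g i y - g i x\<bar>" using z(2) \<open>2 * l \<le> y - x\<close> l by (simp add: abs_mult)
      finally show ?thesis by simp
    qed
    have "\<exists>u v. p \<le> u \<and> v \<le> q \<and> v - u = l \<and> (\<forall>x\<in>{u..v}. l * V \<le> \<bar>g i x\<bar>)"
    proof (cases "\<forall>x\<in>{p..p+l}. l * V \<le> \<bar>g i x\<bar>")
      case True
      thus ?thesis using l by (intro exI[of _ p] exI[of _ "p + l"]) auto
    next
      case False
      then obtain x where x: "x \<in> {p..p+l}" "\<bar>g i x\<bar> < l * V" by force
      have "\<forall>y\<in>{q-l..q}. l * V \<le> \<bar>g i y\<bar>" using diff[OF x(1)] x(2) by (force simp: abs_if split: if_splits)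
      thus ?thesis using l by (intro exI[of _ "q - l"] exI[of _ q]) auto
    qed
    then obtain u v where uv: "p \<le> u" "v \<le> q" "v - u = l" "\<forall>x\<in>{u..v}. l * V \<le> \<bar>g i x\<bar>" by blast
    have "\<exists>x\<in>{u..v}. \<kappa> * (l * V) * (v - u) ^ i \<le> \<bar>g 0 x\<bar>"
      using uv l by (intro IH derivs_on_subset[OF g]) auto
    moreover have "\<kappa> * (l * V) * (v - u) ^ i = \<kappa> / 4 ^ Suc i * V * (q - p) ^ Suc i"
      unfolding uv(3) l_def by (simp add: power_divide)
    ultimately show ?thesis using uv(1,2) by force
  qed
  thus ?case using \<kappa> by (intro exI[of _ "\<kappa> / 4 ^ Suc i"]) simp
qed

text \<open>If \<open>g j\<close> were too large at a point, the bound on \<open>g (Suc j)\<close>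
  would keep it above half that size on a subinterval of half the length. By
  \<open>large_derivative_imp_large\<close>, \<open>g 0\<close> would then exceed \<open>e\<close>
  somewhere.\<close>

lemma interpolation_step:
  assumes "D \<ge> 0"
  shows "\<exists>D'\<ge>0. \<forall>g p q e. p < q \<longrightarrow> derivs_on p q g \<longrightarrow> e > 0 \<longrightarrow> (\<forall>x\<in>{p..q}. \<bar>g 0 x\<bar> \<le> e) \<longrightarrow>
     (\<forall>x\<in>{p..q}. \<bar>g (Suc j) x\<bar> \<le> D * e / (q - p) ^ Suc j) \<longrightarrow>
     (\<forall>x\<in>{p..q}. \<bar>g j x\<bar> \<le> D' * e / (q - p) ^ j)"
proof -
  obtain \<kappa> where \<kappa>: "\<kappa> > 0" and low: "\<And>g p q V. p < q \<Longrightarrow> derivs_on p q g \<Longrightarrow> (\<forall>x\<in>{p..q}. V \<le> \<bar>g j x\<bar>) \<Longrightarrow>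
     (\<exists>x\<in>{p..q}. \<kappa> * V * (q - p) ^ j \<le> \<bar>g 0 x\<bar>)"
    using large_derivative_imp_large[of j] by blast
  \<comment> \<open>\<open>D' \<ge> D\<close> ensures that \<open>g j\<close> loses at most half of
    its size over half the interval; \<open>D' > 2 ^ Suc j / \<kappa>\<close> produces the
    contradiction with the bound on \<open>g 0\<close>.\<close>
  define D' where "D' = D + 2 ^ Suc j / \<kappa> + 1"
  have D': "D' \<ge> D" "D' > 2 ^ Suc j / \<kappa>" "D' \<ge> 0" using assms \<kappa> by (auto simp: D'_def add_nonneg_nonneg)
  have "\<bar>g j x\<bar> \<le> D' * e / (q - p) ^ j"
    if pq: "p < q" and g: "derivs_on p q g" and e: "e > 0" "\<forall>x\<in>{p..q}. \<bar>g 0 x\<bar> \<le> e"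
      and S: "\<forall>x\<in>{p..q}. \<bar>g (Suc j) x\<bar> \<le> D * e / (q - p) ^ Suc j" and x: "x \<in> {p..q}"
    for g :: "nat \<Rightarrow> real \<Rightarrow> real" and p q e x
  proof (rule ccontr)
    define V where "V = D' * e / (q - p) ^ j"
    assume "\<not> ?thesis"
    hence big: "\<bar>g j x\<bar> > V" by (simp add: V_def)
    define l where "l = (q - p) / 2"
    have l: "l > 0" "q - p = 2 * l" using pq by (auto simp: l_def)
    obtain u v where uv: "p \<le> u" "v \<le> q" "v - u = l" "x \<in> {u..v}"
    proof (cases "x + l \<le> q")
      case True
      show ?thesis by (rule that[of x "x + l"]) (use True x l in auto)
    next
      case False
      show ?thesis by (rule that[of "x - l" x]) (use False x l in auto)
    qed
    have "V / 2 \<le> \<bar>g j y\<bar>" if "y \<in> {u..v}" for y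
    proof -
      have "y \<in> {p..q}" using that uv by auto
      then obtain z where z: "z \<in> {p..q}" "g j y - g j x = (y - x) * g (Suc j) z"
        using mvt_ex[where f = "g j" and f' = "g (Suc j)", OF derivs_onD[OF g]] x by blast
      have "\<bar>y - x\<bar> \<le> l" using that uv by auto
      hence "\<bar>g j y - g j x\<bar> \<le> l * (D * e / (q - p) ^ Suc j)"
        unfolding z(2) abs_mult using S z(1) l by (intro mult_mono) auto
      also have "\<dots> = (D * e / (q - p) ^ j) / 2" using l by (simp add: field_simps)
      also have "\<dots> \<le> V / 2" unfolding V_def using D'(1) e(1) pq
        by (intro divide_right_mono mult_right_mono) auto
      finally show ?thesis using big by linarith
    qed
    hence "\<exists>y\<in>{u..v}. \<kappa> * (V / 2) * (v - u) ^ j \<le> \<bar>g 0 y\<bar>"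
      using uv l by (intro low derivs_on_subset[OF g]) auto
    then obtain y where y: "y \<in> {u..v}" "\<kappa> * (V / 2) * l ^ j \<le> \<bar>g 0 y\<bar>" unfolding uv(3) by blast
    hence "y \<in> {p..q}" using uv by auto
    hence "\<kappa> * (V / 2) * l ^ j \<le> e" using e(2) y(2) by force
    moreover have "\<kappa> * (V / 2) * l ^ j = \<kappa> * D' / 2 ^ Suc j * e"
      unfolding V_def l(2) using l(1) by (simp add: power_mult_distrib field_simps)
    ultimately have "\<kappa> * D' / 2 ^ Suc j * e \<le> 1 * e" by linarith
    hence "\<kappa> * D' / 2 ^ Suc j \<le> 1" using e(1) by (simp only: mult_le_cancel_right_pos)
    moreover have "\<kappa> * D' > 2 ^ Suc j" using D'(2) \<kappa> by (simp add: pos_divide_less_eq mult.commute)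
    ultimately show False by (simp add: field_simps)
  qed
  thus ?thesis using D'(3) by (intro exI[of _ D']) blast
qed

text \<open>A Landau-Kolmogorov inequality: \<open>interpolation_step\<close> descends from order
  \<open>j\<close> to order 1.\<close>

lemma interpolation:
  assumes "D \<ge> 0" "j \<ge> 1"
  shows "\<exists>C\<ge>0. \<forall>g p q e. p < q \<longrightarrow> derivs_on p q g \<longrightarrow> e > 0 \<longrightarrow> (\<forall>x\<in>{p..q}. \<bar>g 0 x\<bar> \<le> e) \<longrightarrow>
     (\<forall>x\<in>{p..q}. \<bar>g j x\<bar> \<le> D * e / (q - p) ^ j) \<longrightarrow>
     (\<forall>x\<in>{p..q}. \<bar>g 1 x\<bar> \<le> C * e / (q - p))"
  using assms(2,1)
proof (induction j arbitrary: D rule: dec_induct)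
  case base
  thus ?case by (intro exI[of _ D]) simp
next
  case (step j)
  obtain D' where D': "D' \<ge> 0" and s: "\<And>g p q e. p < q \<Longrightarrow> derivs_on p q g \<Longrightarrow> e > 0 \<Longrightarrow> (\<forall>x\<in>{p..q}. \<bar>g 0 x\<bar> \<le> e) \<Longrightarrow>
     (\<forall>x\<in>{p..q}. \<bar>g (Suc j) x\<bar> \<le> D * e / (q - p) ^ Suc j) \<Longrightarrow>
     (\<forall>x\<in>{p..q}. \<bar>g j x\<bar> \<le> D' * e / (q - p) ^ j)"
    using interpolation_step[OF step.prems, of j] by blast
  obtain C where C: "C \<ge> 0" "\<And>g p q e. p < q \<Longrightarrow> derivs_on p q g \<Longrightarrow> e > 0 \<Longrightarrow> (\<forall>x\<in>{p..q}. \<bar>g 0 x\<bar> \<le> e) \<Longrightarrow>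
     (\<forall>x\<in>{p..q}. \<bar>g j x\<bar> \<le> D' * e / (q - p) ^ j) \<Longrightarrow>
     (\<forall>x\<in>{p..q}. \<bar>g 1 x\<bar> \<le> C * e / (q - p))"
    using step.IH[OF D'] by blast
  show ?case using C(1) by (intro exI[of _ C] conjI allI impI C(2) s)
qed

section \<open>Splitting an interval according to signs\<close>

definition const_sign :: "real \<Rightarrow> real \<Rightarrow> (real \<Rightarrow> real) \<Rightarrow> bool"
  where "const_sign p q f \<longleftrightarrow> (\<forall>x\<in>{p..q}. 0 \<le> f x) \<or> (\<forall>x\<in>{p..q}. f x \<le> 0)"

lemma const_sign_subset: "const_sign p q f \<Longrightarrow> p \<le> u \<Longrightarrow> v \<le> q \<Longrightarrow> const_sign u v f"
  unfolding const_sign_def by auto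

text \<open>\<open>f\<close> is monotone, so one cut suffices: at a zero if the sign changes, at an
  endpoint otherwise.\<close>

lemma const_sign_split:
  assumes der: "\<And>x. x \<in> {p..q} \<Longrightarrow> (f has_real_derivative f' x) (at x within {p..q})"
    and sgn: "const_sign p q f'" and pq: "p \<le> q"
  obtains r where "p \<le> r" "r \<le> q" "const_sign p r f" "const_sign r q f"
proof -
  have mono: "(\<forall>x\<in>{p..q}. \<forall>y\<in>{p..q}. x \<le> y \<longrightarrow> f x \<le> f y)" if "\<forall>x\<in>{p..q}. 0 \<le> f' x"
  proof (intro ballI impI)
    fix x y assume xy: "x \<in> {p..q}" "y \<in> {p..q}" "x \<le> y"
    obtain z where z: "z \<in> {p..q}" "f y - f x = (y - x) * f' z" using mvt_ex[OF der xy(1,2)] by blast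
    have "0 \<le> (y - x) * f' z" using that z(1) xy(3) by (intro mult_nonneg_nonneg) auto
    thus "f x \<le> f y" using z(2) by linarith
  qed
  have anti: "(\<forall>x\<in>{p..q}. \<forall>y\<in>{p..q}. x \<le> y \<longrightarrow> f y \<le> f x)" if "\<forall>x\<in>{p..q}. f' x \<le> 0"
  proof (intro ballI impI)
    fix x y assume xy: "x \<in> {p..q}" "y \<in> {p..q}" "x \<le> y"
    obtain z where z: "z \<in> {p..q}" "f y - f x = (y - x) * f' z" using mvt_ex[OF der xy(1,2)] by blast
    have "(y - x) * f' z \<le> 0" using that z(1) xy(3) by (intro mult_nonneg_nonpos) auto
    thus "f y \<le> f x" using z(2) by linarith
  qed
  have cont: "continuous_on {p..q} f"
    using der by (meson DERIV_continuous continuous_on_eq_continuous_within)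
  have "\<exists>r\<in>{p..q}. const_sign p r f \<and> const_sign r q f"
    using sgn[unfolded const_sign_def]
  proof
    assume a: "\<forall>x\<in>{p..q}. 0 \<le> f' x"
    note m = mono[OF a]
    consider "0 \<le> f p" | "f q \<le> 0" | "f p \<le> 0" "0 \<le> f q" by linarith
    thus ?thesis
    proof cases
      case 1
      hence "\<forall>x\<in>{p..q}. 0 \<le> f x" using m pq by force
      thus ?thesis using pq unfolding const_sign_def by (intro bexI[of _ q]) auto
    next
      case 2
      hence "\<forall>x\<in>{p..q}. f x \<le> 0" using m pq by force
      thus ?thesis using pq unfolding const_sign_def by (intro bexI[of _ p]) auto
    next
      case 3
      then obtain r where r: "p \<le> r" "r \<le> q" "f r = 0" using IVT'[of f p 0 q] cont pq by blast
      have "\<forall>x\<in>{p..r}. f x \<le> 0" "\<forall>x\<in>{r..q}. 0 \<le> f x" using m r by force+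
      thus ?thesis using r unfolding const_sign_def by (intro bexI[of _ r]) auto
    qed
  next
    assume a: "\<forall>x\<in>{p..q}. f' x \<le> 0"
    note m = anti[OF a]
    consider "0 \<le> f q" | "f p \<le> 0" | "f q \<le> 0" "0 \<le> f p" by linarith
    thus ?thesis
    proof cases
      case 1
      hence "\<forall>x\<in>{p..q}. 0 \<le> f x" using m pq by force
      thus ?thesis using pq unfolding const_sign_def by (intro bexI[of _ q]) auto
    next
      case 2
      hence "\<forall>x\<in>{p..q}. f x \<le> 0" using m pq by force
      thus ?thesis using pq unfolding const_sign_def by (intro bexI[of _ p]) auto
    next
      case 3
      then obtain r where r: "p \<le> r" "r \<le> q" "f r = 0" using IVT2'[of f q 0 p] cont pq by blast
      have "\<forall>x\<in>{p..r}. 0 \<le> f x" "\<forall>x\<in>{r..q}. f x \<le> 0" using m r by force+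
      thus ?thesis using r unfolding const_sign_def by (intro bexI[of _ r]) auto
    qed
  qed
  thus thesis using that by auto
qed

text \<open>Descending by one derivative at most doubles the number of pieces of constant sign, so
  from order \<open>j\<close> to order 1 there are at most \<open>2 ^ (j - 1)\<close> of
  them.\<close>

lemma sign_splitting:
  fixes \<Phi> :: "real \<Rightarrow> real \<Rightarrow> real"
  assumes g: "derivs_on u v g"
    and sub: "\<And>p r q. u \<le> p \<Longrightarrow> p \<le> r \<Longrightarrow> r \<le> q \<Longrightarrow> q \<le> v \<Longrightarrow> \<Phi> p q \<le> \<Phi> p r + \<Phi> r q"
    and base: "\<And>p q. u \<le> p \<Longrightarrow> p \<le> q \<Longrightarrow> q \<le> v \<Longrightarrow> const_sign p q (g 1) \<Longrightarrow> \<Phi> p q \<le> Z"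
    and j: "j \<ge> 1" and pq: "u \<le> p" "p \<le> q" "q \<le> v" "const_sign p q (g j)"
  shows "\<Phi> p q \<le> 2 ^ (j - 1) * Z"
  using j pq
proof (induction j arbitrary: p q rule: dec_induct)
  case base
  thus ?case using assms(3) by simp
next
  case (step j)
  obtain r where r: "p \<le> r" "r \<le> q" "const_sign p r (g j)" "const_sign r q (g j)"
    using const_sign_split[OF derivs_onD[OF derivs_on_subset[OF g step.prems(1,3)]] step.prems(4,2)] by blast
  have "\<Phi> p q \<le> \<Phi> p r + \<Phi> r q" using sub r(1,2) step.prems by auto
  also have "\<dots> \<le> 2 ^ (j - 1) * Z + 2 ^ (j - 1) * Z"
    using step.IH[of p r] step.IH[of r q] r step.prems by (intro add_mono) auto
  also have "\<dots> = 2 ^ (Suc j - 1) * Z" using step.hyps by (cases j) auto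
  finally show ?case .
qed

section \<open>Integration by parts\<close>

locale oscillation =
  fixes G h h' :: "real \<Rightarrow> real" and \<psi> \<psi>' :: "real \<Rightarrow> complex" and lam B u v :: real
  assumes G: "\<And>x. x \<in> {u..v} \<Longrightarrow> (G has_real_derivative h x) (at x within {u..v})"
    and h: "\<And>x. x \<in> {u..v} \<Longrightarrow> (h has_real_derivative h' x) (at x within {u..v})"
    and h': "continuous_on {u..v} h'"
    and \<psi>: "\<And>x. x \<in> {u..v} \<Longrightarrow> (\<psi> has_vector_derivative \<psi>' x) (at x within {u..v})"
    and \<psi>': "continuous_on {u..v} \<psi>'"
    and B: "\<And>x. x \<in> {u..v} \<Longrightarrow> norm (\<psi> x) \<le> B" "\<And>x. x \<in> {u..v} \<Longrightarrow> norm (\<psi>' x) \<le> B"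
    and B0: "0 \<le> B" and lam: "lam \<noteq> 0"
begin

definition E :: "real \<Rightarrow> complex" where "E x = exp (\<i> * complex_of_real (lam * G x))"

definition osc :: "real \<Rightarrow> real \<Rightarrow> real" where "osc p q = norm (integral {p..q} (\<lambda>x. E x * \<psi> x))"

lemma norm_E: "norm (E x) = 1" by (simp add: E_def norm_exp_i_times)

lemma continuous: "continuous_on {u..v} G" "continuous_on {u..v} h" "continuous_on {u..v} \<psi>" "continuous_on {u..v} E"
proof -
  show G': "continuous_on {u..v} G" "continuous_on {u..v} h"
    using G h by (meson DERIV_continuous continuous_on_eq_continuous_within)+
  show "continuous_on {u..v} \<psi>"
    using \<psi> by (meson has_vector_derivative_continuous continuous_on_eq_continuous_within)
  show "continuous_on {u..v} E" unfolding E_def by (intro continuous_intros G')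
qed

lemma integrable: "p \<ge> u \<Longrightarrow> q \<le> v \<Longrightarrow> (\<lambda>x. E x * \<psi> x) integrable_on {p..q}"
  by (intro integrable_continuous_real continuous_intros continuous_on_subset[OF continuous(3)]
      continuous_on_subset[OF continuous(4)]) auto

lemma osc_subadd:
  assumes "u \<le> p" "p \<le> r" "r \<le> q" "q \<le> v"
  shows "osc p q \<le> osc p r + osc r q"
proof -
  have "integral {p..q} (\<lambda>x. E x * \<psi> x) = integral {p..r} (\<lambda>x. E x * \<psi> x) + integral {r..q} (\<lambda>x. E x * \<psi> x)"
    using assms integrable by (intro Henstock_Kurzweil_Integration.integral_combine[symmetric]) auto
  thus ?thesis unfolding osc_def by (simp add: norm_triangle_ineq)
qed

lemma osc_trivial:
  assumes "u \<le> p" "p \<le> q" "q \<le> v" shows "osc p q \<le> B * (q - p)"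
  unfolding osc_def using assms
  by (intro integral_bound continuous_intros continuous_on_subset[OF continuous(3)] continuous_on_subset[OF continuous(4)])
     (auto simp: norm_mult norm_E intro!: B)

text \<open>\<open>E\<close> is the derivative of \<open>E\<close> divided by
  \<open>i * lam * h\<close>, up to the term in which the divisor is differentiated. The two
  boundary terms, and the derivative of the amplitude over a length of at most 3, make up the
  constant 5.\<close>

lemma osc_by_parts:
  assumes pq: "u \<le> p" "p \<le> q" "q \<le> v" "q - p \<le> 3" and eps: "\<epsilon> > 0" "\<And>x. x \<in> {p..q} \<Longrightarrow> \<epsilon> \<le> \<bar>h x\<bar>"
  shows "osc p q \<le> B / \<bar>lam\<bar> * (5 / \<epsilon> + integral {p..q} (\<lambda>x. \<bar>h' x\<bar> / (h x)\<^sup>2))"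
proof -
  have sub: "{p..q} \<subseteq> {u..v}" using pq by auto
  have h0: "h x \<noteq> 0" if "x \<in> {p..q}" for x using eps(1) eps(2)[OF that] by auto
  define a where "a x = 1 / (lam * h x)" for x
  define a' where "a' x = - h' x / (lam * (h x)\<^sup>2)" for x
  have a: "(a has_real_derivative a' x) (at x within {p..q})" if "x \<in> {p..q}" for x
    unfolding a_def a'_def using h0[OF that] lam that sub
    by (auto intro!: derivative_eq_intros has_field_derivative_subset[OF h[of x] sub] simp: field_simps power2_eq_square)
  have Ed: "(E has_vector_derivative (\<i> * complex_of_real (lam * h x)) * E x) (at x within {p..q})" if "x \<in> {p..q}" for x
  proof -
    have "((\<lambda>x. \<i> * complex_of_real (lam * G x)) has_vector_derivative \<i> * complex_of_real (lam * h x)) (at x within {p..q})"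
      using that sub
      by (intro has_vector_derivative_mult_right has_vector_derivative_of_real DERIV_cmult
          has_field_derivative_subset[OF G[of x] sub]) auto
    from field_vector_diff_chain_within[OF this, of exp "exp (\<i> * complex_of_real (lam * G x))"]
    show ?thesis unfolding E_def[abs_def] o_def
      by (simp add: DERIV_exp has_field_derivative_at_within)
  qed
  have \<psi>s: "(\<psi> has_vector_derivative \<psi>' x) (at x within {p..q})" if "x \<in> {p..q}" for x
    using has_vector_derivative_within_subset[OF \<psi> sub] that sub by blast
  define R where "R x = E x * (\<psi> x * complex_of_real (a' x) + \<psi>' x * complex_of_real (a x))" for x
  have F: "((\<lambda>x. E x * (\<psi> x * complex_of_real (a x))) has_vector_derivative (R x + \<i> * (E x * \<psi> x))) (at x within {p..q})"
    if x: "x \<in> {p..q}" for x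
  proof -
    have "((\<lambda>x. E x * (\<psi> x * complex_of_real (a x))) has_vector_derivative
       E x * (\<psi> x * complex_of_real (a' x) + \<psi>' x * complex_of_real (a x)) +
       ((\<i> * complex_of_real (lam * h x)) * E x) * (\<psi> x * complex_of_real (a x))) (at x within {p..q})"
      by (intro has_vector_derivative_mult Ed x \<psi>s has_vector_derivative_of_real a)
    also have "((\<i> * complex_of_real (lam * h x)) * E x) * (\<psi> x * complex_of_real (a x)) =
        \<i> * (E x * \<psi> x) * complex_of_real (lam * h x * a x)" by (simp add: mult_ac)
    also have "lam * h x * a x = 1" using lam h0[OF x] by (simp add: a_def)
    finally show ?thesis by (simp add: R_def)
  qed
  have ca: "continuous_on {p..q} a" "continuous_on {p..q} a'"
    unfolding a_def[abs_def] a'_def[abs_def] using h0 lam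
    by (auto intro!: continuous_intros continuous_on_subset[OF h' sub] continuous_on_subset[OF continuous(2) sub])
  have "((\<lambda>x. R x + \<i> * (E x * \<psi> x)) has_integral
      (E q * (\<psi> q * complex_of_real (a q)) - E p * (\<psi> p * complex_of_real (a p)))) {p..q}"
    by (rule fundamental_theorem_of_calculus[OF pq(2) F])
  moreover have Rint: "R integrable_on {p..q}"
    unfolding R_def[abs_def]
    by (intro integrable_continuous_real continuous_intros continuous_on_subset[OF continuous(3) sub]
        continuous_on_subset[OF continuous(4) sub] continuous_on_subset[OF \<psi>' sub] ca)
  ultimately have "((\<lambda>x. (R x + \<i> * (E x * \<psi> x)) - R x) has_integral
      (E q * (\<psi> q * complex_of_real (a q)) - E p * (\<psi> p * complex_of_real (a p))) - integral {p..q} R) {p..q}"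
    by (intro has_integral_diff integrable_integral)
  moreover have "((\<lambda>x. \<i> * (E x * \<psi> x)) has_integral \<i> * integral {p..q} (\<lambda>x. E x * \<psi> x)) {p..q}"
    using integrable pq by (intro has_integral_mult_right integrable_integral) auto
  ultimately have eq: "\<i> * integral {p..q} (\<lambda>x. E x * \<psi> x) =
      (E q * (\<psi> q * complex_of_real (a q)) - E p * (\<psi> p * complex_of_real (a p))) - integral {p..q} R"
    by (simp add: has_integral_unique)
  have abd: "\<bar>a x\<bar> \<le> 1 / (\<bar>lam\<bar> * \<epsilon>)" if "x \<in> {p..q}" for x
    unfolding a_def using eps(2)[OF that] lam eps(1) by (auto simp: abs_mult intro!: divide_left_mono mult_left_mono)
  have end_bd: "norm (E x * (\<psi> x * complex_of_real (a x))) \<le> B * (1 / (\<bar>lam\<bar> * \<epsilon>))" if "x \<in> {p..q}" for x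
    unfolding norm_mult norm_E using mult_mono[OF B(1) abd[OF that] B0 abs_ge_zero] that sub by auto
  have Iint: "(\<lambda>x. \<bar>h' x\<bar> / (h x)\<^sup>2) integrable_on {p..q}" using h0
    by (auto intro!: integrable_continuous_real continuous_intros continuous_on_subset[OF h' sub] continuous_on_subset[OF continuous(2) sub])
  let ?m = "\<lambda>x. B / \<bar>lam\<bar> * (\<bar>h' x\<bar> / (h x)\<^sup>2) + B * (1 / (\<bar>lam\<bar> * \<epsilon>))"
  have "norm (integral {p..q} R) \<le> integral {p..q} ?m"
  proof (rule integral_norm_bound_integral[OF Rint])
    show "?m integrable_on {p..q}" by (intro integrable_add integrable_on_mult_right Iint integrable_const_ivl)
    fix x assume x: "x \<in> {p..q}"
    have "norm (R x) \<le> norm (\<psi> x) * \<bar>a' x\<bar> + norm (\<psi>' x) * \<bar>a x\<bar>"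
      unfolding R_def norm_mult norm_E using norm_triangle_ineq[of "\<psi> x * complex_of_real (a' x)" "\<psi>' x * complex_of_real (a x)"]
      by (simp add: norm_mult)
    also have "\<dots> \<le> B * \<bar>a' x\<bar> + B * (1 / (\<bar>lam\<bar> * \<epsilon>))"
      using B[of x] x sub B0 abd[OF x] by (intro add_mono mult_mono mult_right_mono) auto
    also have "B * \<bar>a' x\<bar> = B / \<bar>lam\<bar> * (\<bar>h' x\<bar> / (h x)\<^sup>2)" by (simp add: a'_def abs_mult)
    finally show "norm (R x) \<le> ?m x" by simp
  qed
  also have "integral {p..q} ?m = B / \<bar>lam\<bar> * integral {p..q} (\<lambda>x. \<bar>h' x\<bar> / (h x)\<^sup>2) + (q - p) * (B * (1 / (\<bar>lam\<bar> * \<epsilon>)))"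
  proof -
    have i1: "integral {p..q} (\<lambda>x. B / \<bar>lam\<bar> * (\<bar>h' x\<bar> / (h x)\<^sup>2)) = B / \<bar>lam\<bar> * integral {p..q} (\<lambda>x. \<bar>h' x\<bar> / (h x)\<^sup>2)"
      by (rule integral_mult_right)
    have i2: "integral {p..q} (\<lambda>x. B * (1 / (\<bar>lam\<bar> * \<epsilon>))) = (q - p) * (B * (1 / (\<bar>lam\<bar> * \<epsilon>)))"
      using pq by simp
    show ?thesis
      by (subst integral_add[OF integrable_on_mult_right[OF Iint] integrable_const_ivl]) (simp only: i1 i2)
  qed
  also have "(q - p) * (B * (1 / (\<bar>lam\<bar> * \<epsilon>))) \<le> 3 * (B * (1 / (\<bar>lam\<bar> * \<epsilon>)))"
    using pq(4) B0 eps(1) by (intro mult_right_mono) auto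
  finally have "norm (integral {p..q} R) \<le> B / \<bar>lam\<bar> * integral {p..q} (\<lambda>x. \<bar>h' x\<bar> / (h x)\<^sup>2) + 3 * (B * (1 / (\<bar>lam\<bar> * \<epsilon>)))"
    by simp
  moreover have "osc p q = norm (\<i> * integral {p..q} (\<lambda>x. E x * \<psi> x))" by (simp add: osc_def norm_mult)
  moreover have "\<dots> \<le> B * (1 / (\<bar>lam\<bar> * \<epsilon>)) + B * (1 / (\<bar>lam\<bar> * \<epsilon>)) + norm (integral {p..q} R)"
    unfolding eq using end_bd[of p] end_bd[of q] pq(2)
    by (intro order_trans[OF norm_triangle_ineq4] add_mono order_trans[OF norm_triangle_ineq4]) auto
  moreover have "r \<le> y + 3 * x \<Longrightarrow> z = w \<Longrightarrow> w \<le> x + x + r \<Longrightarrow> z \<le> 5 * x + y" for r x y z w :: real by linarith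
  ultimately have "osc p q \<le> 5 * (B * (1 / (\<bar>lam\<bar> * \<epsilon>))) + B / \<bar>lam\<bar> * integral {p..q} (\<lambda>x. \<bar>h' x\<bar> / (h x)\<^sup>2)" by blast
  also have "\<dots> = B / \<bar>lam\<bar> * (5 / \<epsilon> + integral {p..q} (\<lambda>x. \<bar>h' x\<bar> / (h x)\<^sup>2))" by (simp add: distrib_left)
  finally show ?thesis .
qed

text \<open>When \<open>h'\<close> has constant sign, \<open>\<bar>h'\<bar> / h\<^sup>2\<close> is
  the derivative of \<open>1 / h\<close> up to sign, so its integral is at most
  \<open>2 / \<epsilon>\<close>, and 5 + 2 = 7.\<close>

lemma osc_monotone:
  assumes pq: "u \<le> p" "p \<le> q" "q \<le> v" "q - p \<le> 3" and eps: "\<epsilon> > 0" "\<And>x. x \<in> {p..q} \<Longrightarrow> \<epsilon> \<le> \<bar>h x\<bar>"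
    and sgn: "const_sign p q h'"
  shows "osc p q \<le> 7 * B / (\<bar>lam\<bar> * \<epsilon>)"
proof -
  have sub: "{p..q} \<subseteq> {u..v}" using pq by auto
  have h0: "h x \<noteq> 0" if "x \<in> {p..q}" for x using eps(1) eps(2)[OF that] by auto
  obtain \<sigma> :: real where \<sigma>: "\<bar>\<sigma>\<bar> = 1" "\<And>x. x \<in> {p..q} \<Longrightarrow> \<bar>h' x\<bar> = - \<sigma> * h' x"
  proof (cases "\<forall>x\<in>{p..q}. 0 \<le> h' x")
    case True
    thus ?thesis by (intro that[of "- 1"]) auto
  next
    case False
    hence "\<forall>x\<in>{p..q}. h' x \<le> 0" using sgn by (auto simp: const_sign_def)
    thus ?thesis by (intro that[of 1]) auto
  qed
  have "((\<lambda>x. \<bar>h' x\<bar> / (h x)\<^sup>2) has_integral (\<sigma> / h q - \<sigma> / h p)) {p..q}"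
  proof (rule fundamental_theorem_of_calculus[OF pq(2)])
    fix x assume x: "x \<in> {p..q}"
    have "((\<lambda>x. \<sigma> / h x) has_real_derivative \<bar>h' x\<bar> / (h x)\<^sup>2) (at x within {p..q})"
      using h0[OF x] x sub \<sigma>(2)[OF x]
      by (auto intro!: derivative_eq_intros has_field_derivative_subset[OF h[of x] sub] simp: power2_eq_square)
    thus "((\<lambda>x. \<sigma> / h x) has_vector_derivative \<bar>h' x\<bar> / (h x)\<^sup>2) (at x within {p..q})"
      by (simp add: has_real_derivative_iff_has_vector_derivative)
  qed
  hence "integral {p..q} (\<lambda>x. \<bar>h' x\<bar> / (h x)\<^sup>2) = \<sigma> / h q - \<sigma> / h p" by (rule integral_unique)
  also have "\<dots> \<le> \<bar>\<sigma> / h q\<bar> + \<bar>\<sigma> / h p\<bar>" by linarith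
  also have "\<dots> \<le> 1 / \<epsilon> + 1 / \<epsilon>"
    unfolding abs_divide \<sigma>(1) using eps pq(2) by (intro add_mono frac_le) auto
  finally have "B / \<bar>lam\<bar> * (5 / \<epsilon> + integral {p..q} (\<lambda>x. \<bar>h' x\<bar> / (h x)\<^sup>2)) \<le> B / \<bar>lam\<bar> * (5 / \<epsilon> + (1 / \<epsilon> + 1 / \<epsilon>))"
    using B0 by (intro mult_left_mono add_left_mono) auto
  also have "\<dots> = 7 * B / (\<bar>lam\<bar> * \<epsilon>)" by (simp add: field_simps)
  finally show ?thesis using osc_by_parts[OF pq eps] by linarith
qed

end

section \<open>Intervals on which the derivative of the phase is small\<close>

lemma min_one_quot_bounds: "0 \<le> min_one_quot p q" "min_one_quot p q \<le> 1"
  by (auto simp: min_one_quot_def)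

lemma min_one_quot_measurable [measurable]:
  assumes [measurable]: "f \<in> borel_measurable M" "g \<in> borel_measurable M"
  shows "(\<lambda>x. min_one_quot (f x) (g x)) \<in> borel_measurable M"
  unfolding min_one_quot_def by measurable

lemma min_one_quot_set_integrable:
  assumes "continuous_on {u..v::real} f" "continuous_on {u..v} g"
  shows "set_integrable lborel {u..v} (\<lambda>t. min_one_quot (f t) (g t))"
proof -
  have [measurable]: "(\<lambda>t. indicator {u..v} t *\<^sub>R f t) \<in> borel_measurable borel"
    "(\<lambda>t. indicator {u..v} t *\<^sub>R g t) \<in> borel_measurable borel"
    by (rule borel_measurable_continuous_on_indicator[OF _ assms(1)], simp)
       (rule borel_measurable_continuous_on_indicator[OF _ assms(2)], simp)
  have "(\<lambda>t. indicator {u..v} t *\<^sub>R min_one_quot (f t) (g t)) =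
     (\<lambda>t. indicator {u..v} t *\<^sub>R min_one_quot (indicator {u..v} t *\<^sub>R f t) (indicator {u..v} t *\<^sub>R g t))"
    by (auto simp: indicator_def fun_eq_iff)
  moreover have "\<dots> \<in> borel_measurable lborel" by measurable
  ultimately have m: "(\<lambda>t. indicator {u..v} t *\<^sub>R min_one_quot (f t) (g t)) \<in> borel_measurable lborel" by simp
  show ?thesis unfolding set_integrable_def
  proof (rule Bochner_Integration.integrable_bound[OF _ m])
    show "integrable lborel (indicator {u..v} :: real \<Rightarrow> real)"
      by (rule integrable_real_indicator) (auto simp: emeasure_lborel_Icc_eq)
    show "AE x in lborel. norm (indicator {u..v} x *\<^sub>R min_one_quot (f x) (g x)) \<le> norm (indicator {u..v} x :: real)"
      by (auto simp: indicator_def min_one_quot_bounds)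
  qed
qed

text \<open>\<open>z\<close> belongs to the least parameter, counted from \<open>a\<close>, at which
  the level \<open>e\<close> is attained; exceeding \<open>e\<close> before it would force an
  earlier hit. Using a segment covers both directions, \<open>a < y\<close> and
  \<open>y < a\<close>.\<close>

lemma first_hit:
  fixes k :: "real \<Rightarrow> real"
  assumes "continuous_on (closed_segment a y) k" "k a \<le> e" "e \<le> k y"
  shows "\<exists>z\<in>closed_segment a y. k z = e \<and> (\<forall>t\<in>closed_segment a z. k t \<le> e)"
proof -
  define f where "f s = k (a + s * (y - a))" for s
  have seg: "a + s * (y - a) \<in> closed_segment a y" if "s \<in> {0..1}" for s
    using that unfolding closed_segment_def by (intro CollectI exI[of _ s]) (auto simp: algebra_simps)
  have cf: "continuous_on {0..1} f" unfolding f_def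
    by (intro continuous_on_compose2[OF assms(1)] continuous_intros) (use seg in auto)
  have f01: "f 0 \<le> e" "e \<le> f 1" using assms by (auto simp: f_def)
  define S where "S = {s\<in>{0..1}. f s = e}"
  have "closed S" unfolding S_def
    using continuous_closed_preimage_constant[OF cf closed_atLeastAtMost] by simp
  moreover have "S \<noteq> {}" using IVT'[of f 0 e 1] f01 cf unfolding S_def by fastforce
  moreover have "bdd_below S" unfolding S_def by (rule bdd_belowI[of _ 0]) auto
  ultimately have I: "Inf S \<in> S" by (intro closed_contains_Inf)
  define s where "s = Inf S"
  have s: "s \<in> {0..1}" "f s = e" using I by (auto simp: s_def S_def)
  have before: "f t \<le> e" if t: "t \<in> {0..s}" for t
  proof (rule ccontr)
    assume "\<not> ?thesis"
    hence "e \<le> f t" by simp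
    moreover have "continuous_on {0..t} f" by (rule continuous_on_subset[OF cf]) (use t s in auto)
    ultimately obtain r where r: "0 \<le> r" "r \<le> t" "f r = e" using IVT'[of f 0 e t] f01(1) t by auto
    hence "r \<in> S" using t s by (auto simp: S_def)
    hence "s \<le> r" unfolding s_def by (rule cInf_lower) fact
    hence "t = s" using r t by auto
    thus False using s \<open>\<not> f t \<le> e\<close> by simp
  qed
  show ?thesis
  proof (intro bexI[of _ "a + s * (y - a)"] conjI ballI)
    show "k (a + s * (y - a)) = e" using s(2) by (simp add: f_def)
    show "a + s * (y - a) \<in> closed_segment a y" by (rule seg[OF s(1)])
    fix t assume "t \<in> closed_segment a (a + s * (y - a))"
    then obtain w where w: "0 \<le> w" "w \<le> 1" "t = (1 - w) * a + w * (a + s * (y - a))"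
      by (auto simp: closed_segment_def)
    hence "t = a + (w * s) * (y - a)" by (simp add: algebra_simps)
    moreover have "w * s \<in> {0..s}" using w(1,2) s(1) by (auto simp: mult_left_le_one_le)
    ultimately show "k t \<le> e" using before[of "w * s"] by (simp add: f_def)
  qed
qed

lemma variation_le_integral:
  assumes "derivs_on p q g" "x \<in> {p..q}" "y \<in> {p..q}"
  shows "\<bar>g 0 y - g 0 x\<bar> \<le> (LINT t:{p..q}|lborel. \<bar>g 1 t\<bar>)"
proof -
  have c: "continuous_on {p..q} (\<lambda>t. \<bar>g 1 t\<bar>)" by (intro continuous_intros derivs_on_continuous[OF assms(1)])
  have main: "\<bar>g 0 y - g 0 x\<bar> \<le> (LINT t:{p..q}|lborel. \<bar>g 1 t\<bar>)" if "x \<le> y" "x \<in> {p..q}" "y \<in> {p..q}" for x y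
  proof -
    have sub: "{x..y} \<subseteq> {p..q}" using that by auto
    have "(g 1 has_integral (g 0 y - g 0 x)) {x..y}"
    proof (rule fundamental_theorem_of_calculus[OF that(1)])
      fix t assume "t \<in> {x..y}"
      hence "(g 0 has_real_derivative g 1 t) (at t within {x..y})"
        using has_field_derivative_subset[OF derivs_onD[OF assms(1), of t 0] sub] sub by auto
      thus "(g 0 has_vector_derivative g 1 t) (at t within {x..y})"
        by (simp add: has_real_derivative_iff_has_vector_derivative)
    qed
    hence "norm (g 0 y - g 0 x) \<le> integral {x..y} (\<lambda>t. \<bar>g 1 t\<bar>)"
      by (subst integral_unique[symmetric, of "g 1"], assumption)
         (intro integral_norm_bound_integral integrable_continuous_real continuous_on_subset[OF derivs_on_continuous[OF assms(1)] sub]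
            continuous_on_subset[OF c sub], simp)
    also have "\<dots> \<le> integral {p..q} (\<lambda>t. \<bar>g 1 t\<bar>)"
      by (intro integral_subset_le sub integrable_continuous_real continuous_on_subset[OF c sub] c) auto
    also have "\<dots> = (LINT t:{p..q}|lborel. \<bar>g 1 t\<bar>)"
      using set_borel_integral_eq_integral(2)[OF borel_integrable_atLeastAtMost'[OF c]] by simp
    finally show ?thesis by simp
  qed
  show ?thesis using main[OF _ assms(2,3)] main[OF _ assms(3,2)] by (cases "x \<le> y") (auto simp: abs_minus_commute)
qed

text \<open>If \<open>\<bar>g 0\<bar> \<le> \<epsilon> = 1 / (\<Lambda> \<kappa>)\<close> on \<open>{p..q}\<close>, where \<open>\<kappa> = K (T + 1 / \<Lambda>)\<close>, enlarge the interval until \<open>\<bar>g 0\<bar>\<close> reaches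
  \<open>2 \<epsilon>\<close>. By interpolation \<open>\<bar>g 1\<bar>\<close> is at most \<open>\<epsilon>\<close> over the new length \<open>l\<close>, up to constants, whereas \<open>g 0\<close> varies by
  \<open>\<epsilon>\<close>; so the interval contributes at least a multiple of \<open>min l \<kappa>\<close> to \<open>T\<close>, which forces \<open>l \<le> \<kappa>\<close>.\<close>

lemma small_interval_short:
  assumes j: "j \<ge> 1" and c: "c > 0" and Cb: "Cb \<ge> 0" and c0: "c0 > 0"
  shows "\<exists>K\<ge>1. \<forall>g u v \<Lambda> T p q. derivs_on u v g \<longrightarrow> (\<forall>x\<in>{u..v}. c \<le> \<bar>g j x\<bar> \<and> \<bar>g j x\<bar> \<le> Cb) \<longrightarrow>
    (\<exists>y\<in>{u..v}. c0 \<le> \<bar>g 0 y\<bar>) \<longrightarrow> \<Lambda> > 0 \<longrightarrow> u \<le> p \<longrightarrow> p \<le> q \<longrightarrow> q \<le> v \<longrightarrow>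
    T = (LINT t:{u..v}|lborel. min_one_quot (g 1 t) (\<Lambda> * (g 0 t)\<^sup>2)) \<longrightarrow>
    (\<forall>x\<in>{p..q}. \<bar>g 0 x\<bar> \<le> 1 / (\<Lambda> * (K * (T + 1 / \<Lambda>)))) \<longrightarrow> q - p \<le> K * (T + 1 / \<Lambda>)"
proof -
  obtain \<kappa>j where \<kappa>j: "\<kappa>j > 0" and low: "\<And>g p q V. p < q \<Longrightarrow> derivs_on p q g \<Longrightarrow> (\<forall>x\<in>{p..q}. V \<le> \<bar>g j x\<bar>) \<Longrightarrow>
     (\<exists>x\<in>{p..q}. \<kappa>j * V * (q - p) ^ j \<le> \<bar>g 0 x\<bar>)"
    using large_derivative_imp_large[of j] by blast
  \<comment> \<open>The lower bound on \<open>g j\<close> gives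
    \<open>\<kappa>j * c * l ^ j \<le> 2 * \<epsilon>\<close> on an interval of length
    \<open>l\<close> where \<open>\<bar>g 0\<bar> \<le> 2 * \<epsilon>\<close>. Multiplied by
    \<open>D\<close> this turns the fixed upper bound \<open>Cb\<close> into the scale-dependent one
    that \<open>interpolation\<close> asks for.\<close>
  define D where "D = Cb / (\<kappa>j * c)"
  have D0: "D \<ge> 0" using Cb \<kappa>j c by (simp add: D_def)
  obtain C where C: "C \<ge> 0" "\<And>g p q e. p < q \<Longrightarrow> derivs_on p q g \<Longrightarrow> e > 0 \<Longrightarrow> (\<forall>x\<in>{p..q}. \<bar>g 0 x\<bar> \<le> e) \<Longrightarrow>
     (\<forall>x\<in>{p..q}. \<bar>g j x\<bar> \<le> D * e / (q - p) ^ j) \<Longrightarrow> (\<forall>x\<in>{p..q}. \<bar>g 1 x\<bar> \<le> C * e / (q - p))"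
    using interpolation[OF D0 j] by blast
  \<comment> \<open>The 8 gives \<open>T < \<kappa> / 4\<close>, which excludes the second entry of
    the minimum at the end; \<open>2 * (C + 1)\<close> turns the surviving entry into
    \<open>l \<le> \<kappa>\<close>; \<open>2 / c0\<close> ensures that
    \<open>2 * \<epsilon> \<le> c0\<close>, so the level \<open>2 * \<epsilon>\<close> is reached
    somewhere.\<close>
  define K where "K = 8 + 2 * (C + 1) + 2 / c0"
  have K: "K \<ge> 8" "K \<ge> 2 * (C + 1)" "K \<ge> 2 / c0" using C(1) c0 by (auto simp: K_def)
  show ?thesis
  proof (intro exI[of _ K] conjI allI impI)
    show "K \<ge> 1" using K by simp
    fix g :: "nat \<Rightarrow> real \<Rightarrow> real" and u v \<Lambda> T p q :: real
    assume g: "derivs_on u v g" and gj: "\<forall>x\<in>{u..v}. c \<le> \<bar>g j x\<bar> \<and> \<bar>g j x\<bar> \<le> Cb"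
      and y: "\<exists>y\<in>{u..v}. c0 \<le> \<bar>g 0 y\<bar>" and \<Lambda>: "\<Lambda> > 0" and pq: "u \<le> p" "p \<le> q" "q \<le> v"
      and T: "T = (LINT t:{u..v}|lborel. min_one_quot (g 1 t) (\<Lambda> * (g 0 t)\<^sup>2))"
      and small: "\<forall>x\<in>{p..q}. \<bar>g 0 x\<bar> \<le> 1 / (\<Lambda> * (K * (T + 1 / \<Lambda>)))"
    define \<kappa> where "\<kappa> = K * (T + 1 / \<Lambda>)"
    define \<epsilon> where "\<epsilon> = 1 / (\<Lambda> * \<kappa>)"
    have T0: "T \<ge> 0" unfolding T set_lebesgue_integral_def
      by (intro Bochner_Integration.integral_nonneg) (auto simp: min_one_quot_bounds)
    have \<kappa>: "\<kappa> > 0" "\<kappa> \<ge> 8 * T" "\<kappa> \<ge> 2 * (C + 1) * T" "\<Lambda> * \<kappa> \<ge> K"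
    proof -
      have "K * (T + 1 / \<Lambda>) \<ge> K * T" "K * (T + 1 / \<Lambda>) \<ge> K * (1 / \<Lambda>)"
        by (rule mult_left_mono, use K(1) T0 \<Lambda> in simp, use K(1) in simp)+
      moreover have "K * T \<ge> 8 * T" "K * T \<ge> 2 * (C + 1) * T" using K T0 by (auto intro!: mult_right_mono)
      moreover have "K * (1 / \<Lambda>) > 0" using K(1) \<Lambda> by simp
      ultimately show "\<kappa> > 0" "\<kappa> \<ge> 8 * T" "\<kappa> \<ge> 2 * (C + 1) * T" by (auto simp: \<kappa>_def)
      have "\<Lambda> * \<kappa> = K * (\<Lambda> * T) + K" using \<Lambda> by (simp add: \<kappa>_def field_simps)
      thus "\<Lambda> * \<kappa> \<ge> K" using K(1) T0 \<Lambda> by simp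
    qed
    have \<epsilon>: "\<epsilon> > 0" using \<Lambda> \<kappa>(1) by (simp add: \<epsilon>_def)
    have le\<epsilon>: "\<bar>g 0 x\<bar> \<le> \<epsilon>" if "x \<in> {p..q}" for x using small that by (simp add: \<epsilon>_def \<kappa>_def)
    have "2 * \<epsilon> \<le> c0"
    proof -
      have "2 / c0 \<le> \<Lambda> * \<kappa>" using K(3) \<kappa>(4) by linarith
      thus ?thesis using c0 \<Lambda> \<kappa>(1) by (simp add: \<epsilon>_def field_simps)
    qed
    with y obtain y where y: "y \<in> {u..v}" "2 * \<epsilon> \<le> \<bar>g 0 y\<bar>" by force
    have cont: "continuous_on {u..v} (\<lambda>t. \<bar>g 0 t\<bar>)" by (intro continuous_intros derivs_on_continuous[OF g])
    \<comment> \<open>The interval grows towards \<open>y\<close>, to the right or to the left, and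
      stops at the first point \<open>z\<close> where
      \<open>\<bar>g 0\<bar> = 2 * \<epsilon>\<close>. The old endpoint on that side serves as
      \<open>x\<close>.\<close>
    have "\<exists>p' q' x z. u \<le> p' \<and> q' \<le> v \<and> p' \<le> p \<and> q \<le> q' \<and> x \<in> {p'..q'} \<and> z \<in> {p'..q'} \<and> \<bar>g 0 x\<bar> \<le> \<epsilon> \<and>
        \<bar>g 0 z\<bar> = 2 * \<epsilon> \<and> (\<forall>t\<in>{p'..q'}. \<bar>g 0 t\<bar> \<le> 2 * \<epsilon>)"
    proof (cases "q < y")
      case True
      have "continuous_on (closed_segment q y) (\<lambda>t. \<bar>g 0 t\<bar>)"
        by (rule continuous_on_subset[OF cont]) (use True y pq in \<open>auto simp: closed_segment_eq_real_ivl\<close>)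
      then obtain z where z: "z \<in> closed_segment q y" "\<bar>g 0 z\<bar> = 2 * \<epsilon>" "\<forall>t\<in>closed_segment q z. \<bar>g 0 t\<bar> \<le> 2 * \<epsilon>"
        using first_hit[of q y "\<lambda>t. \<bar>g 0 t\<bar>" "2 * \<epsilon>"] le\<epsilon>[of q] \<epsilon> y(2) pq by auto
      have zq: "q \<le> z" "z \<le> y" using z(1) True by (auto simp: closed_segment_eq_real_ivl)
      have "\<bar>g 0 t\<bar> \<le> 2 * \<epsilon>" if "t \<in> {p..z}" for t
      proof (cases "t \<le> q")
        case True
        thus ?thesis using le\<epsilon>[of t] that \<epsilon> by auto
      next
        case False
        thus ?thesis using z(3) that zq by (auto simp: closed_segment_eq_real_ivl)
      qed
      thus ?thesis using zq z(2) pq y le\<epsilon>[of q]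
        by (intro exI[of _ p] exI[of _ z] exI[of _ q] exI[of _ z]) auto
    next
      case False
      have "y \<notin> {p..q}" using le\<epsilon>[of y] y(2) \<epsilon> by auto
      hence yp: "y < p" using False by auto
      have "continuous_on (closed_segment p y) (\<lambda>t. \<bar>g 0 t\<bar>)"
        by (rule continuous_on_subset[OF cont]) (use yp y pq in \<open>auto simp: closed_segment_eq_real_ivl\<close>)
      then obtain z where z: "z \<in> closed_segment p y" "\<bar>g 0 z\<bar> = 2 * \<epsilon>" "\<forall>t\<in>closed_segment p z. \<bar>g 0 t\<bar> \<le> 2 * \<epsilon>"
        using first_hit[of p y "\<lambda>t. \<bar>g 0 t\<bar>" "2 * \<epsilon>"] le\<epsilon>[of p] \<epsilon> y(2) pq by auto
      have zp: "z \<le> p" "y \<le> z" using z(1) yp by (auto simp: closed_segment_eq_real_ivl)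
      have "\<bar>g 0 t\<bar> \<le> 2 * \<epsilon>" if "t \<in> {z..q}" for t
      proof (cases "p \<le> t")
        case True
        thus ?thesis using le\<epsilon>[of t] that \<epsilon> by auto
      next
        case False
        thus ?thesis using z(3) that zp by (auto simp: closed_segment_eq_real_ivl)
      qed
      thus ?thesis using zp z(2) pq y le\<epsilon>[of p]
        by (intro exI[of _ z] exI[of _ q] exI[of _ p] exI[of _ z]) auto
    qed
    then obtain p' q' x z where I: "u \<le> p'" "q' \<le> v" "p' \<le> p" "q \<le> q'" "x \<in> {p'..q'}" "z \<in> {p'..q'}"
      "\<bar>g 0 x\<bar> \<le> \<epsilon>" "\<bar>g 0 z\<bar> = 2 * \<epsilon>" "\<And>t. t \<in> {p'..q'} \<Longrightarrow> \<bar>g 0 t\<bar> \<le> 2 * \<epsilon>" by blast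
    have "x \<noteq> z" using I(7,8) \<epsilon> by auto
    hence l: "p' < q'" using I(5,6) by auto
    have sub: "{p'..q'} \<subseteq> {u..v}" using I by auto
    note g' = derivs_on_subset[OF g I(1,2)]
    have "\<exists>x\<in>{p'..q'}. \<kappa>j * c * (q' - p') ^ j \<le> \<bar>g 0 x\<bar>" using gj sub by (intro low l g') auto
    hence len: "\<kappa>j * c * (q' - p') ^ j \<le> 2 * \<epsilon>" using I(9) by force
    have "\<bar>g j t\<bar> \<le> D * (2 * \<epsilon>) / (q' - p') ^ j" if "t \<in> {p'..q'}" for t
    proof -
      have "\<bar>g j t\<bar> \<le> Cb" using gj sub that by auto
      also have "Cb = D * (\<kappa>j * c * (q' - p') ^ j) / (q' - p') ^ j" using \<kappa>j c l by (simp add: D_def)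
      also have "\<dots> \<le> D * (2 * \<epsilon>) / (q' - p') ^ j" using len D0 l by (intro divide_right_mono mult_left_mono) auto
      finally show ?thesis .
    qed
    hence g1: "\<forall>t\<in>{p'..q'}. \<bar>g 1 t\<bar> \<le> C * (2 * \<epsilon>) / (q' - p')"
      using \<epsilon> I(9) by (intro C(2) l g') auto
    \<comment> \<open>The largest factor for which \<open>\<mu> * \<bar>g 1 t\<bar>\<close> provably
      stays below both entries of the minimum: below 1 by the interpolated bound on
      \<open>g 1\<close>, and below the quotient because
      \<open>\<bar>g 0\<bar> \<le> 2 * \<epsilon>\<close> and \<open>1 / (\<Lambda> * (2 *
      \<epsilon>)\<^sup>2) = \<kappa> / (4 * \<epsilon>)\<close>.\<close>
    define \<mu> where "\<mu> = min ((q' - p') / (2 * (C + 1) * \<epsilon>)) (\<kappa> / (4 * \<epsilon>))"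
    have \<mu>0: "\<mu> \<ge> 0" using l C(1) \<epsilon> \<kappa>(1) by (simp add: \<mu>_def)
    have pointwise: "\<mu> * \<bar>g 1 t\<bar> \<le> min_one_quot (g 1 t) (\<Lambda> * (g 0 t)\<^sup>2)" if t: "t \<in> {p'..q'}" for t
    proof -
      have "\<mu> * \<bar>g 1 t\<bar> \<le> (q' - p') / (2 * (C + 1) * \<epsilon>) * \<bar>g 1 t\<bar>" unfolding \<mu>_def by (intro mult_right_mono) auto
      also have "\<dots> \<le> (q' - p') / (2 * (C + 1) * \<epsilon>) * ((C + 1) * (2 * \<epsilon>) / (q' - p'))"
      proof (intro mult_left_mono)
        have "C * (2 * \<epsilon>) / (q' - p') \<le> (C + 1) * (2 * \<epsilon>) / (q' - p')"
          using l \<epsilon> by (intro divide_right_mono mult_right_mono) auto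
        thus "\<bar>g 1 t\<bar> \<le> (C + 1) * (2 * \<epsilon>) / (q' - p')" using g1 t by force
      qed (use l C(1) \<epsilon> in auto)
      also have "\<dots> = 1" using l C(1) \<epsilon> by simp
      finally have 1: "\<mu> * \<bar>g 1 t\<bar> \<le> 1" .
      have 2: "\<mu> * \<bar>g 1 t\<bar> \<le> \<bar>g 1 t / (\<Lambda> * (g 0 t)\<^sup>2)\<bar>" if "g 0 t \<noteq> 0"
      proof -
        have "\<mu> * \<bar>g 1 t\<bar> \<le> \<kappa> / (4 * \<epsilon>) * \<bar>g 1 t\<bar>" unfolding \<mu>_def by (intro mult_right_mono) auto
        also have "\<kappa> / (4 * \<epsilon>) = 1 / (\<Lambda> * (2 * \<epsilon>)\<^sup>2)"
          using \<Lambda> \<kappa>(1) by (simp add: \<epsilon>_def power2_eq_square field_simps)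
        also have "\<dots> \<le> 1 / (\<Lambda> * (g 0 t)\<^sup>2)"
        proof -
          have "\<bar>g 0 t\<bar>\<^sup>2 \<le> (2 * \<epsilon>)\<^sup>2" by (rule power_mono[OF I(9)[OF t]]) simp
          thus ?thesis using \<Lambda> that \<epsilon> by (intro divide_left_mono mult_left_mono mult_pos_pos) auto
        qed
        finally show ?thesis using \<Lambda> by (simp add: abs_mult mult_right_mono)
      qed
      show ?thesis using 1 2 \<Lambda> by (auto simp: min_one_quot_def)
    qed
    have cont_sq: "continuous_on {u..v} (\<lambda>t. \<Lambda> * (g 0 t)\<^sup>2)"
      by (intro continuous_intros derivs_on_continuous[OF g])
    have int_uv: "set_integrable lborel {u..v} (\<lambda>t. min_one_quot (g 1 t) (\<Lambda> * (g 0 t)\<^sup>2))"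
      by (rule min_one_quot_set_integrable[OF derivs_on_continuous[OF g] cont_sq])
    have int': "set_integrable lborel {p'..q'} (\<lambda>t. min_one_quot (g 1 t) (\<Lambda> * (g 0 t)\<^sup>2))"
      by (rule set_integrable_subset[OF int_uv]) (use sub in auto)
    have int1: "set_integrable lborel {p'..q'} (\<lambda>t. \<bar>g 1 t\<bar>)"
      by (intro borel_integrable_atLeastAtMost' continuous_intros derivs_on_continuous[OF g'])
    have "\<epsilon> \<le> \<bar>g 0 z - g 0 x\<bar>" using I(7,8) by linarith
    also have "\<dots> \<le> (LINT t:{p'..q'}|lborel. \<bar>g 1 t\<bar>)" by (rule variation_le_integral[OF g' I(5,6)])
    finally have "\<mu> * \<epsilon> \<le> \<mu> * (LINT t:{p'..q'}|lborel. \<bar>g 1 t\<bar>)" using \<mu>0 by (rule mult_left_mono)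
    also have "\<dots> = (LINT t:{p'..q'}|lborel. \<mu> * \<bar>g 1 t\<bar>)" by (rule set_integral_mult_right[symmetric])
    also have "\<dots> \<le> (LINT t:{p'..q'}|lborel. min_one_quot (g 1 t) (\<Lambda> * (g 0 t)\<^sup>2))"
      by (rule set_integral_mono[OF set_integrable_mult_right[OF int1] int' pointwise])
    also have "\<dots> \<le> T" unfolding T set_lebesgue_integral_def
      using int' int_uv sub unfolding set_integrable_def
      by (intro integral_mono) (auto simp: indicator_def min_one_quot_bounds)
    finally have "\<mu> * \<epsilon> \<le> T" .
    moreover have "\<mu> * \<epsilon> = min ((q' - p') / (2 * (C + 1))) (\<kappa> / 4)"
      unfolding \<mu>_def using \<epsilon> C(1) by (simp add: min_mult_distrib_right)
    moreover have "T < \<kappa> / 4"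
      using \<kappa>(1,2) by linarith
    ultimately have "(q' - p') / (2 * (C + 1)) \<le> T" by linarith
    hence "q' - p' \<le> 2 * (C + 1) * T" using C(1) by (simp add: field_simps)
    thus "q - p \<le> K * (T + 1 / \<Lambda>)" using \<kappa>(3) I(3,4) unfolding \<kappa>_def by linarith
  qed
qed

section \<open>Phases with a derivative bounded below\<close>

lemma nonvanishing_const_sign:
  assumes "continuous_on {u..v} f" "\<And>x. x \<in> {u..v} \<Longrightarrow> f x \<noteq> (0::real)"
  shows "const_sign u v f"
proof (rule ccontr)
  assume "\<not> ?thesis"
  then obtain x y where xy: "x \<in> {u..v}" "f x < 0" "y \<in> {u..v}" "0 < f y"
    unfolding const_sign_def by force
  have "connected (f ` {u..v})" by (rule connected_continuous_image[OF assms(1)]) simp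
  hence "0 \<in> f ` {u..v}"
    by (rule connectedD_interval[of _ "f x" "f y"]) (use xy in auto)
  thus False using assms(2) by force
qed

lemma set_integral_min_one_quot_mono:
  assumes "set_integrable lborel B (\<lambda>t. min_one_quot (f t) (g t))" "A \<in> sets borel" "A \<subseteq> B"
  shows "(LINT t:A|lborel. min_one_quot (f t) (g t)) \<le> (LINT t:B|lborel. min_one_quot (f t) (g t))"
proof -
  have "set_integrable lborel A (\<lambda>t. min_one_quot (f t) (g t))"
    by (rule set_integrable_subset[OF assms(1)]) (use assms in auto)
  thus ?thesis using assms(1,3) unfolding set_lebesgue_integral_def set_integrable_def
    by (intro integral_mono) (auto simp: indicator_def min_one_quot_bounds)
qed

lemma set_integral_min_one_quot_nonneg: "0 \<le> (LINT t:A|M. min_one_quot (f t) (g t))"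
  unfolding set_lebesgue_integral_def
  by (intro Bochner_Integration.integral_nonneg) (auto simp: min_one_quot_bounds)

text \<open>\<open>g (Suc j)\<close> has constant sign, so there are at most
  \<open>2 ^ (j - 1)\<close> pieces on which \<open>g 2\<close> has constant sign. Cutting each
  where \<open>g 1\<close> crosses \<epsilon> and \<open>-\<epsilon>\<close> gives at most four
  parts, each costing at most \<open>7 * B * \<kappa>\<close>, hence 28.\<close>

lemma osc_finite_type:
  assumes j: "j \<ge> 1" and c: "c > 0" and Cb: "Cb \<ge> 0" and c0: "c0 > 0"
  shows "\<exists>C\<ge>0. \<forall>g \<psi> \<psi>' lam B u v. oscillation (g 0) (g 1) (g 2) \<psi> \<psi>' lam B u v \<longrightarrow> derivs_on u v g \<longrightarrow>
    u \<le> v \<longrightarrow> v - u \<le> 3 \<longrightarrow> (\<forall>x\<in>{u..v}. c \<le> \<bar>g (Suc j) x\<bar> \<and> \<bar>g (Suc j) x\<bar> \<le> Cb) \<longrightarrow>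
    (\<exists>y\<in>{u..v}. c0 \<le> \<bar>g 1 y\<bar>) \<longrightarrow>
    oscillation.osc (g 0) \<psi> lam u v \<le>
      C * B * ((LINT t:{u..v}|lborel. min_one_quot (g 2 t) (\<bar>lam\<bar> * (g 1 t)\<^sup>2)) + 1 / \<bar>lam\<bar>)"
proof -
  obtain K where K: "K \<ge> 1" and short_all: "\<forall>g u v \<Lambda> T p q. derivs_on u v g \<longrightarrow>
    (\<forall>x\<in>{u..v}. c \<le> \<bar>g j x\<bar> \<and> \<bar>g j x\<bar> \<le> Cb) \<longrightarrow>
    (\<exists>y\<in>{u..v}. c0 \<le> \<bar>g 0 y\<bar>) \<longrightarrow> \<Lambda> > 0 \<longrightarrow> u \<le> p \<longrightarrow> p \<le> q \<longrightarrow> q \<le> v \<longrightarrow>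
    T = (LINT t:{u..v}|lborel. min_one_quot (g 1 t) (\<Lambda> * (g 0 t)\<^sup>2)) \<longrightarrow>
    (\<forall>x\<in>{p..q}. \<bar>g 0 x\<bar> \<le> 1 / (\<Lambda> * (K * (T + 1 / \<Lambda>)))) \<longrightarrow> q - p \<le> K * (T + 1 / \<Lambda>)"
    using small_interval_short[OF j c Cb c0] by (elim exE conjE)
  show ?thesis
  proof (intro exI[of _ "2 ^ (j - 1) * (28 * K)"] conjI allI impI)
    show "0 \<le> 2 ^ (j - 1) * (28 * K)" using K by simp
    fix g :: "nat \<Rightarrow> real \<Rightarrow> real" and \<psi> \<psi>' :: "real \<Rightarrow> complex" and lam B u v :: real
    assume "oscillation (g 0) (g 1) (g 2) \<psi> \<psi>' lam B u v" and g: "derivs_on u v g" and uv: "u \<le> v" "v - u \<le> 3"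
      and gj: "\<forall>x\<in>{u..v}. c \<le> \<bar>g (Suc j) x\<bar> \<and> \<bar>g (Suc j) x\<bar> \<le> Cb" and y: "\<exists>y\<in>{u..v}. c0 \<le> \<bar>g 1 y\<bar>"
    then interpret oscillation "g 0" "g 1" "g 2" \<psi> \<psi>' lam B u v by simp
    define T where "T = (LINT t:{u..v}|lborel. min_one_quot (g 2 t) (\<bar>lam\<bar> * (g 1 t)\<^sup>2))"
    define \<kappa> where "\<kappa> = K * (T + 1 / \<bar>lam\<bar>)"
    define \<epsilon> where "\<epsilon> = 1 / (\<bar>lam\<bar> * \<kappa>)"
    have T0: "T \<ge> 0" unfolding T_def by (rule set_integral_min_one_quot_nonneg)
    have \<kappa>: "\<kappa> > 0" unfolding \<kappa>_def using K T0 lam by (intro mult_pos_pos add_nonneg_pos) auto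
    have \<epsilon>: "\<epsilon> > 0" using \<kappa> lam by (simp add: \<epsilon>_def)
    \<comment> \<open>The level \<epsilon> is chosen so that integration by parts where
      \<open>\<bar>g 1\<bar> \<ge> \<epsilon>\<close> costs a multiple of \<kappa>, the same order
      as the trivial estimate on a part of length at most \<kappa>.\<close>
    have inv: "7 * B / (\<bar>lam\<bar> * \<epsilon>) = 7 * B * \<kappa>" using lam \<kappa> by (simp add: \<epsilon>_def)
    have piece: "osc p q \<le> 7 * B * \<kappa>"
      if pq: "u \<le> p" "p \<le> q" "q \<le> v" and s: "const_sign p q (g 2)"
        "const_sign p q (\<lambda>x. g 1 x - \<epsilon>)" "const_sign p q (\<lambda>x. g 1 x + \<epsilon>)" for p q
    proof -
      have len: "q - p \<le> 3" using pq uv by linarith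
      consider "\<forall>x\<in>{p..q}. \<epsilon> \<le> \<bar>g 1 x\<bar>" | "\<forall>x\<in>{p..q}. \<bar>g 1 x\<bar> \<le> \<epsilon>"
      proof -
        have "(\<forall>x\<in>{p..q}. \<epsilon> \<le> \<bar>g 1 x\<bar>) \<or> (\<forall>x\<in>{p..q}. \<bar>g 1 x\<bar> \<le> \<epsilon>)"
          using s(2)[unfolded const_sign_def]
        proof
          assume a: "\<forall>x\<in>{p..q}. 0 \<le> g 1 x - \<epsilon>"
          have "\<epsilon> \<le> \<bar>g 1 x\<bar>" if "x \<in> {p..q}" for x using bspec[OF a that] by linarith
          thus ?thesis by blast
        next
          assume up: "\<forall>x\<in>{p..q}. g 1 x - \<epsilon> \<le> 0"
          show ?thesis using s(3)[unfolded const_sign_def]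
          proof
            assume a: "\<forall>x\<in>{p..q}. 0 \<le> g 1 x + \<epsilon>"
            have "\<bar>g 1 x\<bar> \<le> \<epsilon>" if "x \<in> {p..q}" for x
              using bspec[OF a that] bspec[OF up that] by linarith
            thus ?thesis by blast
          next
            assume a: "\<forall>x\<in>{p..q}. g 1 x + \<epsilon> \<le> 0"
            have "\<epsilon> \<le> \<bar>g 1 x\<bar>" if "x \<in> {p..q}" for x
              using bspec[OF a that] by linarith
            thus ?thesis by blast
          qed
        qed
        thus thesis using that by blast
      qed
      thus ?thesis
      proof cases
        case 1
        thus ?thesis using osc_monotone[OF pq len \<epsilon> _ s(1)] inv by simp
      next
        case 2
        have T': "T = (LINT t:{u..v}|lborel. min_one_quot (g (Suc 1) t) (\<bar>lam\<bar> * (g (Suc 0) t)\<^sup>2))"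
          by (simp add: T_def numeral_2_eq_2)
        have small: "\<forall>x\<in>{p..q}. \<bar>g (Suc 0) x\<bar> \<le> 1 / (\<bar>lam\<bar> * (K * (T + 1 / \<bar>lam\<bar>)))"
          using 2 by (simp add: \<epsilon>_def \<kappa>_def)
        have y': "\<exists>y\<in>{u..v}. c0 \<le> \<bar>g (Suc 0) y\<bar>" using y by simp
        have lam': "\<bar>lam\<bar> > 0" using lam by simp
        \<comment> \<open>The lemma on short intervals concerns a function and its derivatives; here
          that function is the derivative of the phase, so the sequence is shifted by one.\<close>
        have "q - p \<le> \<kappa>" unfolding \<kappa>_def
        proof (rule short_all[rule_format, where g = "\<lambda>k. g (Suc k)" and u = u and v = v and \<Lambda> = "\<bar>lam\<bar>"
              and T = T and p = p and q = q])
          show "derivs_on u v (\<lambda>k. g (Suc k))" by (rule derivs_on_Suc[OF g])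
          show "T = (LINT t:{u..v}|lborel. min_one_quot (g (Suc 1) t) (\<bar>lam\<bar> * (g (Suc 0) t)\<^sup>2))" by (rule T')
          show "c \<le> \<bar>g (Suc j) x\<bar> \<and> \<bar>g (Suc j) x\<bar> \<le> Cb" if "x \<in> {u..v}" for x using gj that by blast
          show "\<exists>y\<in>{u..v}. c0 \<le> \<bar>g (Suc 0) y\<bar>" by (rule y')
          show "\<bar>g (Suc 0) x\<bar> \<le> 1 / (\<bar>lam\<bar> * (K * (T + 1 / \<bar>lam\<bar>)))" if "x \<in> {p..q}" for x using small that by blast
        qed (rule lam' pq)+
        hence "B * (q - p) \<le> B * \<kappa>" using B0 by (rule mult_left_mono)
        moreover have "0 \<le> B * \<kappa>" using B0 \<kappa> by simp
        ultimately show ?thesis using osc_trivial[OF pq] by linarith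
      qed
    qed
    have mono: "osc p q \<le> 28 * B * \<kappa>"
      if pq: "u \<le> p" "p \<le> q" "q \<le> v" and s: "const_sign p q (g 2)" for p q
    proof -
      have der: "((\<lambda>x. g 1 x + e) has_real_derivative g 2 x) (at x within {p'..q'})"
        if "p \<le> p'" "q' \<le> q" "x \<in> {p'..q'}" for p' q' x e
      proof -
        have "derivs_on p' q' g" by (rule derivs_on_subset[OF g]) (use that pq in auto)
        from derivs_onD[OF this that(3), of 1] show ?thesis
          by (auto intro!: derivative_eq_intros simp: numeral_2_eq_2)
      qed
      have two: "osc p' q' \<le> 14 * B * \<kappa>"
        if tw: "p \<le> p'" "p' \<le> q'" "q' \<le> q" "const_sign p' q' (\<lambda>x. g 1 x - \<epsilon>)" for p' q'
      proof -
        obtain r where r: "p' \<le> r" "r \<le> q'" "const_sign p' r (\<lambda>x. g 1 x + \<epsilon>)" "const_sign r q' (\<lambda>x. g 1 x + \<epsilon>)"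
        proof (rule const_sign_split[of p' q' "\<lambda>x. g 1 x + \<epsilon>" "g 2"])
          show "((\<lambda>x. g 1 x + \<epsilon>) has_real_derivative g 2 x) (at x within {p'..q'})" if "x \<in> {p'..q'}" for x
            by (rule der) (use \<open>p \<le> p'\<close> \<open>q' \<le> q\<close> that in simp_all)
        qed (use const_sign_subset[OF s tw(1,3)] tw(2) in simp_all)
        have "osc p' q' \<le> osc p' r + osc r q'" by (rule osc_subadd) (use r tw pq in linarith)+
        also have "\<dots> \<le> 7 * B * \<kappa> + 7 * B * \<kappa>"
        proof (rule add_mono; rule piece)
          show "const_sign p' r (g 2)" "const_sign r q' (g 2)"
            by (rule const_sign_subset[OF s]; use tw r in linarith)+
          show "const_sign p' r (\<lambda>x. g 1 x - \<epsilon>)" "const_sign r q' (\<lambda>x. g 1 x - \<epsilon>)"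
            by (rule const_sign_subset[OF tw(4)]; use tw r in linarith)+
        qed (use r tw pq in \<open>simp_all\<close>)
        finally show ?thesis by simp
      qed
      obtain r where r: "p \<le> r" "r \<le> q" "const_sign p r (\<lambda>x. g 1 x + - \<epsilon>)" "const_sign r q (\<lambda>x. g 1 x + - \<epsilon>)"
      proof (rule const_sign_split[of p q "\<lambda>x. g 1 x + - \<epsilon>" "g 2"])
        show "((\<lambda>x. g 1 x + - \<epsilon>) has_real_derivative g 2 x) (at x within {p..q})" if "x \<in> {p..q}" for x
          by (rule der) (use that in simp_all)
      qed (use s pq(2) in simp_all)
      have "osc p q \<le> osc p r + osc r q" by (rule osc_subadd) (use r pq in linarith)+
      also have "\<dots> \<le> 14 * B * \<kappa> + 14 * B * \<kappa>" using r by (intro add_mono two) simp_all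
      finally show ?thesis by simp
    qed
    have "const_sign u v (g (Suc j))"
      by (rule nonvanishing_const_sign[OF derivs_on_continuous[OF g]]) (use gj c in force)
    hence "osc u v \<le> 2 ^ (j - 1) * (28 * B * \<kappa>)"
    proof (intro sign_splitting[where g = "\<lambda>k. g (Suc k)" and \<Phi> = osc and u = u and v = v])
      show "derivs_on u v (\<lambda>k. g (Suc k))" by (rule derivs_on_Suc[OF g])
      show "osc p q \<le> osc p r + osc r q" if "u \<le> p" "p \<le> r" "r \<le> q" "q \<le> v" for p r q
        by (rule osc_subadd[OF that])
      show "osc p q \<le> 28 * B * \<kappa>" if "u \<le> p" "p \<le> q" "q \<le> v" "const_sign p q (g (Suc 1))" for p q
        using mono[OF that(1-3)] that(4) by (simp add: numeral_2_eq_2)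
    qed (use j uv in simp_all)
    thus "osc u v \<le> 2 ^ (j - 1) * (28 * K) * B *
        ((LINT t:{u..v}|lborel. min_one_quot (g 2 t) (\<bar>lam\<bar> * (g 1 t)\<^sup>2)) + 1 / \<bar>lam\<bar>)"
      unfolding T_def[symmetric] by (simp only: \<kappa>_def mult_ac)
  qed
qed

section \<open>Jets along a ray and the uniform one-dimensional bound\<close>

lemma gronwall_jets:
  assumes g: "derivs_on 1 4 g" and A: "A \<ge> 0"
    and ode: "\<forall>x\<in>{1..4}. (g (Suc N) x)\<^sup>2 \<le> A * (\<Sum>j<N. (g (Suc j) x)\<^sup>2)" and x: "x \<in> {1..4}"
  defines "Y \<equiv> \<lambda>x. \<Sum>j<N. (g (Suc j) x)\<^sup>2"
  shows "Y 1 * exp (- (3 * (2 + A))) \<le> Y x" "Y x \<le> Y 1 * exp (3 * (2 + A))"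
proof -
  \<comment> \<open>By \<open>2 a b \<le> a\<^sup>2 + b\<^sup>2\<close> the derivative of
    \<open>Y\<close> is at most \<open>Y\<close> plus the sum with orders raised by one. The latter
    is at most \<open>(1 + A) * Y\<close>, since \<open>ode\<close> controls the one new term. So
    \<open>L = 2 + A\<close> is the Gronwall rate: \<open>Y\<close> times \<open>exp (L * x)\<close>
    increases, \<open>Y\<close> times \<open>exp (- L * x)\<close> decreases.\<close>
  define L where "L = 2 + A"
  define Y' where "Y' x = (\<Sum>j<N. 2 * g (Suc j) x * g (Suc (Suc j)) x)" for x
  have Y: "(Y has_real_derivative Y' t) (at t within {1..4})" if "t \<in> {1..4}" for t
    unfolding Y_def Y'_def
    by (auto intro!: derivative_eq_intros derivs_onD[OF g that] simp: mult_ac)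
  have Y'b: "\<bar>Y' t\<bar> \<le> L * Y t" if t: "t \<in> {1..4}" for t
  proof -
    have "\<bar>Y' t\<bar> \<le> (\<Sum>j<N. (g (Suc j) t)\<^sup>2 + (g (Suc (Suc j)) t)\<^sup>2)"
      unfolding Y'_def
    proof (rule order_trans[OF sum_abs sum_mono])
      fix j
      have "\<bar>2 * a * b\<bar> \<le> a\<^sup>2 + b\<^sup>2" for a b :: real
        using sum_squares_bound[of "\<bar>a\<bar>" "\<bar>b\<bar>"] by (simp add: abs_mult)
      thus "\<bar>2 * g (Suc j) t * g (Suc (Suc j)) t\<bar> \<le> (g (Suc j) t)\<^sup>2 + (g (Suc (Suc j)) t)\<^sup>2" .
    qed
    also have "\<dots> = Y t + (\<Sum>j<N. (g (Suc (Suc j)) t)\<^sup>2)" by (simp add: sum.distrib Y_def)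
    also have "(\<Sum>j<N. (g (Suc (Suc j)) t)\<^sup>2) = Y t + (g (Suc N) t)\<^sup>2 - (g (Suc 0) t)\<^sup>2"
      using sum.lessThan_Suc_shift[of "\<lambda>j. (g (Suc j) t)\<^sup>2" N] by (simp add: Y_def)
    also have "(g (Suc N) t)\<^sup>2 \<le> A * Y t" using ode t by (simp add: Y_def)
    finally have "\<bar>Y' t\<bar> \<le> Y t + (Y t + A * Y t - (g (Suc 0) t)\<^sup>2)" by simp
    moreover have "0 \<le> (g (Suc 0) t)\<^sup>2" by simp
    moreover have "L * Y t = 2 * Y t + A * Y t" by (simp add: L_def distrib_right)
    ultimately show ?thesis by linarith
  qed
  have 1: "Y 1 * exp (L * 1) \<le> Y x * exp (L * x)"
  proof -
    have "\<exists>z\<in>{1..4}. Y x * exp (L * x) - Y 1 * exp (L * 1) = (x - 1) * (Y' z * exp (L * z) + Y z * (L * exp (L * z)))"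
      by (rule mvt_ex[where f = "\<lambda>x. Y x * exp (L * x)"])
         (use x in \<open>auto intro!: derivative_eq_intros Y\<close>)
    then obtain z where z: "z \<in> {1..4}"
      "Y x * exp (L * x) - Y 1 * exp (L * 1) = (x - 1) * (Y' z * exp (L * z) + Y z * (L * exp (L * z)))" by blast
    have "Y' z * exp (L * z) + Y z * (L * exp (L * z)) = (Y' z + L * Y z) * exp (L * z)" by (simp add: algebra_simps)
    also have "\<dots> \<ge> 0" using Y'b[OF z(1)] by (intro mult_nonneg_nonneg) auto
    finally have "0 \<le> (x - 1) * (Y' z * exp (L * z) + Y z * (L * exp (L * z)))" using x by (intro mult_nonneg_nonneg) auto
    thus ?thesis using z(2) by linarith
  qed
  have 2: "Y x * exp (- L * x) \<le> Y 1 * exp (- L * 1)"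
  proof -
    have "\<exists>z\<in>{1..4}. Y x * exp (- L * x) - Y 1 * exp (- L * 1) = (x - 1) * (Y' z * exp (- L * z) + Y z * (- L * exp (- L * z)))"
      by (rule mvt_ex[where f = "\<lambda>x. Y x * exp (- L * x)"])
         (use x in \<open>auto intro!: derivative_eq_intros Y\<close>)
    then obtain z where z: "z \<in> {1..4}"
      "Y x * exp (- L * x) - Y 1 * exp (- L * 1) = (x - 1) * (Y' z * exp (- L * z) + Y z * (- L * exp (- L * z)))" by blast
    have "Y' z * exp (- L * z) + Y z * (- L * exp (- L * z)) = (Y' z - L * Y z) * exp (- L * z)" by (simp add: algebra_simps)
    also have "\<dots> \<le> 0" using Y'b[OF z(1)] by (intro mult_nonpos_nonneg) auto
    finally have "(x - 1) * (Y' z * exp (- L * z) + Y z * (- L * exp (- L * z))) \<le> 0" using x by (intro mult_nonneg_nonpos) auto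
    thus ?thesis using z(2) by linarith
  qed
  have Y0: "0 \<le> Y t" for t unfolding Y_def by (intro sum_nonneg) auto
  have L: "L \<ge> 0" using A by (simp add: L_def)
  have "Y 1 * exp (- (3 * L)) = Y 1 * exp (L * 1) * exp (- (L * 4))" by (simp flip: exp_add)
  also have "\<dots> \<le> Y x * exp (L * x) * exp (- (L * 4))" using 1 by (intro mult_right_mono) auto
  also have "\<dots> = Y x * exp (L * x - L * 4)" by (simp flip: exp_add)
  also have "\<dots> \<le> Y x * 1" using L x Y0[of x] by (intro mult_left_mono) (auto intro!: mult_left_mono)
  finally show "Y 1 * exp (- (3 * (2 + A))) \<le> Y x" by (simp add: L_def)
  have "Y x = Y x * exp (- L * x) * exp (L * x)" by (simp flip: exp_add)
  also have "\<dots> \<le> Y 1 * exp (- L * 1) * exp (L * x)" using 2 by (intro mult_right_mono) auto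
  also have "\<dots> = Y 1 * exp (L * x - L)" by (simp flip: exp_add)
  also have "\<dots> \<le> Y 1 * exp (3 * L)" using L x Y0[of 1]
    by (intro mult_left_mono) (auto simp: algebra_simps intro!: order_trans[OF mult_left_mono[of x 4 L]])
  finally show "Y x \<le> Y 1 * exp (3 * (2 + A))" by (simp add: L_def)
qed

lemma osc_pieces:
  fixes \<Phi> :: "real \<Rightarrow> real \<Rightarrow> real"
  assumes sub: "\<And>p r q. 2 \<le> p \<Longrightarrow> p \<le> r \<Longrightarrow> r \<le> q \<Longrightarrow> q \<le> 4 \<Longrightarrow> \<Phi> p q \<le> \<Phi> p r + \<Phi> r q"
    and refl: "\<Phi> 2 2 \<le> 0" and d: "d \<ge> 0" "2 + real n * d \<le> 4"
    and piece: "\<And>k. k < n \<Longrightarrow> \<Phi> (2 + real k * d) (2 + real (Suc k) * d) \<le> Z"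
  shows "\<Phi> 2 (2 + real n * d) \<le> real n * Z"
proof -
  have "m \<le> n \<Longrightarrow> \<Phi> 2 (2 + real m * d) \<le> real m * Z" for m
  proof (induction m)
    case 0
    thus ?case using refl by simp
  next
    case (Suc m)
    have "real (Suc m) * d \<le> real n * d" using Suc.prems d(1) by (intro mult_right_mono) auto
    moreover have "real m * d \<le> real (Suc m) * d" using d(1) by (intro mult_right_mono) auto
    moreover have "0 \<le> real m * d" using d(1) by simp
    ultimately have "\<Phi> 2 (2 + real (Suc m) * d) \<le> \<Phi> 2 (2 + real m * d) + \<Phi> (2 + real m * d) (2 + real (Suc m) * d)"
      using d(2) by (intro sub) linarith+
    also have "\<dots> \<le> real m * Z + Z" using Suc by (intro add_mono piece) auto
    finally show ?case by (simp add: distrib_right)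
  qed
  thus ?thesis by simp
qed

lemma oscillation_subset:
  assumes "oscillation G h h' \<psi> \<psi>' lam B u v" "u \<le> p" "q \<le> v"
  shows "oscillation G h h' \<psi> \<psi>' lam B p q"
proof -
  interpret oscillation G h h' \<psi> \<psi>' lam B u v by fact
  have sub: "{p..q} \<subseteq> {u..v}" using assms by auto
  show ?thesis
  proof
    fix x assume "x \<in> {p..q}"
    hence x: "x \<in> {u..v}" using sub by blast
    show "(G has_real_derivative h x) (at x within {p..q})" by (rule has_field_derivative_subset[OF G[OF x] sub])
    show "(h has_real_derivative h' x) (at x within {p..q})" by (rule has_field_derivative_subset[OF h[OF x] sub])
    show "(\<psi> has_vector_derivative \<psi>' x) (at x within {p..q})" by (rule has_vector_derivative_within_subset[OF \<psi>[OF x] sub])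
    show "norm (\<psi> x) \<le> B" "norm (\<psi>' x) \<le> B" using B x by auto
  next
    show "continuous_on {p..q} h'" by (rule continuous_on_subset[OF h' sub])
    show "continuous_on {p..q} \<psi>'" by (rule continuous_on_subset[OF \<psi>' sub])
  qed (rule B0, rule lam)
qed

text \<open>Gronwall keeps the jet between fixed positive bounds on all of \<open>{1..4}\<close>, so
  at each point some derivative of order at most \<open>N\<close> is at least \<open>c\<close> and
  stays above \<open>c / 2\<close> over length \<open>d\<close>. If it is the first, integration by
  parts suffices; otherwise \<open>osc_finite_type\<close> applies. The bound on \<open>g 1\<close>
  serves later to compare the size of the jet with the supremum of the derivative.\<close>

lemma osc_normalised:
  assumes N: "N \<ge> 1" and A: "A \<ge> 0"
  shows "\<exists>C\<ge>0. \<forall>g \<psi> \<psi>' lam B. oscillation (g 0) (g 1) (g 2) \<psi> \<psi>' lam B 1 4 \<longrightarrow> derivs_on 1 4 g \<longrightarrow>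
    (\<forall>x\<in>{1..4}. (g (Suc N) x)\<^sup>2 \<le> A * (\<Sum>j<N. (g (Suc j) x)\<^sup>2)) \<longrightarrow> (\<Sum>j<N. (g (Suc j) 1)\<^sup>2) = 1 \<longrightarrow>
    oscillation.osc (g 0) \<psi> lam 2 4 \<le>
      C * B * ((LINT t:{2..4}|lborel. min_one_quot (g 2 t) (\<bar>lam\<bar> * (g 1 t)\<^sup>2)) + 1 / \<bar>lam\<bar>) \<and>
    (\<forall>x\<in>{1..4}. \<bar>g 1 x\<bar> \<le> C)"
proof -
  define L where "L = 3 * (2 + A)"
  \<comment> \<open>\<open>M\<close> bounds all derivatives of orders 1 to \<open>N + 1\<close>; the
    factor \<open>1 + A\<close> accounts for the last one. By pigeonhole among \<open>N\<close>
    squares with sum at least \<open>exp (- L)\<close>, one derivative is at least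
    \<open>c\<close>.\<close>
  define M where "M = sqrt (exp L * (1 + A))"
  define c where "c = sqrt (exp (- L) / N)"
  have M: "M > 0" using A by (simp add: M_def add_pos_nonneg)
  have c: "c > 0" using N by (simp add: c_def)
  \<comment> \<open>Enough equal pieces of \<open>{2..4}\<close> that a function with derivative at
    most \<open>M\<close> varies by at most \<open>c / 2\<close> on each.\<close>
  obtain n :: nat where n: "real n > 4 * M / c" using reals_Archimedean2 by blast
  have n0: "real n > 0" using n M c by (smt (verit) divide_pos_pos)
  define d where "d = 2 / real n"
  have d: "d > 0" "2 + real n * d = 4" "d * M \<le> c / 2"
    using n n0 M c by (auto simp: d_def field_simps)
  define P where "P j C \<longleftrightarrow> (\<forall>g \<psi> \<psi>' lam B u v. oscillation (g 0) (g 1) (g 2) \<psi> \<psi>' lam B u v \<longrightarrow> derivs_on u v g \<longrightarrow>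
    u \<le> v \<longrightarrow> v - u \<le> 3 \<longrightarrow> v - u = d \<longrightarrow> (\<forall>x\<in>{u..v}. c / 2 \<le> \<bar>g (Suc j) x\<bar> \<and> \<bar>g (Suc j) x\<bar> \<le> M) \<longrightarrow>
    oscillation.osc (g 0) \<psi> lam u v \<le>
      C * B * ((LINT t:{u..v}|lborel. min_one_quot (g 2 t) (\<bar>lam\<bar> * (g 1 t)\<^sup>2)) + 1 / \<bar>lam\<bar>))" for j C
  have exP: "\<exists>C\<ge>0. P j C" if j: "j \<in> {1..<N}" for j
  proof -
    obtain \<kappa> where \<kappa>: "\<kappa> > 0" and low: "\<And>g p q V. p < q \<Longrightarrow> derivs_on p q g \<Longrightarrow> (\<forall>x\<in>{p..q}. V \<le> \<bar>g j x\<bar>) \<Longrightarrow>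
       (\<exists>x\<in>{p..q}. \<kappa> * V * (q - p) ^ j \<le> \<bar>g 0 x\<bar>)"
      using large_derivative_imp_large[of j] by blast
    \<comment> \<open>A derivative of \<open>g 1\<close> of size at least \<open>c / 2\<close> on an
      interval of length \<open>d\<close> forces \<open>\<bar>g 1\<bar>\<close> to reach this value,
      by \<open>large_derivative_imp_large\<close>.\<close>
    define c0 where "c0 = \<kappa> * (c / 2) * d ^ j"
    have c0: "c0 > 0" using \<kappa> c d by (simp add: c0_def)
    obtain C where C: "C \<ge> 0" and ft: "\<forall>g \<psi> \<psi>' lam B u v. oscillation (g 0) (g 1) (g 2) \<psi> \<psi>' lam B u v \<longrightarrow> derivs_on u v g \<longrightarrow>
      u \<le> v \<longrightarrow> v - u \<le> 3 \<longrightarrow> (\<forall>x\<in>{u..v}. c / 2 \<le> \<bar>g (Suc j) x\<bar> \<and> \<bar>g (Suc j) x\<bar> \<le> M) \<longrightarrow>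
      (\<exists>y\<in>{u..v}. c0 \<le> \<bar>g 1 y\<bar>) \<longrightarrow>
      oscillation.osc (g 0) \<psi> lam u v \<le>
        C * B * ((LINT t:{u..v}|lborel. min_one_quot (g 2 t) (\<bar>lam\<bar> * (g 1 t)\<^sup>2)) + 1 / \<bar>lam\<bar>)"
      using osc_finite_type[of j "c / 2" M c0] j c M c0 by force
    have "P j C" unfolding P_def
    proof (intro allI impI)
      fix g :: "nat \<Rightarrow> real \<Rightarrow> real" and \<psi> \<psi>' :: "real \<Rightarrow> complex" and lam B u v :: real
      assume o: "oscillation (g 0) (g 1) (g 2) \<psi> \<psi>' lam B u v" and g: "derivs_on u v g" and uv: "u \<le> v" "v - u \<le> 3" "v - u = d"
        and b: "\<forall>x\<in>{u..v}. c / 2 \<le> \<bar>g (Suc j) x\<bar> \<and> \<bar>g (Suc j) x\<bar> \<le> M"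
      have "u < v" using uv d by linarith
      moreover have "\<forall>x\<in>{u..v}. c / 2 \<le> \<bar>g (Suc j) x\<bar>" using b by blast
      ultimately have "\<exists>x\<in>{u..v}. \<kappa> * (c / 2) * (v - u) ^ j \<le> \<bar>g (Suc 0) x\<bar>"
        by (intro low[of u v "\<lambda>k. g (Suc k)"] derivs_on_Suc[OF g])
      hence y: "\<exists>y\<in>{u..v}. c0 \<le> \<bar>g 1 y\<bar>" by (simp add: c0_def uv(3))
      show "oscillation.osc (g 0) \<psi> lam u v \<le>
        C * B * ((LINT t:{u..v}|lborel. min_one_quot (g 2 t) (\<bar>lam\<bar> * (g 1 t)\<^sup>2)) + 1 / \<bar>lam\<bar>)"
        by (rule ft[THEN spec, THEN spec, THEN spec, THEN spec, THEN spec, THEN spec, THEN spec,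
            THEN mp, THEN mp, THEN mp, THEN mp, THEN mp, THEN mp, OF o g uv(1,2) b y])
    qed
    thus ?thesis using C by blast
  qed
  have "\<forall>j\<in>{1..<N}. \<exists>C. C \<ge> 0 \<and> P j C" using exP by blast
  from bchoice[OF this] obtain Cj where Cj: "\<forall>j\<in>{1..<N}. Cj j \<ge> 0 \<and> P j (Cj j)" by blast
  \<comment> \<open>The first summand is the cost of integrating by parts with
    \<open>\<bar>g 1\<bar> \<ge> c / 2\<close>: five times \<open>2 / c\<close>, and
    \<open>M / (c / 2)\<^sup>2\<close> over a length of at most 3.\<close>
  define C where "C = (10 / c + 3 * M / (c / 2)\<^sup>2) + (\<Sum>j\<in>{1..<N}. Cj j)"
  have CjC: "Cj j \<le> C" if "j \<in> {1..<N}" for j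
  proof -
    have "Cj j \<le> (\<Sum>j\<in>{1..<N}. Cj j)" using Cj that by (intro member_le_sum) auto
    moreover have "0 \<le> 10 / c + 3 * M / (c / 2)\<^sup>2" using c M by simp
    ultimately show ?thesis by (simp add: C_def)
  qed
  have C0: "10 / c + 3 * M / (c / 2)\<^sup>2 \<le> C" "C \<ge> 0"
  proof -
    have "0 \<le> (\<Sum>j\<in>{1..<N}. Cj j)" using Cj by (intro sum_nonneg) auto
    moreover have "0 \<le> 10 / c + 3 * M / (c / 2)\<^sup>2" using c M by simp
    ultimately show "10 / c + 3 * M / (c / 2)\<^sup>2 \<le> C" "C \<ge> 0" by (auto simp: C_def)
  qed
  define C' where "C' = real n * C + M"
  show ?thesis
  proof (intro exI[of _ C'] conjI allI impI ballI)
    show "C' \<ge> 0" using C0 M by (simp add: C'_def)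
    fix g :: "nat \<Rightarrow> real \<Rightarrow> real" and \<psi> \<psi>' :: "real \<Rightarrow> complex" and lam B :: real
    assume o: "oscillation (g 0) (g 1) (g 2) \<psi> \<psi>' lam B 1 4" and g: "derivs_on 1 4 g"
      and ode: "\<forall>x\<in>{1..4}. (g (Suc N) x)\<^sup>2 \<le> A * (\<Sum>j<N. (g (Suc j) x)\<^sup>2)" and one: "(\<Sum>j<N. (g (Suc j) 1)\<^sup>2) = 1"
    interpret oscillation "g 0" "g 1" "g 2" \<psi> \<psi>' lam B 1 4 by (rule o)
    define T where "T = (LINT t:{2..4}|lborel. min_one_quot (g 2 t) (\<bar>lam\<bar> * (g 1 t)\<^sup>2))"
    have Y: "exp (- L) \<le> (\<Sum>j<N. (g (Suc j) x)\<^sup>2)" "(\<Sum>j<N. (g (Suc j) x)\<^sup>2) \<le> exp L" if "x \<in> {1..4}" for x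
      using gronwall_jets[OF g A ode that] one by (simp_all add: L_def)
    have bd: "\<bar>g (Suc j) x\<bar> \<le> M" if "x \<in> {1..4}" "j \<le> N" for j x
    proof -
      have "(g (Suc j) x)\<^sup>2 \<le> exp L * (1 + A)"
      proof (cases "j = N")
        case True
        have "(g (Suc j) x)\<^sup>2 \<le> A * (\<Sum>j<N. (g (Suc j) x)\<^sup>2)" using ode that True by blast
        also have "\<dots> \<le> A * exp L" using Y(2)[OF that(1)] A by (intro mult_left_mono) auto
        also have "\<dots> \<le> exp L * (1 + A)" by (simp add: distrib_left mult.commute)
        finally show ?thesis .
      next
        case False
        hence "(g (Suc j) x)\<^sup>2 \<le> (\<Sum>j<N. (g (Suc j) x)\<^sup>2)" using that by (intro member_le_sum) auto
        also have "\<dots> \<le> exp L" by (rule Y(2)[OF that(1)])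
        also have "\<dots> \<le> exp L * (1 + A)" using A by simp
        finally show ?thesis .
      qed
      thus ?thesis unfolding M_def by (rule real_le_rsqrt[of "\<bar>_\<bar>", simplified])
    qed
    have big: "\<exists>j<N. c \<le> \<bar>g (Suc j) x\<bar>" if "x \<in> {1..4}" for x
    proof (rule ccontr)
      assume "\<not> ?thesis"
      hence lt: "\<bar>g (Suc j) x\<bar> < c" if "j < N" for j using that by force
      have "(g (Suc j) x)\<^sup>2 < exp (- L) / N" if "j < N" for j
      proof -
        have "\<bar>g (Suc j) x\<bar>\<^sup>2 < c\<^sup>2" using lt[OF that] by (intro power_strict_mono) auto
        thus ?thesis by (simp add: c_def)
      qed
      hence "(\<Sum>j<N. (g (Suc j) x)\<^sup>2) < (\<Sum>j<N. exp (- L) / N)" using N by (intro sum_strict_mono) (auto simp: lessThan_empty_iff bot_nat_def)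
      also have "\<dots> = exp (- L)" using N by simp
      finally show False using Y(1)[OF that] by linarith
    qed
    have cont_sq: "continuous_on {2..4} (\<lambda>t. \<bar>lam\<bar> * (g 1 t)\<^sup>2)" "continuous_on {2..4} (g 2)"
      by (intro continuous_intros derivs_on_continuous[OF derivs_on_subset[OF g]]; simp)+
    have Tint: "set_integrable lborel {2..4} (\<lambda>t. min_one_quot (g 2 t) (\<bar>lam\<bar> * (g 1 t)\<^sup>2))"
      by (rule min_one_quot_set_integrable[OF cont_sq(2,1)])
    have piece: "osc u v \<le> C * B * (T + 1 / \<bar>lam\<bar>)" if uv: "2 \<le> u" "v \<le> 4" "v - u = d" for u v
    proof -
      have sub: "{u..v} \<subseteq> {1..4}" and u: "u \<in> {1..4}" "u < v" using uv d by auto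
      obtain j where j: "j < N" "c \<le> \<bar>g (Suc j) u\<bar>" using big[OF u(1)] by blast
      have lo: "c / 2 \<le> \<bar>g (Suc j) x\<bar>" if x: "x \<in> {u..v}" for x
      proof -
        have "x \<in> {1..4}" using x sub by blast
        then obtain z where z: "z \<in> {1..4}" "g (Suc j) x - g (Suc j) u = (x - u) * g (Suc (Suc j)) z"
          using mvt_ex[where f = "g (Suc j)" and f' = "g (Suc (Suc j))", OF derivs_onD[OF g] u(1)] by blast
        have "\<bar>g (Suc j) x - g (Suc j) u\<bar> \<le> d * M"
          unfolding z(2) abs_mult using x uv bd[OF z(1), of "Suc j"] j(1) by (intro mult_mono) auto
        thus ?thesis using j(2) d(3) by linarith
      qed
      have hi: "\<bar>g (Suc j) x\<bar> \<le> M" if "x \<in> {u..v}" for x using bd[of x j] that sub j(1) by auto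
      have T_le: "(LINT t:{u..v}|lborel. min_one_quot (g 2 t) (\<bar>lam\<bar> * (g 1 t)\<^sup>2)) \<le> T"
        unfolding T_def by (rule set_integral_min_one_quot_mono[OF Tint]) (use uv in auto)
      have T0: "0 \<le> T" unfolding T_def by (rule set_integral_min_one_quot_nonneg)
      have dl: "v - u \<le> 3" using uv by linarith
      show ?thesis
      proof (cases "j = 0")
        case True
        have c2: "c / 2 > 0" using c by simp
        have "osc u v \<le> B / \<bar>lam\<bar> * (5 / (c / 2) + integral {u..v} (\<lambda>x. \<bar>g 2 x\<bar> / (g 1 x)\<^sup>2))"
          using lo True u uv by (intro osc_by_parts c2 dl) auto
        also have "\<dots> \<le> B / \<bar>lam\<bar> * (10 / c + 3 * M / (c / 2)\<^sup>2)"
        proof (intro mult_left_mono add_mono)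
          have nz: "g 1 x \<noteq> 0" if "x \<in> {u..v}" for x using lo[OF that] True c by auto
          have gd: "derivs_on u v g" by (rule derivs_on_subset[OF g]) (use uv in auto)
          have "norm (integral {u..v} (\<lambda>x. \<bar>g 2 x\<bar> / (g 1 x)\<^sup>2)) \<le> M / (c / 2)\<^sup>2 * (v - u)"
          proof (rule integral_bound)
            show "u \<le> v" using u by simp
            show "continuous_on {u..v} (\<lambda>x. \<bar>g 2 x\<bar> / (g 1 x)\<^sup>2)"
              using nz by (intro continuous_intros derivs_on_continuous[OF gd]) auto
            fix x assume x: "x \<in> {u..v}"
            have "(c / 2)\<^sup>2 \<le> \<bar>g 1 x\<bar>\<^sup>2" using lo[OF x] True c by (intro power_mono) auto
            moreover have "\<bar>g 2 x\<bar> \<le> M" using bd[of x 1] x sub N by (auto simp: numeral_2_eq_2)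
            ultimately show "norm (\<bar>g 2 x\<bar> / (g 1 x)\<^sup>2) \<le> M / (c / 2)\<^sup>2"
              using c M by (auto intro!: frac_le)
          qed
          also have "\<dots> \<le> M / (c / 2)\<^sup>2 * 3" using dl M by (intro mult_left_mono) auto
          finally have "\<bar>integral {u..v} (\<lambda>x. \<bar>g 2 x\<bar> / (g 1 x)\<^sup>2)\<bar> \<le> 3 * M / (c / 2)\<^sup>2" by (simp add: mult.commute)
          thus "integral {u..v} (\<lambda>x. \<bar>g 2 x\<bar> / (g 1 x)\<^sup>2) \<le> 3 * M / (c / 2)\<^sup>2" by (rule abs_le_D1)
        qed (use B0 in auto)
        also have "\<dots> \<le> B / \<bar>lam\<bar> * C" using C0 B0 by (intro mult_left_mono) auto
        also have "\<dots> = C * B * (1 / \<bar>lam\<bar>)" by simp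
        also have "\<dots> \<le> C * B * (T + 1 / \<bar>lam\<bar>)" using C0 B0 T0 by (intro mult_left_mono) auto
        finally show ?thesis .
      next
        case False
        hence jj: "j \<in> {1..<N}" using j(1) by auto
        have o': "oscillation (g 0) (g 1) (g 2) \<psi> \<psi>' lam B u v" by (rule oscillation_subset[OF o]) (use uv in auto)
        have gd: "derivs_on u v g" by (rule derivs_on_subset[OF g]) (use uv in auto)
        have lh: "\<forall>x\<in>{u..v}. c / 2 \<le> \<bar>g (Suc j) x\<bar> \<and> \<bar>g (Suc j) x\<bar> \<le> M" using lo hi by blast
        have "P j (Cj j)" using Cj jj by blast
        hence "osc u v \<le> Cj j * B * ((LINT t:{u..v}|lborel. min_one_quot (g 2 t) (\<bar>lam\<bar> * (g 1 t)\<^sup>2)) + 1 / \<bar>lam\<bar>)"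
          unfolding P_def using o' gd less_imp_le[OF u(2)] dl uv(3) lh by blast
        also have "\<dots> \<le> C * B * (T + 1 / \<bar>lam\<bar>)"
          using CjC[OF jj] C0(2) B0 T_le
          by (intro mult_mono mult_right_mono add_right_mono add_nonneg_nonneg set_integral_min_one_quot_nonneg mult_nonneg_nonneg) auto
        finally show ?thesis .
      qed
    qed
    have T0: "0 \<le> T" unfolding T_def by (rule set_integral_min_one_quot_nonneg)
    have "osc 2 (2 + real n * d) \<le> real n * (C * B * (T + 1 / \<bar>lam\<bar>))"
    proof (rule osc_pieces)
      show "osc p q \<le> osc p r + osc r q" if "2 \<le> p" "p \<le> r" "r \<le> q" "q \<le> 4" for p r q
        by (rule osc_subadd) (use that in auto)
      show "osc 2 2 \<le> 0" by (simp add: osc_def)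
      fix k assume "k < n"
      hence "real (Suc k) * d \<le> real n * d" using d(1) by (intro mult_right_mono) auto
      moreover have "0 \<le> real k * d" using d(1) by simp
      ultimately show "osc (2 + real k * d) (2 + real (Suc k) * d) \<le> C * B * (T + 1 / \<bar>lam\<bar>)"
        using d(2) by (intro piece) (linarith | simp add: distrib_right)+
    qed (use d in auto)
    also have "\<dots> = real n * C * (B * (T + 1 / \<bar>lam\<bar>))" by simp
    also have "\<dots> \<le> C' * (B * (T + 1 / \<bar>lam\<bar>))"
      using M B0 T0 by (intro mult_right_mono mult_nonneg_nonneg) (auto simp: C'_def)
    finally show "osc 2 4 \<le> C' * B * ((LINT t:{2..4}|lborel. min_one_quot (g 2 t) (\<bar>lam\<bar> * (g 1 t)\<^sup>2)) + 1 / \<bar>lam\<bar>)"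
      by (simp only: T_def[symmetric] d(2) mult.assoc)
    fix x :: real assume "x \<in> {1..4}"
    hence "\<bar>g 1 x\<bar> \<le> M" using bd[of x 0] by simp
    thus "\<bar>g 1 x\<bar> \<le> C'" using C0 by (simp add: C'_def add_increasing)
  qed
qed

lemma set_integral_const_Icc: "a \<le> b \<Longrightarrow> (LINT t:{a..b::real}|lborel. (c::real)) = c * (b - a)"
  unfolding set_lebesgue_integral_def by simp

text \<open>Homogeneity removes the normalisation: the phase is divided by the size \<open>y\<close>
  of its jet at 1 and \<open>lam\<close> is multiplied by \<open>y\<close>, which preserves the
  oscillatory factor and the first quotient. The second, constant minimum is written as an integral
  so that both terms can later be integrated over rays together.\<close>

lemma osc_bound:
  assumes N: "N \<ge> 1" and A: "A \<ge> 0"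
  shows "\<exists>C\<ge>0. \<forall>g \<psi> \<psi>' lam B. oscillation (g 0) (g 1) (g 2) \<psi> \<psi>' lam B 1 4 \<longrightarrow> derivs_on 1 4 g \<longrightarrow>
    (\<forall>x\<in>{1..4}. (g (Suc N) x)\<^sup>2 \<le> A * (\<Sum>j<N. (g (Suc j) x)\<^sup>2)) \<longrightarrow>
    oscillation.osc (g 0) \<psi> lam 2 4 \<le>
      C * B * ((LINT t:{2..4}|lborel. min_one_quot (g 2 t) (lam * (g 1 t)\<^sup>2)) +
        (LINT t:{2..4::real}|lborel. min_one_quot 1 (\<bar>lam\<bar> * (SUP s\<in>{1..4}. \<bar>g 1 s\<bar>))))"
proof -
  obtain C where C: "C \<ge> 0" and main: "\<forall>g \<psi> \<psi>' lam B. oscillation (g 0) (g 1) (g 2) \<psi> \<psi>' lam B 1 4 \<longrightarrow> derivs_on 1 4 g \<longrightarrow>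
    (\<forall>x\<in>{1..4}. (g (Suc N) x)\<^sup>2 \<le> A * (\<Sum>j<N. (g (Suc j) x)\<^sup>2)) \<longrightarrow> (\<Sum>j<N. (g (Suc j) 1)\<^sup>2) = 1 \<longrightarrow>
    oscillation.osc (g 0) \<psi> lam 2 4 \<le>
      C * B * ((LINT t:{2..4}|lborel. min_one_quot (g 2 t) (\<bar>lam\<bar> * (g 1 t)\<^sup>2)) + 1 / \<bar>lam\<bar>) \<and>
    (\<forall>x\<in>{1..4}. \<bar>g 1 x\<bar> \<le> C)" using osc_normalised[OF N A] by (elim exE conjE)
  show ?thesis
  proof (intro exI[of _ "C * (1 + C) + 1"] conjI allI impI)
    show "0 \<le> C * (1 + C) + 1" using C by simp
    fix g :: "nat \<Rightarrow> real \<Rightarrow> real" and \<psi> \<psi>' :: "real \<Rightarrow> complex" and lam B :: real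
    assume o: "oscillation (g 0) (g 1) (g 2) \<psi> \<psi>' lam B 1 4" and g: "derivs_on 1 4 g"
      and ode: "\<forall>x\<in>{1..4}. (g (Suc N) x)\<^sup>2 \<le> A * (\<Sum>j<N. (g (Suc j) x)\<^sup>2)"
    interpret oscillation "g 0" "g 1" "g 2" \<psi> \<psi>' lam B 1 4 by (rule o)
    define S where "S = (SUP s\<in>{1..4}. \<bar>g 1 s\<bar>)"
    define T where "T = (LINT t:{2..4}|lborel. min_one_quot (g 2 t) (lam * (g 1 t)\<^sup>2))"
    define w where "w = min_one_quot 1 (\<bar>lam\<bar> * S)"
    have T0: "T \<ge> 0" unfolding T_def by (rule set_integral_min_one_quot_nonneg)
    have w0: "w \<ge> 0" unfolding w_def by (rule min_one_quot_bounds)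
    have wint: "(LINT t:{2..4::real}|lborel. min_one_quot 1 (\<bar>lam\<bar> * (SUP s\<in>{1..4}. \<bar>g 1 s\<bar>))) = 2 * w"
      by (simp add: set_integral_const_Icc w_def S_def)
    have triv: "osc 2 4 \<le> 2 * B" using osc_trivial[of 2 4] by simp
    have S0: "0 \<le> S"
    proof -
      have "bdd_above ((\<lambda>s. \<bar>g 1 s\<bar>) ` {1..4})"
        by (intro compact_imp_bounded[THEN bounded_imp_bdd_above] compact_continuous_image continuous_intros
            derivs_on_continuous[OF g] compact_Icc)
      hence "\<bar>g 1 1\<bar> \<le> S" unfolding S_def by (intro cSUP_upper) auto
      thus ?thesis by simp
    qed
    have "osc 2 4 \<le> (C * (1 + C) + 1) * B * (T + 2 * w)"
    \<comment> \<open>In the first case the minimum \<open>w\<close> is 1, by convention also for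
      \<open>S = 0\<close>, so the trivial estimate \<open>2 * B\<close> suffices. It accounts for
      the \<open>+ 1\<close> in the constant.\<close>
    proof (cases "\<bar>lam\<bar> * S \<le> 1")
      case True
      hence "w = 1" using S0 by (auto simp: w_def min_one_quot_def abs_mult)
      hence "2 * B \<le> 1 * B * (T + 2 * w)" using B0 T0 by (simp add: distrib_left)
      also have "\<dots> \<le> (C * (1 + C) + 1) * B * (T + 2 * w)"
        using C B0 T0 w0 by (intro mult_right_mono) auto
      finally show ?thesis using triv by linarith
    next
      case False
      define y where "y = sqrt (\<Sum>j<N. (g (Suc j) 1)\<^sup>2)"
      have y2: "y\<^sup>2 = (\<Sum>j<N. (g (Suc j) 1)\<^sup>2)" unfolding y_def by (intro real_sqrt_pow2 sum_nonneg) auto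
      \<comment> \<open>A jet vanishing at 1 would vanish everywhere by Gronwall, making
        \<open>S = 0\<close> and contradicting the case assumption.\<close>
      have y: "y > 0"
      proof (rule ccontr)
        assume "\<not> y > 0"
        hence "y = 0" unfolding y_def by (smt (verit) real_sqrt_ge_zero sum_nonneg zero_le_power2)
        hence Y1: "(\<Sum>j<N. (g (Suc j) 1)\<^sup>2) = 0" using y2 by simp
        have "\<bar>g 1 x\<bar> \<le> 0" if "x \<in> {1..4}" for x
        proof -
          have "(g (Suc 0) x)\<^sup>2 \<le> (\<Sum>j<N. (g (Suc j) x)\<^sup>2)" using N by (intro member_le_sum) auto
          also have "\<dots> \<le> 0" using gronwall_jets(2)[OF g A ode that] Y1 by simp
          finally show ?thesis by simp
        qed
        hence "S \<le> 0" unfolding S_def by (intro cSUP_least) auto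
        thus False using False S0 by simp
      qed
      define gt where "gt k x = g k x / y" for k x
      have gtd: "derivs_on 1 4 gt" unfolding derivs_on_def gt_def
        by (intro allI ballI DERIV_cdivide derivs_onD[OF g])
      have ot: "oscillation (gt 0) (gt 1) (gt 2) \<psi> \<psi>' (lam * y) B 1 4"
      proof
        show "(gt 0 has_real_derivative gt 1 x) (at x within {1..4})" if "x \<in> {1..4}" for x
          using derivs_onD[OF gtd that, of 0] by simp
        show "(gt 1 has_real_derivative gt 2 x) (at x within {1..4})" if "x \<in> {1..4}" for x
          using derivs_onD[OF gtd that, of 1] by (simp add: numeral_2_eq_2)
        show "continuous_on {1..4} (gt 2)" by (rule derivs_on_continuous[OF gtd])
      qed (use \<psi> \<psi>' B B0 lam y in auto)
      have odet: "\<forall>x\<in>{1..4}. (gt (Suc N) x)\<^sup>2 \<le> A * (\<Sum>j<N. (gt (Suc j) x)\<^sup>2)"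
      proof
        fix x :: real assume "x \<in> {1..4}"
        hence "(g (Suc N) x)\<^sup>2 / y\<^sup>2 \<le> A * (\<Sum>j<N. (g (Suc j) x)\<^sup>2) / y\<^sup>2"
          using ode by (intro divide_right_mono) auto
        thus "(gt (Suc N) x)\<^sup>2 \<le> A * (\<Sum>j<N. (gt (Suc j) x)\<^sup>2)"
          by (simp add: gt_def power_divide sum_divide_distrib[symmetric])
      qed
      have onet: "(\<Sum>j<N. (gt (Suc j) 1)\<^sup>2) = 1"
        unfolding gt_def power_divide sum_divide_distrib[symmetric] y2[symmetric] using y by simp
      have res: "oscillation.osc (gt 0) \<psi> (lam * y) 2 4 \<le>
        C * B * ((LINT t:{2..4}|lborel. min_one_quot (gt 2 t) (\<bar>lam * y\<bar> * (gt 1 t)\<^sup>2)) + 1 / \<bar>lam * y\<bar>) \<and>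
        (\<forall>x\<in>{1..4}. \<bar>gt 1 x\<bar> \<le> C)"
        by (rule main[rule_format, OF ot gtd _ onet]) (use odet in blast)
      have "oscillation.osc (gt 0) \<psi> (lam * y) 2 4 = osc 2 4"
        unfolding oscillation.osc_def[OF ot] oscillation.E_def[OF ot] osc_def E_def
        using y by (simp add: gt_def)
      moreover have "min_one_quot (gt 2 t) (\<bar>lam * y\<bar> * (gt 1 t)\<^sup>2) = min_one_quot (g 2 t) (lam * (g 1 t)\<^sup>2)" for t
        using y by (auto simp: min_one_quot_def gt_def abs_mult power2_eq_square)
      ultimately have o1: "osc 2 4 \<le> C * B * (T + 1 / \<bar>lam * y\<bar>)" using res by (simp add: T_def)
      have "\<bar>g 1 x\<bar> \<le> C * y" if "x \<in> {1..4}" for x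
      proof -
        have "\<bar>gt 1 x\<bar> \<le> C" using res that by blast
        thus ?thesis using y by (simp add: gt_def abs_divide divide_le_eq)
      qed
      \<comment> \<open>This direction is the useful one: it turns the term
        \<open>1 / \<bar>lam * y\<bar>\<close>, which involves the whole jet, into one involving
        only the supremum of the first derivative.\<close>
      hence SC: "S \<le> C * y" unfolding S_def by (intro cSUP_least) auto
      have S: "S > 0" using False S0 by (cases "S = 0") auto
      have "1 / \<bar>lam * y\<bar> \<le> C * (1 / (\<bar>lam\<bar> * S))"
        using SC S y lam by (simp add: abs_mult field_simps)
      also have "1 / (\<bar>lam\<bar> * S) = w" using False S lam by (auto simp: w_def min_one_quot_def abs_mult min_def field_simps)
      finally have "C * B * (T + 1 / \<bar>lam * y\<bar>) \<le> C * B * (T + C * w)" using C B0 by (intro mult_left_mono add_left_mono) auto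
      also have "\<dots> \<le> C * B * ((1 + C) * (T + 2 * w))"
      proof (intro mult_left_mono)
        have "0 \<le> C * T" "0 \<le> C * w" using C T0 w0 by auto
        moreover have "(1 + C) * (T + 2 * w) = T + 2 * w + C * T + 2 * (C * w)" by (simp add: algebra_simps)
        ultimately show "T + C * w \<le> (1 + C) * (T + 2 * w)" using w0 by linarith
      qed (use C B0 in auto)
      also have "\<dots> = C * (1 + C) * B * (T + 2 * w)" by (simp add: mult_ac)
      also have "\<dots> \<le> (C * (1 + C) + 1) * B * (T + 2 * w)"
        using B0 T0 w0 by (intro mult_right_mono) auto
      finally show ?thesis using o1 by linarith
    qed
    thus "osc 2 4 \<le> (C * (1 + C) + 1) * B * ((LINT t:{2..4}|lborel. min_one_quot (g 2 t) (lam * (g 1 t)\<^sup>2)) +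
        (LINT t:{2..4::real}|lborel. min_one_quot 1 (\<bar>lam\<bar> * (SUP s\<in>{1..4}. \<bar>g 1 s\<bar>))))"
      unfolding wint T_def .
  qed
qed

section \<open>Averaging over dilations\<close>

lemma lborel_integral_scale:
  fixes F :: "'a::euclidean_space \<Rightarrow> 'b::{banach, second_countable_topology}"
  assumes "c > 0" and F: "F \<in> borel_measurable borel"
  shows "(LINT x|lborel. F (c *\<^sub>R x)) = (1 / c ^ DIM('a)) *\<^sub>R (LINT x|lborel. F x)"
proof -
  have "(LINT x|lborel. F x) = (LINT x|density (distr lborel borel (\<lambda>x. 0 + c *\<^sub>R x)) (\<lambda>_. \<bar>c\<bar> ^ DIM('a)). F x)"
    using lborel_affine[of c "0::'a"] assms(1) by simp
  also have "\<dots> = (LINT x|distr lborel borel (\<lambda>x. 0 + c *\<^sub>R x). (c ^ DIM('a)) *\<^sub>R F x)"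
    using F assms(1) by (subst integral_density[where g = "\<lambda>_. c ^ DIM('a)", symmetric]) (auto simp: ennreal_power)
  also have "\<dots> = (LINT x|lborel. (c ^ DIM('a)) *\<^sub>R F (c *\<^sub>R x))"
    using F by (subst integral_distr) auto
  also have "\<dots> = (c ^ DIM('a)) *\<^sub>R (LINT x|lborel. F (c *\<^sub>R x))" by simp
  finally show ?thesis using assms(1) by simp
qed

text \<open>Half-open, so that the dyadic shells partition a punctured ball.\<close>

definition shell :: "real \<Rightarrow> 'a::real_normed_vector set"
  where "shell a = {x. a \<le> norm x \<and> norm x < 2 * a}"

lemma shell_borel [measurable]: "shell a \<in> sets borel"
  unfolding shell_def by measurable

lemma integral_inverse_Ioc:
  fixes p q :: real
  assumes "0 < p" "p \<le> q"
  shows "(LINT t|lborel. indicator {p<..q} t * (1 / t)) = ln q - ln p"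
proof -
  have "(LINT t|lborel. indicator {p..q} t *\<^sub>R (1 / t)) = ln q - ln p"
  proof -
    have "(LINT t|lborel. (1 / t) * indicator {p..q} t) = ln q - ln p"
      by (rule integral_FTC_Icc_real[where F = ln and f = "\<lambda>t. 1 / t" and a = p and b = q]) (use assms in \<open>auto intro!: derivative_eq_intros continuous_intros\<close>)
    thus ?thesis by (simp add: mult.commute)
  qed
  moreover have "(LINT t|lborel. indicator {p<..q} t * (1 / t)) = (LINT t|lborel. indicator {p..q} t *\<^sub>R (1 / t))"
  proof (rule integral_cong_AE)
    have "AE t in lborel. t \<noteq> p" by (rule AE_lborel_singleton)
    thus "AE t in lborel. indicator {p<..q} t * (1 / t) = indicator {p..q} t *\<^sub>R (1 / t)"
      by eventually_elim (auto simp: indicator_def)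
  qed auto
  ultimately show ?thesis by simp
qed

lemma integrable_bounded_support:
  fixes H :: "'a::euclidean_space \<times> real \<Rightarrow> 'b::{banach, second_countable_topology}"
  assumes "H \<in> borel_measurable borel" "\<And>x t. norm (H (x, t)) \<le> K" "\<And>x t. H (x, t) \<noteq> 0 \<Longrightarrow> norm x \<le> r \<and> \<bar>t\<bar> \<le> r"
  shows "integrable (lborel \<Otimes>\<^sub>M lborel) H"
proof -
  have m: "H \<in> borel_measurable (lborel \<Otimes>\<^sub>M lborel)" using assms(1) unfolding lborel_prod by simp
  have int: "integrable (lborel \<Otimes>\<^sub>M lborel) (\<lambda>p. indicator (cball (0::'a) r \<times> cball (0::real) r) p * K)"
  proof -
    have "bounded (cball (0::'a) r \<times> cball (0::real) r)" by (intro bounded_Times bounded_cball)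
    hence "emeasure lborel (cball (0::'a) r \<times> cball (0::real) r) < \<infinity>" by (rule emeasure_bounded_finite)
    thus ?thesis unfolding lborel_prod by (intro integrable_mult_left integrable_real_indicator) (auto intro!: borel_closed closed_Times)
  qed
  show ?thesis
  proof (rule Bochner_Integration.integrable_bound[OF int m], rule AE_I2)
    fix p :: "'a \<times> real"
    obtain x t where p: "p = (x, t)" by (cases p)
    show "norm (H p) \<le> norm (indicator (cball (0::'a) r \<times> cball (0::real) r) p * K)"
    proof (cases "H p = 0")
      case False
      hence "p \<in> cball (0::'a) r \<times> cball (0::real) r" using assms(3)[of x t] p by (auto simp: dist_norm)
      thus ?thesis using assms(2)[of x t] p by (auto intro: order_trans[OF _ abs_ge_self])
    qed simp
  qed
qed

text \<open>A substitute for polar coordinates: the unit shell plays the role of the sphere.\<close>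

lemma dilation_average:
  fixes \<Phi> :: "'a::euclidean_space \<Rightarrow> 'b::{banach, second_countable_topology}"
  assumes \<Phi>: "\<Phi> \<in> borel_measurable borel" "\<And>x. norm (\<Phi> x) \<le> K" and a: "a > 0"
    and support: "{x. \<Phi> x \<noteq> 0} \<subseteq> shell a"
  shows "ln 2 *\<^sub>R (LINT x|lborel. \<Phi> x) =
    (LINT x|lborel. indicator (shell 1) x *\<^sub>R (LINT t|lborel. (indicator {0<..} t * t ^ (DIM('a) - 1)) *\<^sub>R \<Phi> (t *\<^sub>R x)))"
    "integrable lborel (\<lambda>x::'a. indicator (shell 1) x *\<^sub>R (LINT t|lborel. (indicator {0<..} t * t ^ (DIM('a) - 1)) *\<^sub>R \<Phi> (t *\<^sub>R x)))"
    "integrable lborel \<Phi>"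
proof -
  let ?n = "DIM('a)"
  have supp: "x \<in> shell a" if "\<Phi> x \<noteq> 0" for x using support that by blast
  have n: "?n \<ge> 1" using DIM_positive[where 'a='a] by simp
  have K: "K \<ge> 0" using \<Phi>(2)[of 0] norm_ge_zero[of "\<Phi> 0"] by linarith
  note [measurable] = \<Phi>(1)
  define H where "H x t = indicator (shell 1) x *\<^sub>R ((indicator {0<..} t * t ^ (?n - 1)) *\<^sub>R \<Phi> (t *\<^sub>R x))" for x t
  have Hs: "1 \<le> norm x \<and> norm x < 2 \<and> a / 2 < t \<and> t < 2 * a" if "H x t \<noteq> 0" for x t
  proof -
    have x: "1 \<le> norm x" "norm x < 2" and t: "t > 0" and y: "t *\<^sub>R x \<in> shell a"
      using that supp[of "t *\<^sub>R x"] by (auto simp: H_def shell_def indicator_def split: if_splits)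
    have y': "a \<le> t * norm x" "t * norm x < 2 * a" using y t by (auto simp: shell_def)
    have "t * norm x < t * 2" using x t by simp
    moreover have "t \<le> t * norm x" using mult_left_mono[OF x(1), of t] t by simp
    ultimately show ?thesis using x y' by linarith
  qed
  have H1: "integrable (lborel \<Otimes>\<^sub>M lborel) (\<lambda>p. H (fst p) (snd p))"
  proof (rule integrable_bounded_support[where r = "max 2 (2 * a)" and K = "(2 * a) ^ (?n - 1) * K"])
    show "(\<lambda>p. H (fst p) (snd p)) \<in> borel_measurable borel" unfolding H_def borel_prod[symmetric] by measurable
    show "norm (H (fst (x, t)) (snd (x, t))) \<le> (2 * a) ^ (?n - 1) * K" for x t
    proof (cases "H x t = 0")
      case True
      thus ?thesis using K a by simp
    next
      case False
      hence "0 \<le> t" "t \<le> 2 * a" using Hs[OF False] a by auto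
      hence "\<bar>t\<bar> ^ (?n - 1) \<le> (2 * a) ^ (?n - 1)" by (intro power_mono) auto
      hence "\<bar>t\<bar> ^ (?n - 1) * norm (\<Phi> (t *\<^sub>R x)) \<le> (2 * a) ^ (?n - 1) * K" using \<Phi>(2) a by (intro mult_mono) auto
      thus ?thesis using K a by (auto simp: H_def indicator_def power_abs)
    qed
    show "H (fst (x, t)) (snd (x, t)) \<noteq> 0 \<Longrightarrow> norm x \<le> max 2 (2 * a) \<and> \<bar>t\<bar> \<le> max 2 (2 * a)" for x t
      using Hs[of x t] a by auto
  qed
  \<comment> \<open>This is \<open>H\<close> after substituting \<open>y = t *\<^sub>R x\<close> at
    fixed \<open>t\<close>: the Jacobian leaves \<open>1 / t\<close>, and membership of
    \<open>x\<close> in the unit shell becomes a range of \<open>t\<close> from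
    \<open>norm y / 2\<close> to \<open>norm y\<close>. Over it \<open>1 / t\<close> integrates to
    \<open>ln 2\<close> for every \<open>y\<close>.\<close>
  define H' where "H' y t = (indicator {norm y / 2<..norm y} t * (1 / t)) *\<^sub>R \<Phi> y" for y t
  have H's: "a / 2 < t \<and> t \<le> 2 * a \<and> norm y < 2 * a \<and> a \<le> norm y" if "H' y t \<noteq> 0" for y t
    using that supp[of y] by (auto simp: H'_def shell_def indicator_def split: if_splits)
  have H2: "integrable (lborel \<Otimes>\<^sub>M lborel) (\<lambda>p. H' (fst p) (snd p))"
  proof (rule integrable_bounded_support[where r = "2 * a" and K = "2 / a * K"])
    show "(\<lambda>p. H' (fst p) (snd p)) \<in> borel_measurable borel" unfolding H'_def borel_prod[symmetric] indicator_def greaterThanAtMost_iff by measurable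
    show "norm (H' (fst (y, t)) (snd (y, t))) \<le> 2 / a * K" for y t
    proof (cases "H' y t = 0")
      case True
      thus ?thesis using K a by simp
    next
      case False
      hence t: "a / 2 < t" using H's by blast
      hence "\<bar>1 / t\<bar> \<le> 2 / a" using a by (simp add: field_simps)
      hence "\<bar>1 / t\<bar> * norm (\<Phi> y) \<le> 2 / a * K" using \<Phi>(2) a by (intro mult_mono) auto
      thus ?thesis using K a by (auto simp: H'_def indicator_def)
    qed
    show "H' (fst (y, t)) (snd (y, t)) \<noteq> 0 \<Longrightarrow> norm y \<le> 2 * a \<and> \<bar>t\<bar> \<le> 2 * a" for y t
      using H's[of y t] a by auto
  qed
  have swap: "(LINT x|lborel. H x t) = (LINT y|lborel. H' y t)" for t
  proof (cases "t > 0")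
    case False
    have "H' y t = 0" for y using H's[of y t] False a by auto
    moreover have "H x t = 0" for x using False by (simp add: H_def)
    ultimately show ?thesis by simp
  next
    case True
    define F where "F y = indicator (shell 1) ((1 / t) *\<^sub>R y) *\<^sub>R \<Phi> y" for y
    have [measurable]: "F \<in> borel_measurable borel" unfolding F_def by measurable
    have ind: "indicator (shell 1) ((1 / t) *\<^sub>R y) = (indicator {norm y / 2<..norm y} t :: real)" for y
      using True by (auto simp: shell_def indicator_def field_simps)
    have "(LINT x|lborel. H x t) = (LINT x|lborel. t ^ (?n - 1) *\<^sub>R F (t *\<^sub>R x))"
      using True by (simp add: H_def F_def mult.commute)
    also have "\<dots> = t ^ (?n - 1) *\<^sub>R ((1 / t ^ ?n) *\<^sub>R (LINT y|lborel. F y))"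
      using lborel_integral_scale[OF True, of F] by simp
    also have "\<dots> = (1 / t) *\<^sub>R (LINT y|lborel. F y)"
      using True n by (cases ?n) auto
    also have "\<dots> = (LINT y|lborel. H' y t)"
      unfolding F_def H'_def ind by (simp add: mult.commute flip: integral_scaleR_right)
    finally show ?thesis .
  qed
  have inner: "(LINT t|lborel. H' y t) = ln 2 *\<^sub>R \<Phi> y" for y
  proof (cases "\<Phi> y = 0")
    case True
    thus ?thesis by (simp add: H'_def)
  next
    case False
    hence y: "norm y > 0" using supp[OF False] a by (auto simp: shell_def)
    have I: "(LINT t|lborel. indicator {norm y / 2<..norm y} t * (1 / t)) = ln 2"
      using y by (subst integral_inverse_Ioc) (auto simp: ln_div)
    \<comment> \<open>A function that is not integrable has integral 0 by convention, whereas the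
      value here is \<open>ln 2\<close>.\<close>
    have "integrable lborel (\<lambda>t. indicator {norm y / 2<..norm y} t * (1 / t))"
    proof (rule ccontr)
      assume "\<not> ?thesis"
      from not_integrable_integral_eq[OF this] I show False by simp
    qed
    hence "(LINT t|lborel. H' y t) = (LINT t|lborel. indicator {norm y / 2<..norm y} t * (1 / t)) *\<^sub>R \<Phi> y"
      unfolding H'_def by (intro integral_scaleR_left)
    thus ?thesis unfolding I .
  qed
  have H1': "integrable (lborel \<Otimes>\<^sub>M lborel) (case_prod H)" using H1 by (simp add: case_prod_beta')
  have H2': "integrable (lborel \<Otimes>\<^sub>M lborel) (case_prod H')" using H2 by (simp add: case_prod_beta')
  have row: "(LINT t|lborel. H x t) = indicator (shell 1) x *\<^sub>R (LINT t|lborel. (indicator {0<..} t * t ^ (?n - 1)) *\<^sub>R \<Phi> (t *\<^sub>R x))" for x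
    unfolding H_def by (cases "x \<in> shell 1") simp_all
  have "(LINT x|lborel. LINT t|lborel. H x t) = (LINT t|lborel. LINT x|lborel. H x t)"
    by (rule lborel_pair.Fubini_integral[OF H1', symmetric])
  also have "\<dots> = (LINT t|lborel. LINT y|lborel. H' y t)" by (simp add: swap)
  also have "\<dots> = (LINT y|lborel. LINT t|lborel. H' y t)"
    by (rule lborel_pair.Fubini_integral[OF H2'])
  also have "\<dots> = ln 2 *\<^sub>R (LINT y|lborel. \<Phi> y)" by (simp add: inner)
  finally show "ln 2 *\<^sub>R (LINT x|lborel. \<Phi> x) =
    (LINT x|lborel. indicator (shell 1) x *\<^sub>R (LINT t|lborel. (indicator {0<..} t * t ^ (?n - 1)) *\<^sub>R \<Phi> (t *\<^sub>R x)))"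
    by (simp add: row)
  show "integrable lborel (\<lambda>x::'a. indicator (shell 1) x *\<^sub>R (LINT t|lborel. (indicator {0<..} t * t ^ (?n - 1)) *\<^sub>R \<Phi> (t *\<^sub>R x)))"
    unfolding row[symmetric] by (rule lborel_pair.integrable_fst[OF H1'])
  have "integrable lborel (\<lambda>y. LINT t|lborel. H' y t)" by (rule lborel_pair.integrable_fst[OF H2'])
  hence "integrable lborel (\<lambda>y. ln 2 *\<^sub>R \<Phi> y)" unfolding inner .
  hence "integrable lborel (\<lambda>y. (1 / ln 2) *\<^sub>R (ln 2 *\<^sub>R \<Phi> y))" by (rule integrable_scaleR_right)
  thus "integrable lborel \<Phi>" by simp
qed

section \<open>Dyadic shells\<close>

lemma frechet_derivative_grad:
  fixes f :: "real^'n \<Rightarrow> 'b::real_normed_vector"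
  assumes "f differentiable (at x)"
  shows "frechet_derivative f (at x) h = (\<Sum>i\<in>UNIV. h $ i *\<^sub>R grad f x $ i)"
proof -
  have lin: "linear (frechet_derivative f (at x))" by (rule linear_frechet_derivative[OF assms])
  have "h = (\<Sum>i\<in>UNIV. h $ i *\<^sub>R axis i 1)" using basis_expansion[of h] by (simp add: scalar_mult_eq_scaleR)
  hence "frechet_derivative f (at x) h = frechet_derivative f (at x) (\<Sum>i\<in>UNIV. h $ i *\<^sub>R axis i 1)" by (rule arg_cong)
  also have "\<dots> = (\<Sum>i\<in>UNIV. h $ i *\<^sub>R frechet_derivative f (at x) (axis i 1))"
    by (simp only: linear_sum[OF lin] linear_scale[OF lin])
  finally show ?thesis by (simp add: grad_def)
qed

lemma ray_vector_derivative:
  fixes f :: "real^'n \<Rightarrow> 'b::real_normed_vector"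
  assumes "f differentiable (at (s *\<^sub>R z))"
  shows "((\<lambda>s. f (s *\<^sub>R z)) has_vector_derivative (\<Sum>i\<in>UNIV. z $ i *\<^sub>R grad f (s *\<^sub>R z) $ i)) (at s within S)"
proof -
  have f: "(f has_derivative frechet_derivative f (at (s *\<^sub>R z))) (at (s *\<^sub>R z))"
    using assms frechet_derivative_works by blast
  have "((\<lambda>s. f (s *\<^sub>R z)) has_derivative (\<lambda>h. frechet_derivative f (at (s *\<^sub>R z)) (h *\<^sub>R z))) (at s within S)"
  proof (rule has_derivative_compose[where f = "\<lambda>s. s *\<^sub>R z" and g = f])
    show "((\<lambda>s. s *\<^sub>R z) has_derivative (\<lambda>h. h *\<^sub>R z)) (at s within S)"
      by (auto intro!: derivative_eq_intros)
    show "(f has_derivative frechet_derivative f (at (s *\<^sub>R z))) (at (s *\<^sub>R z))" by (rule f)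
  qed
  moreover have "frechet_derivative f (at (s *\<^sub>R z)) (h *\<^sub>R z) = h *\<^sub>R (\<Sum>i\<in>UNIV. z $ i *\<^sub>R grad f (s *\<^sub>R z) $ i)" for h
    unfolding frechet_derivative_grad[OF assms, symmetric]
    by (rule linear_scale[OF linear_frechet_derivative[OF assms]])
  ultimately show ?thesis unfolding has_vector_derivative_def by simp
qed

text \<open>The quotient rule reproduces the recursion of \<open>rad\<close>. Hence
  \<open>rad f k (s *\<^sub>R z) / s ^ k\<close> are the successive derivatives of \<open>f\<close>
  along the ray through \<open>z\<close>, of whatever length \<open>z\<close> is.\<close>

lemma ray_derivative:
  fixes f :: "real^'n \<Rightarrow> real"
  assumes "rad f k differentiable (at (s *\<^sub>R z))" "s > 0"
  shows "((\<lambda>s. rad f k (s *\<^sub>R z) / s ^ k) has_real_derivative rad f (Suc k) (s *\<^sub>R z) / s ^ Suc k) (at s within S)"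
proof -
  define D where "D = (\<Sum>i\<in>UNIV. z $ i *\<^sub>R grad (rad f k) (s *\<^sub>R z) $ i)"
  have d: "((\<lambda>s. rad f k (s *\<^sub>R z)) has_real_derivative D) (at s within S)"
    using ray_vector_derivative[OF assms(1)] unfolding D_def has_real_derivative_iff_has_vector_derivative .
  have suc: "rad f (Suc k) (s *\<^sub>R z) = s * D - real k * rad f k (s *\<^sub>R z)"
    by (simp add: D_def inner_vec_def sum_distrib_left mult_ac)
  have "((\<lambda>s. rad f k (s *\<^sub>R z) / s ^ k) has_real_derivative
      (D * s ^ k - rad f k (s *\<^sub>R z) * (real k * s ^ (k - 1))) / (s ^ k * s ^ k)) (at s within S)"
    using assms(2) by (auto intro!: derivative_eq_intros d)
  also have "(D * s ^ k - rad f k (s *\<^sub>R z) * (real k * s ^ (k - 1))) / (s ^ k * s ^ k) = rad f (Suc k) (s *\<^sub>R z) / s ^ Suc k"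
    using assms(2) unfolding suc by (cases k) (simp_all add: field_simps)
  finally show ?thesis .
qed

lemma radial_deriv_rad: "radial_deriv f x = rad f 1 x / norm x"
  by (simp add: radial_deriv_def sgn_div_norm divide_inverse_commute)

lemma radial_deriv2_rad:
  fixes f :: "real^'n \<Rightarrow> real"
  assumes U: "open U" "x \<in> U" "x \<noteq> 0" and d: "\<And>k y. y \<in> U \<Longrightarrow> rad f k differentiable (at y)"
  shows "radial_deriv2 f x = rad f 2 x / (norm x)\<^sup>2"
proof -
  have x: "norm x *\<^sub>R sgn x = x" using U(3) by (simp add: sgn_div_norm)
  have n: "norm x > 0" using U by simp
  \<comment> \<open>A second \<open>deriv\<close> sees the first one on a whole neighbourhood of
    \<open>norm x\<close>, so the ray is followed as long as it stays in \<open>U\<close> and off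
    the origin.\<close>
  define V where "V = (\<lambda>r. r *\<^sub>R sgn x) -` U \<inter> {0<..}"
  have V: "open V" "norm x \<in> V"
    unfolding V_def using U n by (auto intro!: open_Int open_vimage continuous_intros simp: x)
  have d0: "deriv (\<lambda>r. f (r *\<^sub>R sgn x)) r = rad f 1 (r *\<^sub>R sgn x) / r ^ 1" if "r \<in> V" for r
  proof (rule DERIV_imp_deriv)
    show "((\<lambda>r. f (r *\<^sub>R sgn x)) has_field_derivative rad f 1 (r *\<^sub>R sgn x) / r ^ 1) (at r)"
      using ray_derivative[of f 0 r "sgn x" UNIV] d[of "r *\<^sub>R sgn x" 0] that by (auto simp: V_def)
  qed
  have "deriv (deriv (\<lambda>r. f (r *\<^sub>R sgn x))) (norm x) = deriv (\<lambda>r. rad f 1 (r *\<^sub>R sgn x) / r ^ 1) (norm x)"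
    using V d0 by (intro deriv_cong_ev refl) (auto simp: eventually_nhds)
  also have "\<dots> = rad f (Suc 1) (norm x *\<^sub>R sgn x) / norm x ^ Suc 1"
  proof (rule DERIV_imp_deriv, rule ray_derivative)
    show "rad f 1 differentiable at (norm x *\<^sub>R sgn x)" unfolding x by (rule d[OF U(2)])
  qed (rule n)
  finally show ?thesis unfolding radial_deriv2_def x by (simp add: numeral_2_eq_2)
qed

text \<open>The second radial derivative and the square of the first carry the same power of
  \<open>norm x\<close>, which cancels.\<close>

lemma min_one_quot_rad:
  fixes f :: "real^'n \<Rightarrow> real"
  assumes U: "open U" "x \<in> U" "x \<noteq> 0" and d: "\<And>k y. y \<in> U \<Longrightarrow> rad f k differentiable (at y)"
  shows "min_one_quot (radial_deriv2 f x) (lam * (radial_deriv f x)\<^sup>2) = min_one_quot (rad f 2 x) (lam * (rad f 1 x)\<^sup>2)"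
proof -
  have r: "radial_deriv2 f x = rad f 2 x / (norm x)\<^sup>2" by (rule radial_deriv2_rad[OF U]) (rule d)
  have "norm x > 0" using U by simp
  moreover have "min_one_quot (p / t\<^sup>2) (lam * (q / t)\<^sup>2) = min_one_quot p (lam * q\<^sup>2)" if "t > 0" for p q t :: real
    using that by (auto simp: min_one_quot_def power_divide)
  ultimately show ?thesis unfolding r radial_deriv_rad by blast
qed

lemma min_one_quot_le_scaled:
  assumes "0 \<le> q" "0 \<le> q'" "q' \<le> 4 * q"
  shows "min_one_quot 1 q \<le> 4 * min_one_quot 1 q'"
proof (cases "q' = 0")
  case True
  thus ?thesis using min_one_quot_bounds(2)[of 1 q] by (simp add: min_one_quot_def)
next
  case False
  hence "q > 0" "q' > 0" using assms by auto
  moreover hence "1 / q \<le> 4 * (1 / q')" using assms(3) by (simp add: field_simps)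
  moreover hence "min 1 (1 / q) \<le> 4 * min 1 (1 / q')" by linarith
  ultimately show ?thesis by (simp add: min_one_quot_def)
qed

lemma radial_segment_eq:
  assumes "z = (2 powi (- m - 1)) *\<^sub>R sgn x"
  shows "radial_segment m x = (\<lambda>s. s *\<^sub>R z) ` {1..4}"
proof -
  have four: "(2::real) powi (- m + 1) = 4 * 2 powi (- m - 1)"
    using power_int_add[of "2::real" "- m - 1" 2] by simp
  have "radial_segment m x = closed_segment z (4 *\<^sub>R z)"
    unfolding radial_segment_def assms four by simp
  also have "\<dots> = (\<lambda>s. s *\<^sub>R z) ` {1..4}"
  proof (intro equalityI subsetI)
    fix y assume "y \<in> closed_segment z (4 *\<^sub>R z)"
    then obtain u where u: "0 \<le> u" "u \<le> 1" "y = (1 - u) *\<^sub>R z + u *\<^sub>R (4 *\<^sub>R z)" by (auto simp: closed_segment_def)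
    have "y = (1 + 3 * u) *\<^sub>R z" unfolding u(3) by (simp add: algebra_simps flip: scaleR_left.add)
    thus "y \<in> (\<lambda>s. s *\<^sub>R z) ` {1..4}" using u(1,2) by (intro image_eqI[of _ _ "1 + 3 * u"]) auto
  next
    fix y assume "y \<in> (\<lambda>s. s *\<^sub>R z) ` {1..4}"
    then obtain s where s: "1 \<le> s" "s \<le> 4" "y = s *\<^sub>R z" by auto
    have "(1 - (s - 1) / 3) *\<^sub>R z + ((s - 1) / 3) *\<^sub>R (4 *\<^sub>R z) = ((1 - (s - 1) / 3) + ((s - 1) / 3) * 4) *\<^sub>R z"
      by (simp only: scaleR_left.add scaleR_scaleR)
    also have "(1 - (s - 1) / 3) + ((s - 1) / 3) * 4 = s" by (simp add: field_simps)
    finally show "y \<in> closed_segment z (4 *\<^sub>R z)" unfolding closed_segment_def mem_Collect_eq s(3)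
      using s by (intro exI[of _ "(s - 1) / 3"]) auto
  qed
  finally show ?thesis .
qed

text \<open>A value above the essential supremum would persist on a ball, which has positive
  measure. Boundedness is assumed because \<open>real_of_ereal\<close> sends an infinite essential
  supremum to 0.\<close>

lemma continuous_le_Linfty_norm:
  fixes g :: "real^'n \<Rightarrow> 'b::{real_normed_vector, second_countable_topology}"
  assumes g: "continuous_on UNIV g" and bd: "\<And>x. norm (g x) \<le> K"
  shows "norm (g x) \<le> Linfty_norm g"
proof -
  let ?e = "esssup lborel (\<lambda>x. ereal (norm (g x)))"
  have m: "(\<lambda>x. ereal (norm (g x))) \<in> borel_measurable lborel"
    using borel_measurable_continuous_onI[OF g] by simp
  have up: "?e \<le> ereal K" by (rule esssup_I[OF m]) (simp add: bd)
  have pt: "ereal (norm (g x)) \<le> ?e"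
  proof (rule ccontr)
    assume "\<not> ?thesis"
    then obtain c where c: "?e < ereal c" "ereal c < ereal (norm (g x))"
      by (metis ereal_dense2 not_le)
    define S where "S = {y. c < norm (g y)}"
    have "open S" unfolding S_def by (intro open_Collect_less continuous_intros g)
    moreover have "x \<in> S" using c by (simp add: S_def)
    ultimately obtain e where e: "e > 0" "ball x e \<subseteq> S" by (meson openE)
    have "AE y in lborel. ereal (norm (g y)) \<le> ?e" by (rule esssup_AE)
    hence "AE y in lborel. y \<notin> ball x e"
    proof eventually_elim
      case (elim y)
      have "ereal (norm (g y)) < ereal c" using elim c(1) by (rule le_less_trans)
      thus ?case using e(2) by (auto simp: S_def)
    qed
    hence "emeasure lborel (ball x e) = 0" by (subst (asm) AE_iff_measurable[of "ball x e"]) auto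
    moreover have "measure lborel (ball x e) > 0" using e(1) by (rule content_ball_pos)
    ultimately show False by (simp add: measure_def)
  qed
  have "0 \<le> ?e" using pt by (meson dual_order.trans ereal_less_eq(5) norm_ge_zero)
  hence "\<bar>?e\<bar> \<noteq> \<infinity>" using up by auto
  thus ?thesis using pt unfolding Linfty_norm_def by (cases ?e) auto
qed

section \<open>The two integrands and their measurability\<close>

locale radial_phase =
  fixes f :: "real^'n \<Rightarrow> real" and U :: "(real^'n) set" and b A :: real and N :: nat
  assumes U: "open U" "cball 0 b \<subseteq> U" and b: "0 < b" "b \<le> 1"
    and d: "\<And>k y. y \<in> U \<Longrightarrow> rad f k differentiable (at y)"
    and N: "N \<ge> 1" and A: "A \<ge> 0"
    and ode: "\<And>x. x \<in> cball 0 b \<Longrightarrow> (rad f (Suc N) x)\<^sup>2 \<le> A * (\<Sum>j<N. (rad f (Suc j) x)\<^sup>2)"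
begin

definition segsup :: "int \<Rightarrow> real^'n \<Rightarrow> real"
  where "segsup m x = (SUP y\<in>radial_segment m x. \<bar>radial_deriv f y\<bar>)"

text \<open>Written with \<open>rad\<close>, which is continuous on all of \<open>U\<close>
  including the origin; by \<open>min_one_quot_rad\<close> it agrees there with the integrand in
  radial derivatives except at the origin.\<close>

definition quot1 :: "real \<Rightarrow> real^'n \<Rightarrow> real"
  where "quot1 lam x = min_one_quot (rad f 2 x) (lam * (rad f 1 x)\<^sup>2)"

definition quot2 :: "real \<Rightarrow> int \<Rightarrow> real^'n \<Rightarrow> real"
  where "quot2 lam m x = min_one_quot 1 (\<bar>lam\<bar> * norm x * segsup m x)"

lemma quot_bounds: "0 \<le> quot1 lam x" "quot1 lam x \<le> 1" "0 \<le> quot2 lam m x" "quot2 lam m x \<le> 1"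
  by (simp_all add: quot1_def quot2_def min_one_quot_bounds)

lemma continuous_rad: "continuous_on U (rad f k)"
  by (rule continuous_at_imp_continuous_on, rule ballI, rule differentiable_imp_continuous_within, rule d)

lemma segsup_eq:
  "segsup m x = (SUP s\<in>{1..4}. \<bar>radial_deriv f (s *\<^sub>R (2 powi (- m - 1)) *\<^sub>R sgn x)\<bar>)"
  unfolding segsup_def radial_segment_eq[where m = m and x = x, OF refl] image_image by (rule refl)

lemma norm_segment_point: "(x :: real^'n) \<noteq> 0 \<Longrightarrow> 0 \<le> s \<Longrightarrow> norm (s *\<^sub>R (2 powi (- m - 1)) *\<^sub>R sgn x) = s * 2 powi (- m - 1)"
  by (simp add: norm_sgn)

lemma segment_point:
  fixes x :: "real^'n"
  assumes m: "2 powi (- m + 1) < b" and "x \<noteq> 0" "s \<in> {1..4}"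
  shows "s *\<^sub>R (2 powi (- m - 1)) *\<^sub>R sgn x \<in> cball 0 b" "s *\<^sub>R (2 powi (- m - 1)) *\<^sub>R sgn x \<noteq> 0"
proof -
  have four: "(2::real) powi (- m + 1) = 4 * 2 powi (- m - 1)"
    using power_int_add[of "2::real" "- m - 1" 2] by simp
  have "s * 2 powi (- m - 1) \<le> 4 * (2 powi (- m - 1) :: real)" using assms(3) by (intro mult_right_mono) auto
  moreover have "norm (s *\<^sub>R (2 powi (- m - 1)) *\<^sub>R sgn x) = s * 2 powi (- m - 1)"
    using assms(3) by (intro norm_segment_point assms(2)) auto
  ultimately have "norm (s *\<^sub>R (2 powi (- m - 1)) *\<^sub>R sgn x) \<le> b" using m four by linarith
  thus "s *\<^sub>R (2 powi (- m - 1)) *\<^sub>R sgn x \<in> cball 0 b" by (simp only: mem_cball dist_0_norm)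
  show "s *\<^sub>R (2 powi (- m - 1)) *\<^sub>R sgn x \<noteq> 0"
    using assms(2,3) by (auto simp: sgn_zero_iff)
qed

lemma continuous_radial_deriv: "continuous_on (U - {0}) (radial_deriv f)"
  unfolding radial_deriv_rad[abs_def]
  by (intro continuous_intros continuous_on_subset[OF continuous_rad]) auto

lemma segsup_bdd:
  assumes m: "2 powi (- m + 1) < b" and x: "x \<noteq> 0"
  shows "bdd_above ((\<lambda>s. \<bar>radial_deriv f (s *\<^sub>R (2 powi (- m - 1)) *\<^sub>R sgn x)\<bar>) ` {1..4})"
proof -
  have sub: "(\<lambda>s. s *\<^sub>R (2 powi (- m - 1)) *\<^sub>R sgn x) ` {1..4} \<subseteq> U - {0}"
  proof (rule image_subsetI)
    fix s :: real assume s: "s \<in> {1..4}"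
    show "s *\<^sub>R (2 powi (- m - 1)) *\<^sub>R sgn x \<in> U - {0}"
      using subsetD[OF U(2) segment_point(1)[OF m x s]] segment_point(2)[OF m x s] by simp
  qed
  have "continuous_on {1..4} (\<lambda>s. s *\<^sub>R (2 powi (- m - 1)) *\<^sub>R sgn x)"
    by (intro continuous_intros)
  from continuous_on_compose2[OF continuous_radial_deriv this sub]
  have "continuous_on {1..4} (\<lambda>s. \<bar>radial_deriv f (s *\<^sub>R (2 powi (- m - 1)) *\<^sub>R sgn x)\<bar>)"
    by (rule continuous_on_rabs)
  thus ?thesis
    by (intro bounded_imp_bdd_above compact_imp_bounded compact_continuous_image compact_Icc)
qed

lemma segsup_nonneg:
  assumes m: "2 powi (- m + 1) < b" and x: "x \<noteq> 0"
  shows "0 \<le> segsup m x"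
  unfolding segsup_eq by (rule cSUP_upper2[OF segsup_bdd[OF m x], of 1]) auto

text \<open>A supremum of uncountably many functions, but each is continuous off the origin, so the
  superlevel sets there are unions of open sets. The origin has no direction and receives the value
  0 by hand.\<close>

lemma segsup_measurable:
  assumes m: "2 powi (- m + 1) < b"
  shows "(\<lambda>x. if x = 0 then 0 else segsup m x) \<in> borel_measurable borel"
  unfolding borel_measurable_iff_greater
proof
  fix c :: real
  define F where "F s x = \<bar>radial_deriv f (s *\<^sub>R (2 powi (- m - 1)) *\<^sub>R sgn x)\<bar>" for s x
  have op: "open ((- {0}) \<inter> F s -` {c<..})" if "s \<in> {1..4}" for s
  proof (rule continuous_open_preimage)
    have sub: "(\<lambda>x. s *\<^sub>R (2 powi (- m - 1)) *\<^sub>R sgn x) ` (- {0}) \<subseteq> U - {0}"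
    proof (rule image_subsetI)
      fix x :: "real^'n" assume "x \<in> - {0}"
      hence x: "x \<noteq> 0" by simp
      show "s *\<^sub>R (2 powi (- m - 1)) *\<^sub>R sgn x \<in> U - {0}"
        using subsetD[OF U(2) segment_point(1)[OF m x that]] segment_point(2)[OF m x that] by simp
    qed
    have "continuous_on (- {0}) (\<lambda>x. s *\<^sub>R (2 powi (- m - 1)) *\<^sub>R sgn (x :: real^'n))"
      by (intro continuous_intros) auto
    from continuous_on_compose2[OF continuous_radial_deriv this sub]
    show "continuous_on (- {0}) (F s)" unfolding F_def by (rule continuous_on_rabs)
  qed auto
  have "{x \<in> space borel. c < (if x = 0 then 0 else segsup m x)} =
      (\<Union>s\<in>{1..4}. (- {0}) \<inter> F s -` {c<..}) \<union> (if c < 0 then {0} else {})"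
  proof (intro equalityI subsetI)
    fix x :: "real^'n" assume x: "x \<in> {x \<in> space borel. c < (if x = 0 then 0 else segsup m x)}"
    show "x \<in> (\<Union>s\<in>{1..4}. (- {0}) \<inter> F s -` {c<..}) \<union> (if c < 0 then {0} else {})"
    proof (cases "x = 0")
      case False
      hence "c < segsup m x" using x by simp
      then obtain s where "s \<in> {1..4}" "c < F s x" unfolding segsup_eq F_def
        using less_cSUP_iff[OF _ segsup_bdd[OF m False], of c] by auto
      thus ?thesis using False by auto
    qed (use x in auto)
  next
    fix x :: "real^'n" assume x: "x \<in> (\<Union>s\<in>{1..4}. (- {0}) \<inter> F s -` {c<..}) \<union> (if c < 0 then {0} else {})"
    show "x \<in> {x \<in> space borel. c < (if x = 0 then 0 else segsup m x)}"
    proof (cases "x = 0")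
      case False
      then obtain s where "s \<in> {1..4}" "c < F s x" using x by (auto split: if_splits)
      hence "c < segsup m x" unfolding segsup_eq F_def
        using less_cSUP_iff[OF _ segsup_bdd[OF m False], of c] by auto
      thus ?thesis using False by simp
    qed (use x in \<open>auto split: if_splits\<close>)
  qed
  also have "\<dots> \<in> sets borel"
  proof (rule sets.Un)
    show "(\<Union>s\<in>{1..4}. (- {0}) \<inter> F s -` {c<..}) \<in> sets borel"
      by (rule borel_open, rule open_UN, rule ballI, rule op)
  qed simp
  finally show "{x \<in> space borel. c < (if x = 0 then 0 else segsup m x)} \<in> sets borel" .
qed

lemma quot1_measurable:
  assumes S: "S \<subseteq> U" and [measurable]: "S \<in> sets borel"
  shows "(\<lambda>x. indicator S x * quot1 lam x) \<in> borel_measurable borel"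
proof -
  have c: "continuous_on S (rad f k)" for k using continuous_on_subset[OF continuous_rad S] .
  have [measurable]: "(\<lambda>x. indicator S x *\<^sub>R rad f k x) \<in> borel_measurable borel" for k
    by (rule borel_measurable_continuous_on_indicator[OF assms(2) c])
  have "(\<lambda>x. indicator S x * quot1 lam x) = (\<lambda>x. indicator S x *
      min_one_quot (indicator S x *\<^sub>R rad f 2 x) (lam * (indicator S x *\<^sub>R rad f 1 x)\<^sup>2))"
    by (auto simp: quot1_def indicator_def fun_eq_iff)
  also have "\<dots> \<in> borel_measurable borel" by measurable
  finally show ?thesis .
qed

lemma quot2_measurable:
  assumes m: "2 powi (- m + 1) < b" and [measurable]: "S \<in> sets borel" and S: "0 \<notin> S"
  shows "(\<lambda>x. indicator S x * quot2 lam m x) \<in> borel_measurable borel"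
proof -
  note [measurable] = segsup_measurable[OF m]
  have "(\<lambda>x. indicator S x * quot2 lam m x) = (\<lambda>x. indicator S x *
      min_one_quot 1 (\<bar>lam\<bar> * norm x * (if x = 0 then 0 else segsup m x)))"
    using S by (auto simp: quot2_def indicator_def fun_eq_iff)
  also have "\<dots> \<in> borel_measurable borel" by measurable
  finally show ?thesis .
qed

end

section \<open>From rays to shells\<close>

lemma norm_directional_le:
  fixes g :: "'b::real_normed_vector ^'n"
  shows "norm (\<Sum>i\<in>UNIV. z $ i *\<^sub>R g $ i) \<le> norm (z :: real^'n) * norm g"
proof -
  have "norm (\<Sum>i\<in>UNIV. z $ i *\<^sub>R g $ i) \<le> (\<Sum>i\<in>UNIV. \<bar>z $ i\<bar> * \<bar>norm (g $ i)\<bar>)"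
    by (rule order_trans[OF norm_sum]) simp
  also have "\<dots> \<le> L2_set (\<lambda>i. z $ i) UNIV * L2_set (\<lambda>i. norm (g $ i)) UNIV"
    by (rule L2_set_mult_ineq)
  finally show ?thesis by (simp add: norm_vec_def L2_set_def)
qed

text \<open>The factor \<open>c\<close> gives \<open>c *\<^sub>R x\<close> norm
  \<open>a / 2\<close>. So \<open>s\<close> in \<open>{2..<4}\<close> sweeps out the shell, and
  \<open>s\<close> in \<open>{1..4}\<close> the segment over which the supremum is taken.\<close>

lemma ray_rescale:
  fixes \<Phi> :: "'a::euclidean_space \<Rightarrow> 'b::{banach, second_countable_topology}"
  assumes x: "x \<in> shell 1" and a: "a > 0"
  defines "c \<equiv> a / (2 * norm x)"
  shows "(LINT t|lborel. (indicator {0<..} t * t ^ k) *\<^sub>R (indicator (shell a) (t *\<^sub>R x) *\<^sub>R \<Phi> (t *\<^sub>R x))) =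
    (c * c ^ k) *\<^sub>R (LINT s|lborel. indicator {2..<4} s *\<^sub>R (s ^ k *\<^sub>R \<Phi> (s *\<^sub>R c *\<^sub>R x)))"
proof -
  have nx: "norm x > 0" using x by (auto simp: shell_def)
  have c: "c > 0" using a nx by (simp add: c_def)
  let ?F = "\<lambda>t. (indicator {0<..} t * t ^ k) *\<^sub>R (indicator (shell a) (t *\<^sub>R x) *\<^sub>R \<Phi> (t *\<^sub>R x))"
  have pt: "?F (0 + c * s) = c ^ k *\<^sub>R (indicator {2..<4} s *\<^sub>R (s ^ k *\<^sub>R \<Phi> (s *\<^sub>R c *\<^sub>R x)))" for s
  proof (cases "s > 0")
    case True
    have "norm ((c * s) *\<^sub>R x) = s * (a / 2)" using True a nx by (simp add: c_def abs_mult)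
    hence "(c * s) *\<^sub>R x \<in> shell a \<longleftrightarrow> a \<le> s * (a / 2) \<and> s * (a / 2) < 2 * a"
      by (simp only: shell_def mem_Collect_eq)
    also have "\<dots> \<longleftrightarrow> s \<in> {2..<4}" using a by (auto simp: field_simps)
    finally have "(c * s) *\<^sub>R x \<in> shell a \<longleftrightarrow> s \<in> {2..<4}" .
    thus ?thesis using True c by (auto simp: indicator_def power_mult_distrib mult.commute)
  next
    case False
    hence "\<not> c * s > 0" using c by (simp add: mult_le_0_iff not_less)
    thus ?thesis using False by (simp add: indicator_def)
  qed
  have "(LINT t|lborel. ?F t) = \<bar>c\<bar> *\<^sub>R (LINT s|lborel. ?F (0 + c * s))"
    using c by (intro lborel_integral_real_affine) auto
  also have "\<dots> = \<bar>c\<bar> *\<^sub>R (c ^ k *\<^sub>R (LINT s|lborel. indicator {2..<4} s *\<^sub>R (s ^ k *\<^sub>R \<Phi> (s *\<^sub>R c *\<^sub>R x))))"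
    by (simp only: pt integral_scaleR_right)
  finally show ?thesis using c by (simp only: abs_of_pos scaleR_scaleR)
qed

lemma integral_Ico_Icc:
  fixes F :: "real \<Rightarrow> 'b::{banach, second_countable_topology}"
  assumes "(\<lambda>s. indicator {p..q} s *\<^sub>R F s) \<in> borel_measurable borel"
  shows "(LINT s|lborel. indicator {p..<q} s *\<^sub>R F s) = (LINT s|lborel. indicator {p..q} s *\<^sub>R F s)"
proof (rule integral_cong_AE)
  have "AE s in lborel. s \<noteq> q" by (rule AE_lborel_singleton)
  thus "AE s in lborel. indicator {p..<q} s *\<^sub>R F s = indicator {p..q} s *\<^sub>R F s"
    by eventually_elim (auto simp: indicator_def)
  note [measurable] = assms
  have "(\<lambda>s. indicator {p..<q} s *\<^sub>R F s) = (\<lambda>s. indicator {p..<q} s *\<^sub>R (indicator {p..q} s *\<^sub>R F s))"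
    by (auto simp: indicator_def fun_eq_iff)
  also have "\<dots> \<in> borel_measurable borel" by measurable
  finally show "(\<lambda>s. indicator {p..<q} s *\<^sub>R F s) \<in> borel_measurable lborel" by simp
  show "(\<lambda>s. indicator {p..q} s *\<^sub>R F s) \<in> borel_measurable lborel" using assms by simp
qed

context radial_phase
begin

text \<open>Dividing by powers of \<open>s\<close> preserves the inequality because
  \<open>s \<ge> 1\<close>: the left side is divided by the highest power that occurs.\<close>

lemma ray_jets:
  assumes z: "\<And>s. s \<in> {1..4} \<Longrightarrow> s *\<^sub>R z \<in> cball 0 b"
  defines "g \<equiv> \<lambda>k s. rad f k (s *\<^sub>R z) / s ^ k"
  shows "derivs_on 1 4 g" "\<forall>s\<in>{1..4}. (g (Suc N) s)\<^sup>2 \<le> A * (\<Sum>j<N. (g (Suc j) s)\<^sup>2)"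
proof -
  show "derivs_on 1 4 g" unfolding derivs_on_def g_def
  proof (intro allI ballI)
    fix k and s :: real assume s: "s \<in> {1..4}"
    have "s *\<^sub>R z \<in> U" by (rule subsetD[OF U(2) z[OF s]])
    thus "((\<lambda>s. rad f k (s *\<^sub>R z) / s ^ k) has_real_derivative rad f (Suc k) (s *\<^sub>R z) / s ^ Suc k) (at s within {1..4})"
      using s by (intro ray_derivative d) auto
  qed
  show "\<forall>s\<in>{1..4}. (g (Suc N) s)\<^sup>2 \<le> A * (\<Sum>j<N. (g (Suc j) s)\<^sup>2)"
  proof
    fix s :: real assume s: "s \<in> {1..4}"
    have "(g (Suc N) s)\<^sup>2 = (rad f (Suc N) (s *\<^sub>R z))\<^sup>2 / (s ^ Suc N)\<^sup>2" unfolding g_def by (rule power_divide)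
    also have "\<dots> \<le> A * (\<Sum>j<N. (rad f (Suc j) (s *\<^sub>R z))\<^sup>2) / (s ^ Suc N)\<^sup>2"
      by (intro divide_right_mono ode z s) simp
    also have "\<dots> = A * (\<Sum>j<N. (rad f (Suc j) (s *\<^sub>R z))\<^sup>2 / (s ^ Suc N)\<^sup>2)"
      by (simp only: times_divide_eq_right[symmetric] sum_divide_distrib)
    also have "\<dots> \<le> A * (\<Sum>j<N. (g (Suc j) s)\<^sup>2)"
    proof (intro mult_left_mono sum_mono A)
      fix j assume "j \<in> {..<N}"
      hence "s ^ Suc j \<le> s ^ Suc N" using s by (intro power_increasing) auto
      hence "(s ^ Suc j)\<^sup>2 \<le> (s ^ Suc N)\<^sup>2" using s by (intro power_mono) auto
      hence "(rad f (Suc j) (s *\<^sub>R z))\<^sup>2 / (s ^ Suc N)\<^sup>2 \<le> (rad f (Suc j) (s *\<^sub>R z))\<^sup>2 / (s ^ Suc j)\<^sup>2"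
        using s by (intro divide_left_mono mult_pos_pos zero_less_power) auto
      thus "(rad f (Suc j) (s *\<^sub>R z))\<^sup>2 / (s ^ Suc N)\<^sup>2 \<le> (g (Suc j) s)\<^sup>2"
        unfolding g_def power_divide .
    qed
    finally show "(g (Suc N) s)\<^sup>2 \<le> A * (\<Sum>j<N. (g (Suc j) s)\<^sup>2)" .
  qed
qed

text \<open>In the parameter \<open>s\<close> the derivative is \<open>norm z\<close> times the
  radial derivative, and \<open>s *\<^sub>R z\<close> is at most four times as long as
  \<open>z\<close>. So the two denominators of the second minimum differ by a factor of at most
  4.\<close>

lemma quot_on_ray:
  assumes m: "2 powi (- m + 1) < b" and z: "norm z = 2 powi (- m - 1)" and s: "s \<in> {2..<4}"
  shows "min_one_quot (rad f 2 (s *\<^sub>R z) / s ^ 2) (lam * (rad f 1 (s *\<^sub>R z) / s ^ 1)\<^sup>2) = quot1 lam (s *\<^sub>R z)"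
    "min_one_quot 1 (\<bar>lam\<bar> * (SUP s\<in>{1..4}. \<bar>rad f 1 (s *\<^sub>R z) / s ^ 1\<bar>)) \<le> 4 * quot2 lam m (s *\<^sub>R z)"
proof -
  have s0: "s > 0" using s by auto
  have "min_one_quot (p / s\<^sup>2) (lam * (q / s)\<^sup>2) = min_one_quot p (lam * q\<^sup>2)" for p q :: real
    using s0 by (auto simp: min_one_quot_def power_divide)
  thus "min_one_quot (rad f 2 (s *\<^sub>R z) / s ^ 2) (lam * (rad f 1 (s *\<^sub>R z) / s ^ 1)\<^sup>2) = quot1 lam (s *\<^sub>R z)"
    unfolding quot1_def power_one_right .
  define \<rho> where "\<rho> = (2::real) powi (- m - 1)"
  have \<rho>: "\<rho> > 0" by (simp add: \<rho>_def)
  have z0: "z \<noteq> 0" using z \<rho> unfolding \<rho>_def by auto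
  have sg: "(2 powi (- m - 1)) *\<^sub>R sgn (s *\<^sub>R z) = z"
  proof -
    have "norm z *\<^sub>R sgn z = z" using z0 by (simp add: sgn_div_norm)
    moreover have "sgn (s *\<^sub>R z) = sgn z" using s0 by (simp add: sgn_scaleR)
    ultimately show ?thesis unfolding z by (simp only:)
  qed
  define S where "S = (SUP s\<in>{1..4}. \<bar>rad f 1 (s *\<^sub>R z) / s ^ 1\<bar>)"
  have sz: "s *\<^sub>R z \<noteq> 0" using s0 z0 by simp
  have seg: "segsup m (s *\<^sub>R z) = (SUP t\<in>{1..4}. \<bar>radial_deriv f (t *\<^sub>R z)\<bar>)"
    unfolding segsup_eq sg ..
  have point: "\<bar>radial_deriv f (t *\<^sub>R z)\<bar> = \<bar>rad f 1 (t *\<^sub>R z) / t ^ 1\<bar> / \<rho>" if "t \<in> {1..4}" for t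
    using that z \<rho> unfolding radial_deriv_rad \<rho>_def[symmetric]
    by (simp add: abs_mult abs_divide del: rad.simps)
  have zball: "t *\<^sub>R z \<in> cball 0 b" if "t \<in> {1..4}" for t
    using segment_point(1)[OF m sz that] unfolding sg .
  have "continuous_on {1..4} (\<lambda>s. rad f 1 (s *\<^sub>R z) / s ^ 1)"
    by (rule derivs_on_continuous[OF ray_jets(1)[OF zball]])
  hence bdd: "bdd_above ((\<lambda>s. \<bar>rad f 1 (s *\<^sub>R z) / s ^ 1\<bar>) ` {1..4})"
    by (intro bounded_imp_bdd_above compact_imp_bounded compact_continuous_image compact_Icc continuous_on_rabs)
  have S0: "0 \<le> S" unfolding S_def by (rule cSUP_upper2[OF bdd, of 1]) auto
  have "segsup m (s *\<^sub>R z) \<le> S / \<rho>" unfolding seg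
  proof (rule cSUP_least)
    fix t :: real assume t: "t \<in> {1..4}"
    have "\<bar>rad f 1 (t *\<^sub>R z) / t ^ 1\<bar> \<le> S" unfolding S_def by (rule cSUP_upper[OF t bdd])
    thus "\<bar>radial_deriv f (t *\<^sub>R z)\<bar> \<le> S / \<rho>" unfolding point[OF t] using \<rho> by (intro divide_right_mono) auto
  qed simp
  hence "\<bar>lam\<bar> * norm (s *\<^sub>R z) * segsup m (s *\<^sub>R z) \<le> \<bar>lam\<bar> * norm (s *\<^sub>R z) * (S / \<rho>)"
    by (intro mult_left_mono) auto
  also have "\<dots> = s * (\<bar>lam\<bar> * S)" using z \<rho> s0 unfolding \<rho>_def[symmetric] by simp
  also have "\<dots> \<le> 4 * (\<bar>lam\<bar> * S)" using s S0 by (intro mult_right_mono) auto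
  finally have "\<bar>lam\<bar> * norm (s *\<^sub>R z) * segsup m (s *\<^sub>R z) \<le> 4 * (\<bar>lam\<bar> * S)" .
  thus "min_one_quot 1 (\<bar>lam\<bar> * (SUP s\<in>{1..4}. \<bar>rad f 1 (s *\<^sub>R z) / s ^ 1\<bar>)) \<le> 4 * quot2 lam m (s *\<^sub>R z)"
    unfolding S_def[symmetric] quot2_def
    by (intro min_one_quot_le_scaled mult_nonneg_nonneg S0 segsup_nonneg[OF m sz]) auto
qed

end

locale radial_phase_bound = radial_phase f U b A N for f :: "real^'n \<Rightarrow> real" and U b A N +
  fixes C :: real
  assumes C: "C \<ge> 0" and osc_bound: "\<forall>g \<psi> \<psi>' lam B. oscillation (g 0) (g 1) (g 2) \<psi> \<psi>' lam B 1 4 \<longrightarrow> derivs_on 1 4 g \<longrightarrow>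
    (\<forall>x\<in>{1..4}. (g (Suc N) x)\<^sup>2 \<le> A * (\<Sum>j<N. (g (Suc j) x)\<^sup>2)) \<longrightarrow>
    oscillation.osc (g 0) \<psi> lam 2 4 \<le>
      C * B * ((LINT t:{2..4}|lborel. min_one_quot (g 2 t) (lam * (g 1 t)\<^sup>2)) +
        (LINT t:{2..4::real}|lborel. min_one_quot 1 (\<bar>lam\<bar> * (SUP s\<in>{1..4}. \<bar>g 1 s\<bar>))))"
begin

definition majorant :: "real \<Rightarrow> int \<Rightarrow> real^'n \<Rightarrow> real"
  where "majorant lam m x = quot1 lam x + 4 * quot2 lam m x"

definition phase_factor :: "real \<Rightarrow> real^'n \<Rightarrow> complex"
  where "phase_factor lam x = exp (\<i> * complex_of_real (lam * f x))"

lemma norm_phase_factor: "norm (phase_factor lam x) = 1"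
  by (simp add: phase_factor_def norm_exp_i_times)

lemma majorant_bounds: "0 \<le> majorant lam m x" "majorant lam m x \<le> 5"
  using quot_bounds(1,2)[of lam x] quot_bounds(3,4)[of lam m x] by (auto simp: majorant_def)

lemma shell_subset:
  fixes m :: int
  assumes m: "2 powi (- m + 1) < b"
  shows "shell (2 powi (- m)) \<subseteq> U" "0 \<notin> (shell (2 powi (- m)) :: (real^'n) set)"
proof -
  have two: "(2::real) powi (- m + 1) = 2 * 2 powi (- m)"
    using power_int_add[of "2::real" "- m" 1] by simp
  have "norm x \<le> b" if "x \<in> shell (2 powi (- m))" for x :: "real^'n"
    using that m two by (simp add: shell_def)
  hence "shell (2 powi (- m)) \<subseteq> cball (0 :: real^'n) b" by auto
  thus "shell (2 powi (- m)) \<subseteq> U" using U(2) by (rule subset_trans)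
  show "0 \<notin> (shell (2 powi (- m)) :: (real^'n) set)" by (simp add: shell_def not_le)
qed

lemma majorant_measurable:
  assumes m: "2 powi (- m + 1) < b"
  shows "(\<lambda>x. indicator (shell (2 powi (- m))) x * majorant lam m x) \<in> borel_measurable borel"
proof -
  note [measurable] = quot1_measurable[OF shell_subset(1)[OF m] shell_borel] quot2_measurable[OF m shell_borel shell_subset(2)[OF m]]
  have "(\<lambda>x. indicator (shell (2 powi (- m))) x * majorant lam m x) =
    (\<lambda>x. indicator (shell (2 powi (- m))) x * quot1 lam x + 4 * (indicator (shell (2 powi (- m))) x * quot2 lam m x))"
    by (simp add: majorant_def fun_eq_iff algebra_simps)
  also have "\<dots> \<in> borel_measurable borel" by measurable
  finally show ?thesis .
qed

text \<open>\<open>osc_bound\<close> is applied with the polar weight \<open>s ^ k\<close> absorbed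
  into the amplitude. On the right the same weight may be inserted because \<open>s \<ge> 1\<close>,
  so both sides become radial integrals in polar form.\<close>

lemma ray_bound:
  fixes \<phi> :: "real^'n \<Rightarrow> complex"
  assumes m: "2 powi (- m + 1) < b" and z: "norm z = 2 powi (- m - 1)" and lam: "lam \<noteq> 0"
    and \<phi>: "continuously_differentiable \<phi>" and P: "\<And>x. norm (\<phi> x) \<le> P" "\<And>x. norm (grad \<phi> x) \<le> P"
  defines "k \<equiv> CARD('n) - 1"
  shows "norm (LINT s|lborel. indicator {2..<4} s *\<^sub>R (s ^ k *\<^sub>R (phase_factor lam (s *\<^sub>R z) * \<phi> (s *\<^sub>R z)))) \<le>
    C * (real (k + 1) * 4 ^ k * P) * (LINT s|lborel. indicator {2..<4} s *\<^sub>R (s ^ k *\<^sub>R majorant lam m (s *\<^sub>R z)))"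
proof -
  have P0: "0 \<le> P" using order_trans[OF norm_ge_zero P(1)] .
  have four: "(2::real) powi (- m + 1) = 4 * 2 powi (- m - 1)"
    using power_int_add[of "2::real" "- m - 1" 2] by simp
  have zball: "s *\<^sub>R z \<in> cball 0 b" if "s \<in> {1..4}" for s
  proof -
    have "norm (s *\<^sub>R z) \<le> 4 * norm z" using that by (auto intro!: mult_right_mono)
    hence "norm (s *\<^sub>R z) \<le> b" using m four z by linarith
    thus ?thesis by (simp only: mem_cball dist_0_norm)
  qed
  have z1: "norm z \<le> 1" using zball[of 1] b by simp
  define g where "g = (\<lambda>k s. rad f k (s *\<^sub>R z) / s ^ k)"
  have g: "derivs_on 1 4 g" "\<forall>s\<in>{1..4}. (g (Suc N) s)\<^sup>2 \<le> A * (\<Sum>j<N. (g (Suc j) s)\<^sup>2)"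
    unfolding g_def by (rule ray_jets[OF zball], assumption)+
  have \<phi>d: "\<phi> differentiable (at x)" and \<phi>g: "continuous_on UNIV (grad \<phi>)" for x
    using \<phi> by (auto simp: continuously_differentiable_def)
  have \<phi>c: "continuous_on UNIV \<phi>"
    by (rule continuous_at_imp_continuous_on, rule ballI, rule differentiable_imp_continuous_within, rule \<phi>d)
  define G where "G s = (\<Sum>i\<in>UNIV. z $ i *\<^sub>R grad \<phi> (s *\<^sub>R z) $ i)" for s
  define \<psi> where "\<psi> s = complex_of_real (s ^ k) * \<phi> (s *\<^sub>R z)" for s
  define \<psi>' where "\<psi>' s = complex_of_real (s ^ k) * G s + complex_of_real (real k * s ^ (k - 1)) * \<phi> (s *\<^sub>R z)" for s
  \<comment> \<open>Bounds the amplitude and its derivative: \<open>s \<le> 4\<close>,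
    differentiating \<open>s ^ k\<close> brings a factor \<open>k\<close>, and the chain rule a
    factor \<open>norm z\<close>, which is at most 1 because \<open>b \<le> 1\<close>.\<close>
  define B where "B = real (k + 1) * 4 ^ k * P"
  have cz: "continuous_on S (\<lambda>s. s *\<^sub>R z)" for S by (intro continuous_intros)
  have c1: "continuous_on S (\<lambda>s. \<phi> (s *\<^sub>R z))" for S
    by (rule continuous_on_compose2[OF \<phi>c cz]) simp
  have c2: "continuous_on S (\<lambda>s. grad \<phi> (s *\<^sub>R z))" for S
    by (rule continuous_on_compose2[OF \<phi>g cz]) simp
  have c3: "continuous_on S G" for S unfolding G_def by (intro continuous_intros c2)
  have osc: "oscillation (g 0) (g 1) (g 2) \<psi> \<psi>' lam B 1 4"
  proof
    show "(g 0 has_real_derivative g 1 x) (at x within {1..4})" if "x \<in> {1..4}" for x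
      using derivs_onD[OF g(1) that, of 0] by simp
    show "(g 1 has_real_derivative g 2 x) (at x within {1..4})" if "x \<in> {1..4}" for x
      using derivs_onD[OF g(1) that, of 1] by (simp add: numeral_2_eq_2)
    show "continuous_on {1..4} (g 2)" by (rule derivs_on_continuous[OF g(1)])
    show "(\<psi> has_vector_derivative \<psi>' x) (at x within {1..4})" for x
    proof -
      have "((\<lambda>s. s ^ k) has_real_derivative real k * x ^ (k - 1)) (at x within {1..4})"
        by (auto intro!: derivative_eq_intros)
      thus ?thesis unfolding \<psi>_def[abs_def] \<psi>'_def G_def
        by (intro has_vector_derivative_mult has_vector_derivative_of_real ray_vector_derivative \<phi>d)
    qed
    show "continuous_on {1..4} \<psi>'" unfolding \<psi>'_def[abs_def] by (intro continuous_intros c1 c3)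
    show "0 \<le> B" using P0 by (simp add: B_def)
    show "lam \<noteq> 0" by (rule lam)
    fix x :: real assume x: "x \<in> {1..4}"
    have xk: "x ^ k \<le> 4 ^ k" "x ^ (k - 1) \<le> 4 ^ (k - 1)" using x by (auto intro!: power_mono)
    have k1: "(4::real) ^ (k - 1) \<le> 4 ^ k" by (intro power_increasing) auto
    have "norm (\<psi> x) \<le> 4 ^ k * P" unfolding \<psi>_def norm_mult
      using xk x P(1) by (intro mult_mono) (auto simp: norm_power)
    also have "\<dots> \<le> B" using P0 by (simp add: B_def distrib_right)
    finally show "norm (\<psi> x) \<le> B" .
    have "norm (G x) \<le> norm z * norm (grad \<phi> (x *\<^sub>R z))" unfolding G_def by (rule norm_directional_le)
    also have "\<dots> \<le> 1 * P" using z1 P(2) by (intro mult_mono) auto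
    finally have Gb: "norm (G x) \<le> P" by simp
    have "norm (complex_of_real (x ^ k) * G x) \<le> 4 ^ k * P" unfolding norm_mult
      using xk x Gb by (intro mult_mono) (auto simp: norm_power)
    moreover have "norm (complex_of_real (real k * x ^ (k - 1)) * \<phi> (x *\<^sub>R z)) \<le> (real k * 4 ^ k) * P"
      unfolding norm_mult
    proof (intro mult_mono P)
      have "real k * x ^ (k - 1) \<le> real k * 4 ^ k" using xk(2) k1 by (intro mult_left_mono) linarith+
      thus "norm (complex_of_real (real k * x ^ (k - 1))) \<le> real k * 4 ^ k" using x by (simp only: norm_of_real) (auto simp: abs_mult)
    qed (use P0 in auto)
    ultimately have "norm (\<psi>' x) \<le> 4 ^ k * P + (real k * 4 ^ k) * P"
      unfolding \<psi>'_def by (intro order_trans[OF norm_triangle_ineq] add_mono)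
    also have "\<dots> = B" by (simp add: B_def distrib_right)
    finally show "norm (\<psi>' x) \<le> B" .
  qed
  then interpret oscillation "g 0" "g 1" "g 2" \<psi> \<psi>' lam B 1 4 .
  have Eeq: "E s * \<psi> s = s ^ k *\<^sub>R (phase_factor lam (s *\<^sub>R z) * \<phi> (s *\<^sub>R z))" for s
  proof -
    have g0: "g 0 s = f (s *\<^sub>R z)" by (simp add: g_def)
    have "E s = phase_factor lam (s *\<^sub>R z)" unfolding E_def phase_factor_def g0 ..
    thus ?thesis by (simp add: \<psi>_def scaleR_conv_of_real mult_ac)
  qed
  have cE: "continuous_on {2..4} (\<lambda>s. E s * \<psi> s)"
    by (intro continuous_intros continuous_on_subset[OF continuous(3)] continuous_on_subset[OF continuous(4)]) auto
  have lhs: "norm (LINT s|lborel. indicator {2..<4} s *\<^sub>R (s ^ k *\<^sub>R (phase_factor lam (s *\<^sub>R z) * \<phi> (s *\<^sub>R z)))) = osc 2 4"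
  proof -
    have "(LINT s|lborel. indicator {2..<4} s *\<^sub>R (E s * \<psi> s)) = (LINT s|lborel. indicator {2..4} s *\<^sub>R (E s * \<psi> s))"
      by (rule integral_Ico_Icc[OF borel_measurable_continuous_on_indicator[OF _ cE]]) simp
    also have "\<dots> = integral {2..4} (\<lambda>s. E s * \<psi> s)"
      using set_borel_integral_eq_integral(2)[OF borel_integrable_atLeastAtMost'[OF cE]]
      unfolding set_lebesgue_integral_def .
    finally show ?thesis unfolding osc_def Eeq by simp
  qed
  let ?q1 = "\<lambda>t. min_one_quot (g 2 t) (lam * (g 1 t)\<^sup>2)"
  let ?q2 = "min_one_quot 1 (\<bar>lam\<bar> * (SUP s\<in>{1..4}. \<bar>g 1 s\<bar>))"
  have i1: "set_integrable lborel {2..4} ?q1"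
    by (intro min_one_quot_set_integrable continuous_intros derivs_on_continuous[OF derivs_on_subset[OF g(1)]]) auto
  have i2: "set_integrable lborel {2..4::real} (\<lambda>t. ?q2)"
    by (intro borel_integrable_atLeastAtMost' continuous_intros)
  have i12: "set_integrable lborel {2..4} (\<lambda>t. ?q1 t + ?q2)" by (rule set_integral_add(1)[OF i1 i2])
  have "osc 2 4 \<le> C * B * ((LINT t:{2..4}|lborel. ?q1 t) + (LINT t:{2..4::real}|lborel. ?q2))"
    by (rule osc_bound[rule_format, OF osc g(1)]) (use g(2) in blast)
  also have "(LINT t:{2..4}|lborel. ?q1 t) + (LINT t:{2..4::real}|lborel. ?q2) = (LINT t:{2..4}|lborel. ?q1 t + ?q2)"
    by (rule set_integral_add(2)[OF i1 i2, symmetric])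
  also have "\<dots> = (LINT s|lborel. indicator {2..<4} s *\<^sub>R (?q1 s + ?q2))"
    unfolding set_lebesgue_integral_def
    by (rule integral_Ico_Icc[symmetric]) (use i12 in \<open>auto simp: set_integrable_def dest: borel_measurable_integrable\<close>)
  also have "\<dots> \<le> (LINT s|lborel. indicator {2..<4} s *\<^sub>R (s ^ k *\<^sub>R majorant lam m (s *\<^sub>R z)))"
  proof (rule integral_mono)
    have i12': "set_integrable lborel {2..<4} (\<lambda>t. ?q1 t + ?q2)" by (rule set_integrable_subset[OF i12]) auto
    thus "integrable lborel (\<lambda>s. indicator {2..<4} s *\<^sub>R (?q1 s + ?q2))" by (simp add: set_integrable_def)
    have in_shell: "s *\<^sub>R z \<in> shell (2 powi (- m))" if "s \<in> {2..<4}" for s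
    proof -
      have "(2::real) powi (- m) = 2 * 2 powi (- m - 1)" using power_int_add[of "2::real" "- m - 1" 1] by simp
      hence n: "norm (s *\<^sub>R z) = s * (2 powi (- m) / 2)" using that z by simp
      have "2 * (2 powi (- m) / 2) \<le> s * (2 powi (- m) / 2 :: real)" using that by (intro mult_right_mono) auto
      moreover have "s * (2 powi (- m) / 2) < 4 * (2 powi (- m) / 2 :: real)" using that by (intro mult_strict_right_mono) auto
      ultimately show ?thesis unfolding shell_def mem_Collect_eq n by linarith
    qed
    show "integrable lborel (\<lambda>s. indicator {2..<4} s *\<^sub>R (s ^ k *\<^sub>R majorant lam m (s *\<^sub>R z)))"
    proof (rule Bochner_Integration.integrable_bound)
      show "integrable lborel (\<lambda>s::real. indicator {2..4} s *\<^sub>R ((4 ^ k * 5) :: real))"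
        using borel_integrable_atLeastAtMost'[of 2 4 "\<lambda>_. (4 ^ k * 5) :: real"] by (simp add: set_integrable_def)
      note [measurable] = majorant_measurable[OF m, of lam]
      have "(\<lambda>s. indicator {2..<4} s *\<^sub>R (s ^ k *\<^sub>R majorant lam m (s *\<^sub>R z))) =
        (\<lambda>s. indicator {2..<4} s * (s ^ k * (\<lambda>x. indicator (shell (2 powi (- m))) x * majorant lam m x) (s *\<^sub>R z)))"
        using in_shell by (auto simp: indicator_def fun_eq_iff)
      also have "\<dots> \<in> borel_measurable lborel" by measurable
      finally show "(\<lambda>s. indicator {2..<4} s *\<^sub>R (s ^ k *\<^sub>R majorant lam m (s *\<^sub>R z))) \<in> borel_measurable lborel" .
      show "AE s in lborel. norm (indicator {2..<4} s *\<^sub>R (s ^ k *\<^sub>R majorant lam m (s *\<^sub>R z))) \<le> norm (indicator {2..4} s *\<^sub>R ((4 ^ k * 5) :: real))"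
      proof (rule AE_I2)
        fix s :: real
        have "\<bar>s ^ k * majorant lam m (s *\<^sub>R z)\<bar> \<le> 4 ^ k * 5" if "s \<in> {2..<4}"
          unfolding abs_mult using that majorant_bounds[of lam m "s *\<^sub>R z"]
          by (intro mult_mono) (auto intro!: power_mono simp: power_abs)
        thus "norm (indicator {2..<4} s *\<^sub>R (s ^ k *\<^sub>R majorant lam m (s *\<^sub>R z))) \<le> norm (indicator {2..4} s *\<^sub>R ((4 ^ k * 5) :: real))"
          by (auto simp: indicator_def)
      qed
    qed
    fix s :: real
    show "indicator {2..<4} s *\<^sub>R (?q1 s + ?q2) \<le> indicator {2..<4} s *\<^sub>R (s ^ k *\<^sub>R majorant lam m (s *\<^sub>R z))"
    proof (cases "s \<in> {2..<4}")
      case True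
      have "?q1 s + ?q2 \<le> majorant lam m (s *\<^sub>R z)"
        using quot_on_ray[OF m z True, of lam] unfolding majorant_def g_def by linarith
      also have "\<dots> \<le> s ^ k * majorant lam m (s *\<^sub>R z)"
        using True majorant_bounds(1)[of lam m "s *\<^sub>R z"] mult_right_mono[of 1 "s ^ k" "majorant lam m (s *\<^sub>R z)"]
        by (simp add: one_le_power)
      finally show ?thesis using True by simp
    qed simp
  qed
  finally have "osc 2 4 \<le> C * B * (LINT s|lborel. indicator {2..<4} s *\<^sub>R (s ^ k *\<^sub>R majorant lam m (s *\<^sub>R z)))"
    using C B0 by (simp add: mult_left_mono)
  thus ?thesis unfolding lhs B_def .
qed

text \<open>\<open>dilation_average\<close> is applied to the oscillating integrand and to its
  majorant; the radial integrals are compared ray by ray, and the factor \<open>ln 2\<close>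
  cancels.\<close>

lemma shell_bound:
  fixes \<phi> :: "real^'n \<Rightarrow> complex"
  assumes m: "2 powi (- m + 1) < b" and lam: "lam \<noteq> 0"
    and \<phi>: "continuously_differentiable \<phi>" and P: "\<And>x. norm (\<phi> x) \<le> P" "\<And>x. norm (grad \<phi> x) \<le> P"
  defines "k \<equiv> CARD('n) - 1" and "a \<equiv> 2 powi (- m)"
  shows "norm (LINT x:shell a|lborel. phase_factor lam x * \<phi> x) \<le>
    C * (real (k + 1) * 4 ^ k * P) * (LINT x:shell a|lborel. majorant lam m x)"
    "set_integrable lborel (shell a) (\<lambda>x. phase_factor lam x * \<phi> x)"
    "set_integrable lborel (shell a) (majorant lam m)"
proof -
  define K where "K = C * (real (k + 1) * 4 ^ k * P)"
  have P0: "0 \<le> P" using order_trans[OF norm_ge_zero P(1)] .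
  have K: "K \<ge> 0" using C P0 by (simp add: K_def)
  have a: "a > 0" by (simp add: a_def)
  have sub: "shell a \<subseteq> U" unfolding a_def by (rule shell_subset(1)[OF m])
  have k: "DIM(real^'n) - 1 = k" by (simp add: k_def)
  define \<Phi> where "\<Phi> x = indicator (shell a) x *\<^sub>R (phase_factor lam x * \<phi> x)" for x
  define \<Psi> where "\<Psi> x = indicator (shell a) x *\<^sub>R majorant lam m x" for x
  have fc: "continuous_on U f" using continuous_rad[of 0] by simp
  have \<phi>c: "continuous_on UNIV \<phi>"
  proof (rule continuous_at_imp_continuous_on, rule ballI, rule differentiable_imp_continuous_within)
    show "\<phi> differentiable (at x)" for x using \<phi> by (simp add: continuously_differentiable_def)
  qed
  have \<Phi>m: "\<Phi> \<in> borel_measurable borel" unfolding \<Phi>_def[abs_def]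
  proof (rule borel_measurable_continuous_on_indicator[OF shell_borel])
    show "continuous_on (shell a) (\<lambda>x. phase_factor lam x * \<phi> x)" unfolding phase_factor_def
      by (intro continuous_intros continuous_on_subset[OF fc sub] continuous_on_subset[OF \<phi>c]) simp
  qed
  have \<Psi>m: "\<Psi> \<in> borel_measurable borel"
    using majorant_measurable[OF m, of lam] unfolding \<Psi>_def[abs_def] a_def by simp
  have \<Phi>b: "norm (\<Phi> x) \<le> P" for x
    using P(1)[of x] P0 by (simp add: \<Phi>_def indicator_def norm_mult norm_phase_factor)
  have \<Psi>b: "norm (\<Psi> x) \<le> 5" for x using majorant_bounds[of lam m x] by (simp add: \<Psi>_def indicator_def)
  have \<Phi>s: "{x. \<Phi> x \<noteq> 0} \<subseteq> shell a" by (auto simp: \<Phi>_def indicator_def)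
  have \<Psi>s: "{x. \<Psi> x \<noteq> 0} \<subseteq> shell a" by (auto simp: \<Psi>_def indicator_def)
  note A = dilation_average[OF \<Phi>m \<Phi>b a \<Phi>s, unfolded k]
  note B = dilation_average[OF \<Psi>m \<Psi>b a \<Psi>s, unfolded k]
  define I where "I x = (LINT t|lborel. (indicator {0<..} t * t ^ k) *\<^sub>R \<Phi> (t *\<^sub>R x))" for x
  define J where "J x = (LINT t|lborel. (indicator {0<..} t * t ^ k) *\<^sub>R \<Psi> (t *\<^sub>R x))" for x
  have IJ: "norm (I x) \<le> K * J x" if x: "x \<in> shell 1" for x
  proof -
    define c where "c = a / (2 * norm x)"
    have nx: "norm x > 0" using x by (auto simp: shell_def)
    have c: "c > 0" using a nx by (simp add: c_def)
    have z: "norm (c *\<^sub>R x) = 2 powi (- m - 1)"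
    proof -
      have "a = 2 * 2 powi (- m - 1)" unfolding a_def using power_int_add[of "2::real" "- m - 1" 1] by simp
      thus ?thesis using nx c by (simp add: c_def)
    qed
    have I: "I x = (c * c ^ k) *\<^sub>R (LINT s|lborel. indicator {2..<4} s *\<^sub>R (s ^ k *\<^sub>R (phase_factor lam (s *\<^sub>R c *\<^sub>R x) * \<phi> (s *\<^sub>R c *\<^sub>R x))))"
      unfolding I_def \<Phi>_def c_def by (rule ray_rescale[OF x a])
    have J: "J x = (c * c ^ k) *\<^sub>R (LINT s|lborel. indicator {2..<4} s *\<^sub>R (s ^ k *\<^sub>R majorant lam m (s *\<^sub>R c *\<^sub>R x)))"
      unfolding J_def \<Psi>_def c_def by (rule ray_rescale[OF x a])
    have r: "norm (LINT s|lborel. indicator {2..<4} s *\<^sub>R (s ^ k *\<^sub>R (phase_factor lam (s *\<^sub>R c *\<^sub>R x) * \<phi> (s *\<^sub>R c *\<^sub>R x)))) \<le>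
      K * (LINT s|lborel. indicator {2..<4} s *\<^sub>R (s ^ k *\<^sub>R majorant lam m (s *\<^sub>R c *\<^sub>R x)))"
      unfolding K_def k_def by (rule ray_bound[OF m z lam \<phi> P])
    have "norm (I x) = (c * c ^ k) * norm (LINT s|lborel. indicator {2..<4} s *\<^sub>R (s ^ k *\<^sub>R (phase_factor lam (s *\<^sub>R c *\<^sub>R x) * \<phi> (s *\<^sub>R c *\<^sub>R x))))"
      unfolding I norm_scaleR using c by (simp only: abs_of_pos mult_pos_pos zero_less_power)
    also have "\<dots> \<le> (c * c ^ k) * (K * (LINT s|lborel. indicator {2..<4} s *\<^sub>R (s ^ k *\<^sub>R majorant lam m (s *\<^sub>R c *\<^sub>R x))))"
      using c by (intro mult_left_mono r) auto
    also have "\<dots> = K * J x" unfolding J real_scaleR_def by (simp only: mult_ac)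
    finally show ?thesis .
  qed
  have intI: "integrable lborel (\<lambda>x. indicator (shell 1) x *\<^sub>R I x)" unfolding I_def by (rule A(2))
  have intJ: "integrable lborel (\<lambda>x. indicator (shell 1) x *\<^sub>R J x)" unfolding J_def by (rule B(2))
  have l2: "ln (2::real) > 0" by simp
  have "ln 2 * norm (LINT x|lborel. \<Phi> x) = norm (ln 2 *\<^sub>R (LINT x|lborel. \<Phi> x))" using l2 by simp
  also have "\<dots> = norm (LINT x|lborel. indicator (shell 1) x *\<^sub>R I x)" unfolding I_def A(1) ..
  also have "\<dots> \<le> (LINT x|lborel. norm (indicator (shell 1) x *\<^sub>R I x))" by (rule integral_norm_bound)
  also have "\<dots> \<le> (LINT x|lborel. K * (indicator (shell 1) x *\<^sub>R J x))"
  proof (rule integral_mono)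
    show "integrable lborel (\<lambda>x. norm (indicator (shell 1) x *\<^sub>R I x))" by (rule integrable_norm[OF intI])
    show "integrable lborel (\<lambda>x. K * (indicator (shell 1) x *\<^sub>R J x))" by (rule integrable_mult_right[OF intJ])
    show "norm (indicator (shell 1) x *\<^sub>R I x) \<le> K * (indicator (shell 1) x *\<^sub>R J x)" for x
      using IJ[of x] by (simp add: indicator_def)
  qed
  also have "\<dots> = K * (ln 2 *\<^sub>R (LINT x|lborel. \<Psi> x))" unfolding B(1) J_def by (rule integral_mult_right_zero)
  also have "\<dots> = ln 2 * (K * (LINT x|lborel. \<Psi> x))" by simp
  finally have "norm (LINT x|lborel. \<Phi> x) \<le> K * (LINT x|lborel. \<Psi> x)" using l2 by (simp only: mult_le_cancel_left_pos)
  thus "norm (LINT x:shell a|lborel. phase_factor lam x * \<phi> x) \<le>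
    C * (real (k + 1) * 4 ^ k * P) * (LINT x:shell a|lborel. majorant lam m x)"
    unfolding set_lebesgue_integral_def \<Phi>_def \<Psi>_def K_def .
  show "set_integrable lborel (shell a) (\<lambda>x. phase_factor lam x * \<phi> x)"
    using A(3) unfolding set_integrable_def \<Phi>_def .
  show "set_integrable lborel (shell a) (majorant lam m)"
    using B(3) unfolding set_integrable_def \<Psi>_def .
qed

end

section \<open>Summation over the dyadic shells\<close>

lemma set_integral_sums_nonneg:
  fixes F :: "'a \<Rightarrow> real"
  assumes A: "\<And>i. A i \<in> sets M" "disjoint_family A" and F: "set_integrable M (\<Union>i. A i) F" "\<And>x. 0 \<le> F x"
  shows "(\<lambda>i. LINT x:A i|M. F x) sums (LINT x:(\<Union>i. A i)|M. F x)"
proof -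
  have int: "set_integrable M B F" if "B \<in> sets M" "B \<subseteq> (\<Union>i. A i)" for B
    by (rule set_integrable_subset[OF F(1) that])
  have "(\<Sum>i<n. LINT x:A i|M. F x) \<le> (LINT x:(\<Union>i. A i)|M. F x)" for n
  proof -
    have "(\<Sum>i<n. LINT x:A i|M. F x) = (LINT x:(\<Union>i<n. A i)|M. F x)"
      using A by (intro set_integral_finite_Union[symmetric] int) (auto simp: disjoint_family_on_def)
    also have "\<dots> \<le> (LINT x:(\<Union>i. A i)|M. F x)"
    proof -
      have "set_integrable M (\<Union>i<n. A i) F" by (rule int) (use A(1) in auto)
      thus ?thesis using F unfolding set_lebesgue_integral_def set_integrable_def
        by (intro integral_mono) (auto simp: indicator_def)
    qed
    finally show ?thesis .
  qed
  moreover have "0 \<le> (LINT x:A i|M. F x)" for i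
    unfolding set_lebesgue_integral_def using F(2) by (intro Bochner_Integration.integral_nonneg) simp
  ultimately have "summable (\<lambda>i. LINT x:A i|M. F x)" by (intro summableI_nonneg_bounded)
  hence "(\<lambda>i. LINT x:A i|M. F x) sums (\<Sum>i. LINT x:A i|M. F x)" by (rule summable_sums)
  also have "(\<Sum>i. LINT x:A i|M. F x) = (LINT x:(\<Union>i. A i)|M. F x)"
    using A F(1) by (intro lebesgue_integral_countable_add[symmetric]) (auto simp: disjoint_family_on_def)
  finally show ?thesis .
qed

lemma disjoint_dyadic_shells:
  assumes "r > 0"
  shows "disjoint_family (\<lambda>j. shell (r / 2 ^ j) :: 'a::real_normed_vector set)"
proof -
  have disj: "shell (r / 2 ^ i) \<inter> shell (r / 2 ^ j) = ({} :: 'a set)" if "i < j" for i j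
  proof -
    have "(2::real) ^ Suc i \<le> 2 ^ j" using that by (intro power_increasing) auto
    hence "r / 2 ^ j \<le> r / 2 ^ Suc i" using assms by (intro divide_left_mono) auto
    hence "2 * (r / 2 ^ j) \<le> r / 2 ^ i" by simp
    thus ?thesis unfolding shell_def by (auto simp del: times_divide_eq_right)
  qed
  show ?thesis unfolding disjoint_family_on_def
  proof (intro ballI impI)
    fix i j :: nat assume "i \<noteq> j"
    thus "shell (r / 2 ^ i) \<inter> shell (r / 2 ^ j) = ({} :: 'a set)"
      using disj[of i j] disj[of j i] by (cases "i < j") (auto simp: Int_commute)
  qed
qed

lemma Union_dyadic_shells:
  assumes r: "r > 0"
  shows "(\<Union>j. shell (r / 2 ^ j)) = {x::'a::real_normed_vector. x \<noteq> 0 \<and> norm x < 2 * r}"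
proof (intro equalityI subsetI)
  fix x :: 'a assume "x \<in> (\<Union>j. shell (r / 2 ^ j))"
  then obtain j where j: "r / 2 ^ j \<le> norm x" "norm x < 2 * (r / 2 ^ j)" by (auto simp: shell_def)
  have "0 < r / 2 ^ j" using r by simp
  hence "x \<noteq> 0" using j(1) by auto
  moreover have "r / 2 ^ j \<le> r / 1" using r by (intro divide_left_mono) auto
  ultimately show "x \<in> {x. x \<noteq> 0 \<and> norm x < 2 * r}" using j(2) by simp
next
  fix x :: 'a assume x: "x \<in> {x. x \<noteq> 0 \<and> norm x < 2 * r}"
  define Q where "Q j \<longleftrightarrow> r / 2 ^ j \<le> norm x" for j :: nat
  obtain n where "r / norm x < 2 ^ n" using real_arch_pow[of 2 "r / norm x"] by auto
  hence "Q n" using x r by (simp add: Q_def field_simps)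
  hence L: "Q (LEAST j. Q j)" by (rule LeastI)
  define j where "j = (LEAST j. Q j)"
  have "norm x < 2 * (r / 2 ^ j)"
  proof (cases j)
    case 0
    thus ?thesis using x by simp
  next
    case (Suc i)
    have "\<not> Q i" by (rule not_less_Least) (use Suc j_def in simp)
    thus ?thesis by (simp add: Q_def Suc)
  qed
  hence "x \<in> shell (r / 2 ^ j)" using L by (simp add: shell_def Q_def j_def)
  thus "x \<in> (\<Union>j. shell (r / 2 ^ j))" by blast
qed

lemma bounded_if_bounded_support:
  fixes g :: "'a::euclidean_space \<Rightarrow> 'b::real_normed_vector"
  assumes "continuous_on UNIV g" "\<And>x. norm x > r \<Longrightarrow> g x = 0"
  shows "\<exists>K. \<forall>x. norm (g x) \<le> K"
proof -
  have "compact (g ` cball 0 r)"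
    by (intro compact_continuous_image continuous_on_subset[OF assms(1)]) auto
  then obtain K where K: "\<forall>y\<in>g ` cball 0 r. norm y \<le> K" using compact_imp_bounded bounded_iff by metis
  have "norm (g x) \<le> max K 0" for x
  proof (cases "norm x > r")
    case True
    thus ?thesis using assms(2) by simp
  next
    case False
    hence "g x \<in> g ` cball 0 r" by auto
    thus ?thesis using K by (auto simp: le_max_iff_disj)
  qed
  thus ?thesis by blast
qed

lemma grad_zero_outside:
  fixes \<phi> :: "real^'n \<Rightarrow> 'b::real_normed_vector"
  assumes "\<And>x. \<phi> x \<noteq> 0 \<Longrightarrow> norm x < r" "norm x > r"
  shows "grad \<phi> x = 0"
proof -
  have "open {y::real^'n. r < norm y}" by (intro open_Collect_less continuous_intros)
  moreover have "0 = \<phi> y" if "y \<in> {y. r < norm y}" for y using that assms(1)[of y] by force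
  ultimately have "(\<phi> has_derivative (\<lambda>_. 0)) (at x)"
    using assms(2) by (intro has_derivative_transform_within_open[where f = "\<lambda>_. 0", OF has_derivative_const]) auto
  hence "frechet_derivative \<phi> (at x) = (\<lambda>_. 0)" by (rule frechet_derivative_at[symmetric])
  thus ?thesis by (simp add: grad_def vec_eq_iff)
qed

lemma Linfty_norm_bound:
  fixes \<phi> :: "real^'n \<Rightarrow> complex"
  assumes \<phi>: "continuously_differentiable \<phi>" and supp: "\<And>x. \<phi> x \<noteq> 0 \<Longrightarrow> norm x < r"
  shows "norm (\<phi> x) \<le> Linfty_norm \<phi> + Linfty_norm (grad \<phi>)" "norm (grad \<phi> x) \<le> Linfty_norm \<phi> + Linfty_norm (grad \<phi>)"
proof -
  have c: "continuous_on UNIV \<phi>" "continuous_on UNIV (grad \<phi>)"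
  proof -
    show "continuous_on UNIV \<phi>"
    proof (rule continuous_at_imp_continuous_on, rule ballI, rule differentiable_imp_continuous_within)
      show "\<phi> differentiable (at x)" for x using \<phi> by (simp add: continuously_differentiable_def)
    qed
    show "continuous_on UNIV (grad \<phi>)" using \<phi> by (simp add: continuously_differentiable_def)
  qed
  obtain K where K: "\<forall>x. norm (\<phi> x) \<le> K" using bounded_if_bounded_support[OF c(1), of r] supp by force
  obtain K' where K': "\<forall>x. norm (grad \<phi> x) \<le> K'"
    using bounded_if_bounded_support[OF c(2), of r] grad_zero_outside[of \<phi> r] supp by blast
  have 1: "norm (\<phi> x) \<le> Linfty_norm \<phi>" for x by (rule continuous_le_Linfty_norm[OF c(1) K[rule_format]])
  have 2: "norm (grad \<phi> x) \<le> Linfty_norm (grad \<phi>)" for x by (rule continuous_le_Linfty_norm[OF c(2) K'[rule_format]])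
  have "0 \<le> Linfty_norm \<phi>" "0 \<le> Linfty_norm (grad \<phi>)" using 1[of 0] 2[of 0] order_trans[OF norm_ge_zero] by blast+
  thus "norm (\<phi> x) \<le> Linfty_norm \<phi> + Linfty_norm (grad \<phi>)" "norm (grad \<phi> x) \<le> Linfty_norm \<phi> + Linfty_norm (grad \<phi>)"
    using 1[of x] 2[of x] by linarith+
qed

lemma set_integrable_bounded:
  fixes F :: "'a::euclidean_space \<Rightarrow> 'b::{banach, second_countable_topology}"
  assumes "(\<lambda>x. indicator S x *\<^sub>R F x) \<in> borel_measurable borel" "S \<in> sets borel" "bounded S" "\<And>x. x \<in> S \<Longrightarrow> norm (F x) \<le> K"
  shows "set_integrable lborel S F"
  unfolding set_integrable_def
proof (rule Bochner_Integration.integrable_bound)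
  show "integrable lborel (\<lambda>x. indicator S x * K)"
    using emeasure_bounded_finite[OF assms(3)] assms(2)
    by (intro integrable_mult_left integrable_real_indicator) auto
  show "(\<lambda>x. indicator S x *\<^sub>R F x) \<in> borel_measurable lborel" using assms(1) by simp
  show "AE x in lborel. norm (indicator S x *\<^sub>R F x) \<le> norm (indicator S x * K)"
  proof (rule AE_I2)
    fix x show "norm (indicator S x *\<^sub>R F x) \<le> norm (indicator S x * K)"
      using assms(4)[of x] by (cases "x \<in> S") auto
  qed
qed

context radial_phase_bound
begin

text \<open>The disjoint shells \<open>S j\<close> add up to the punctured ball, so the first
  integrals sum exactly. The annuli of the second term overlap, but each contains its shell, which
  is the direction required.\<close>

lemma oscillatory_integral_bound:
  fixes \<phi> :: "real^'n \<Rightarrow> complex"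
  assumes m0: "2 powi (- m0 + 1) < b" and lam: "lam \<noteq> 0"
    and \<phi>: "continuously_differentiable \<phi>" and supp: "\<And>x. \<phi> x \<noteq> 0 \<Longrightarrow> norm x < 2 powi (- m0 + 1)"
    and P: "\<And>x. norm (\<phi> x) \<le> P" "\<And>x. norm (grad \<phi> x) \<le> P"
  defines "K \<equiv> C * (real CARD('n) * 4 ^ (CARD('n) - 1) * P)"
  shows "norm (osc_integral f \<phi> lam) \<le>
      K * (LINT x : {x. norm x < 2 powi (- m0 + 1)} | lborel.
           min_one_quot (radial_deriv2 f x) (lam * (radial_deriv f x)\<^sup>2)) +
      4 * K * (\<Sum>\<^sub>\<infinity>m\<in>{m0..}. LINT x : {x. 2 powi (- m - 1) < norm x \<and> norm x < 2 powi (- m + 1)} | lborel. quot2 lam m x)"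
proof -
  have P0: "0 \<le> P" using order_trans[OF norm_ge_zero P(1)] .
  have K: "K \<ge> 0" using C P0 by (simp add: K_def)
  define r where "r = (2::real) powi (- m0)"
  have r: "r > 0" by (simp add: r_def)
  have r2: "(2::real) powi (- m0 + 1) = 2 * r" using power_int_add[of "2::real" "- m0" 1] by (simp add: r_def)
  define mm where "mm j = m0 + int j" for j
  have rj: "(2::real) powi (- mm j) = r / 2 ^ j" for j
    unfolding mm_def r_def using power_int_diff[of "2::real" "- m0" "int j"] by (simp add: algebra_simps)
  have mj: "2 powi (- mm j + 1) < b" for j
  proof -
    have "(2::real) powi (- mm j + 1) \<le> 2 powi (- m0 + 1)" by (rule power_int_increasing) (auto simp: mm_def)
    thus ?thesis using m0 by linarith
  qed
  define S where "S j = (shell (r / 2 ^ j) :: (real^'n) set)" for j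
  define F where "F x = phase_factor lam x * \<phi> x" for x
  have S_sets: "S j \<in> sets lborel" for j by (simp add: S_def shell_borel)
  have disj: "disjoint_family S" unfolding S_def[abs_def] by (rule disjoint_dyadic_shells[OF r])
  have US: "(\<Union>j. S j) = {x. x \<noteq> 0 \<and> norm x < 2 * r}" unfolding S_def by (rule Union_dyadic_shells[OF r])
  define D where "D = (\<Union>j. S j)"
  have D_sets: "D \<in> sets borel" unfolding D_def US by measurable
  have DU: "D \<subseteq> U"
  proof -
    have "D \<subseteq> cball 0 b" unfolding D_def US using m0 r2 by auto
    thus ?thesis using U(2) by (rule subset_trans)
  qed
  have Db: "bounded D" unfolding D_def US by (rule bounded_subset[OF bounded_cball[of 0 "2 * r"]]) auto
  have AE0: "AE x in lborel. (x::real^'n) \<noteq> 0" by (rule AE_lborel_singleton)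
  have \<phi>c: "continuous_on UNIV \<phi>"
  proof (rule continuous_at_imp_continuous_on, rule ballI, rule differentiable_imp_continuous_within)
    show "\<phi> differentiable (at x)" for x using \<phi> by (simp add: continuously_differentiable_def)
  qed
  have fc: "continuous_on U f" using continuous_rad[of 0] by simp
  have Fc: "continuous_on U F" unfolding F_def phase_factor_def
    by (intro continuous_intros fc continuous_on_subset[OF \<phi>c]) simp
  have Fint: "set_integrable lborel D F"
  proof (rule set_integrable_bounded[OF _ D_sets Db])
    show "(\<lambda>x. indicator D x *\<^sub>R F x) \<in> borel_measurable borel"
      by (rule borel_measurable_continuous_on_indicator[OF D_sets continuous_on_subset[OF Fc DU]])
    show "norm (F x) \<le> P" for x using P(1)[of x] by (simp add: F_def norm_mult norm_phase_factor)
  qed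
  have osc_eq: "osc_integral f \<phi> lam = (LINT x:D|lborel. F x)"
  proof -
    have FB: "F = (\<lambda>x. indicator (ball 0 (2 * r)) x *\<^sub>R F x)"
      using supp r2 by (auto simp: F_def indicator_def fun_eq_iff)
    have BU: "ball 0 (2 * r) \<subseteq> U"
    proof -
      have "ball 0 (2 * r) \<subseteq> cball (0::real^'n) b" using m0 r2 by auto
      thus ?thesis using U(2) by (rule subset_trans)
    qed
    have "(\<lambda>x. indicator (ball 0 (2 * r)) x *\<^sub>R F x) \<in> borel_measurable borel"
      by (rule borel_measurable_continuous_on_indicator[OF _ continuous_on_subset[OF Fc BU]]) simp
    hence Fm: "F \<in> borel_measurable borel" using FB by simp
    have "osc_integral f \<phi> lam = (LINT x|lborel. F x)" unfolding osc_integral_def F_def phase_factor_def ..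
    also have "\<dots> = (LINT x|lborel. indicator D x *\<^sub>R F x)"
    proof (rule integral_cong_AE)
      show "F \<in> borel_measurable lborel" using Fm by simp
      show "(\<lambda>x. indicator D x *\<^sub>R F x) \<in> borel_measurable lborel"
        using borel_measurable_integrable[OF Fint[unfolded set_integrable_def]] .
      show "AE x in lborel. F x = indicator D x *\<^sub>R F x"
        using AE0
      proof eventually_elim
        case (elim x)
        show ?case using supp[of x] elim r2 by (auto simp: D_def US indicator_def F_def)
      qed
    qed
    finally show ?thesis unfolding set_lebesgue_integral_def .
  qed
  define T1 where "T1 = (LINT x : {x. norm x < 2 powi (- m0 + 1)} | lborel.
           min_one_quot (radial_deriv2 f x) (lam * (radial_deriv f x)\<^sup>2))"
  have q1int: "set_integrable lborel D (quot1 lam)"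
  proof (rule set_integrable_bounded[OF _ D_sets Db, where K = 1])
    show "(\<lambda>x. indicator D x *\<^sub>R quot1 lam x) \<in> borel_measurable borel"
      using quot1_measurable[OF DU D_sets, of lam] by simp
    show "norm (quot1 lam x) \<le> 1" for x using quot_bounds(1,2)[of lam x] by simp
  qed
  have T1: "T1 = (LINT x:D|lborel. quot1 lam x)"
  proof -
    have eqD: "min_one_quot (radial_deriv2 f x) (lam * (radial_deriv f x)\<^sup>2) = quot1 lam x" if "x \<in> D" for x
      unfolding quot1_def
    proof (rule min_one_quot_rad[OF U(1)])
      show "x \<in> U" using that DU by blast
      show "x \<noteq> 0" using that by (simp add: D_def US)
    qed (rule d)
    let ?H = "\<lambda>x. indicator {x. norm x < 2 powi (- m0 + 1)} x *\<^sub>R min_one_quot (radial_deriv2 f x) (lam * (radial_deriv f x)\<^sup>2)"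
    let ?v = "min_one_quot (radial_deriv2 f 0) (lam * (radial_deriv f 0)\<^sup>2)"
    \<comment> \<open>At the origin the radial derivatives have meaningless values; splitting off
      this single point also settles measurability there.\<close>
    have Hx: "?H x = indicator D x *\<^sub>R quot1 lam x + indicator {0} x *\<^sub>R ?v" for x
    proof (cases "x = 0")
      case True
      thus ?thesis by (simp add: D_def US)
    next
      case False
      show ?thesis
      proof (cases "x \<in> D")
        case True
        hence "norm x < 2 powi (- m0 + 1)" unfolding D_def US r2 by simp
        thus ?thesis using True False eqD[OF True] by simp
      next
        case nD: False
        hence "\<not> norm x < 2 powi (- m0 + 1)" using False unfolding D_def US r2 by simp
        thus ?thesis using nD False by simp
      qed
    qed
    have "T1 = (LINT x|lborel. indicator D x *\<^sub>R quot1 lam x)"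
      unfolding T1_def set_lebesgue_integral_def
    proof (rule integral_cong_AE)
      have m: "(\<lambda>x. indicator D x *\<^sub>R quot1 lam x) \<in> borel_measurable borel"
        using borel_measurable_integrable[OF q1int[unfolded set_integrable_def]] by simp
      thus "(\<lambda>x. indicator D x *\<^sub>R quot1 lam x) \<in> borel_measurable lborel" by simp
      show "?H \<in> borel_measurable lborel" unfolding Hx using m by simp
      show "AE x in lborel. ?H x = indicator D x *\<^sub>R quot1 lam x"
        using AE0 by eventually_elim (simp only: Hx, simp)
    qed
    thus ?thesis unfolding set_lebesgue_integral_def .
  qed
  define \<alpha> where "\<alpha> j = (LINT x:S j|lborel. quot1 lam x)" for j
  have \<alpha>: "\<alpha> sums T1" unfolding T1 D_def \<alpha>_def
    by (rule set_integral_sums_nonneg[OF S_sets disj]) (use q1int D_def quot_bounds(1) in auto)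
  define An where "An m = {x::real^'n. 2 powi (- m - 1) < norm x \<and> norm x < 2 powi (- m + 1)}" for m
  have An_sets: "An m \<in> sets borel" for m unfolding An_def by measurable
  have An_bdd: "bounded (An m)" for m
    unfolding An_def by (rule bounded_subset[OF bounded_cball[of 0 "2 powi (- m + 1)"]]) auto
  have An_eq: "An (mm j) = {x. r / 2 ^ j / 2 < norm x \<and> norm x < 2 * (r / 2 ^ j)}" for j
  proof -
    have "(2::real) powi (- mm j + 1) = 2 * (r / 2 ^ j)"
      using power_int_add[of "2::real" "- mm j" 1] unfolding rj by simp
    moreover have "(2::real) powi (- mm j - 1) = r / 2 ^ j / 2"
      using power_int_diff[of "2::real" "- mm j" 1] unfolding rj by simp
    ultimately show ?thesis unfolding An_def by (simp only:)
  qed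
  define \<gamma> where "\<gamma> j = (LINT x:An (mm j)|lborel. quot2 lam (mm j) x)" for j
  have q2int: "set_integrable lborel (An (mm j)) (quot2 lam (mm j))" for j
  proof (rule set_integrable_bounded[OF _ An_sets An_bdd, where K = 1])
    show "(\<lambda>x. indicator (An (mm j)) x *\<^sub>R quot2 lam (mm j) x) \<in> borel_measurable borel"
      using quot2_measurable[OF mj[of j] An_sets[of "mm j"], where lam = lam] by (simp add: An_def not_less)
    show "norm (quot2 lam (mm j) x) \<le> 1" for x using quot_bounds(3,4)[of lam "mm j" x] by simp
  qed
  have SA: "S j \<subseteq> An (mm j)" for j
  proof
    fix x assume x: "x \<in> S j"
    have "0 < r / 2 ^ j" using r by simp
    thus "x \<in> An (mm j)" using x unfolding An_eq S_def shell_def by (auto simp del: times_divide_eq_right)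
  qed
  have AS: "An (mm j) \<subseteq> S j \<union> S (Suc j)" for j
    unfolding An_eq S_def shell_def by auto
  have \<gamma>0: "0 \<le> \<gamma> j" for j unfolding \<gamma>_def set_lebesgue_integral_def
    using quot_bounds(3) by (intro Bochner_Integration.integral_nonneg) auto
  \<comment> \<open>Volumes of the shells. Each annulus lies in two consecutive shells and the
    integrand is at most 1, so they dominate the second integrals.\<close>
  define \<mu> where "\<mu> j = (LINT x:S j|lborel. (1::real))" for j
  have Sint1: "set_integrable lborel D (\<lambda>_. 1::real)"
    by (rule set_integrable_bounded[OF _ D_sets Db, where K = 1]) (use D_sets in auto)
  have \<mu>: "summable \<mu>" unfolding \<mu>_def
    by (rule sums_summable[OF set_integral_sums_nonneg[OF S_sets disj]]) (use Sint1 D_def in auto)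
  have SD: "S j \<subseteq> D" for j unfolding D_def by blast
  have Sj1: "set_integrable lborel (S j) (\<lambda>_. 1::real)" for j
    by (rule set_integrable_subset[OF Sint1 S_sets SD])
  have \<gamma>\<mu>: "\<gamma> j \<le> \<mu> j + \<mu> (Suc j)" for j
  proof -
    have "\<gamma> j \<le> (LINT x|lborel. indicator (S j) x *\<^sub>R 1 + indicator (S (Suc j)) x *\<^sub>R (1::real))"
      unfolding \<gamma>_def set_lebesgue_integral_def
    proof (rule integral_mono)
      show "integrable lborel (\<lambda>x. indicator (An (mm j)) x *\<^sub>R quot2 lam (mm j) x)" using q2int unfolding set_integrable_def .
      show "integrable lborel (\<lambda>x. indicator (S j) x *\<^sub>R 1 + indicator (S (Suc j)) x *\<^sub>R (1::real))"
        by (intro Bochner_Integration.integrable_add Sj1[unfolded set_integrable_def])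
      fix x
      show "indicator (An (mm j)) x *\<^sub>R quot2 lam (mm j) x \<le> indicator (S j) x *\<^sub>R 1 + indicator (S (Suc j)) x *\<^sub>R (1::real)"
        using AS[of j] quot_bounds(4)[of lam "mm j" x] by (auto simp: indicator_def)
    qed
    also have "\<dots> = \<mu> j + \<mu> (Suc j)" unfolding \<mu>_def set_lebesgue_integral_def
      by (intro Bochner_Integration.integral_add Sj1[unfolded set_integrable_def])
    finally show ?thesis .
  qed
  \<comment> \<open>Without summability the infinite sum in the conclusion would take the default
    value 0 and could bound nothing.\<close>
  have \<gamma>s: "summable \<gamma>"
  proof (rule summable_comparison_test')
    show "summable (\<lambda>j. \<mu> j + \<mu> (Suc j))" using \<mu> by (intro summable_add) (auto simp: summable_Suc_iff)
    show "norm (\<gamma> j) \<le> \<mu> j + \<mu> (Suc j)" if "j \<ge> 0" for j using \<gamma>\<mu>[of j] \<gamma>0[of j] by simp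
  qed
  have \<gamma>sum: "(\<Sum>\<^sub>\<infinity>m\<in>{m0..}. LINT x:An m|lborel. quot2 lam m x) = suminf \<gamma>"
  proof -
    have bij: "bij_betw mm UNIV {m0..}" unfolding mm_def
      by (rule bij_betw_byWitness[where f' = "\<lambda>m. nat (m - m0)"]) auto
    have "(\<gamma> has_sum suminf \<gamma>) UNIV"
      by (rule sums_nonneg_imp_has_sum[OF summable_sums[OF \<gamma>s]]) (rule \<gamma>0)
    hence "(\<Sum>\<^sub>\<infinity>j. \<gamma> j) = suminf \<gamma>" by (rule infsumI)
    thus ?thesis using infsum_reindex_bij_betw[OF bij, of "\<lambda>m. LINT x:An m|lborel. quot2 lam m x"]
      unfolding \<gamma>_def by simp
  qed
  have shell_le: "norm (LINT x:S j|lborel. F x) \<le> K * (\<alpha> j + 4 * \<gamma> j)" for j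
  proof -
    have Kk: "C * (real (CARD('n) - 1 + 1) * 4 ^ (CARD('n) - 1) * P) = K" by (simp add: K_def)
    have "norm (LINT x:S j|lborel. F x) \<le> K * (LINT x:S j|lborel. majorant lam (mm j) x)"
      using shell_bound(1)[OF mj[of j] lam \<phi> P] unfolding S_def F_def rj Kk .
    also have "(LINT x:S j|lborel. majorant lam (mm j) x) = \<alpha> j + (LINT x:S j|lborel. 4 * quot2 lam (mm j) x)"
      unfolding majorant_def \<alpha>_def
      by (rule set_integral_add(2)[OF set_integrable_subset[OF q1int S_sets SD]
            set_integrable_mult_right[OF set_integrable_subset[OF q2int S_sets SA]]])
    also have "(LINT x:S j|lborel. 4 * quot2 lam (mm j) x) = 4 * (LINT x:S j|lborel. quot2 lam (mm j) x)"
      by (rule set_integral_mult_right)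
    also have "(LINT x:S j|lborel. quot2 lam (mm j) x) \<le> \<gamma> j"
    proof -
      have "set_integrable lborel (S j) (quot2 lam (mm j))" by (rule set_integrable_subset[OF q2int S_sets SA])
      thus ?thesis unfolding \<gamma>_def set_lebesgue_integral_def using SA[of j] q2int[of j] quot_bounds(3)[of lam "mm j"]
        unfolding set_integrable_def by (intro integral_mono) (auto simp: indicator_def)
    qed
    finally show ?thesis using K by (simp add: mult_left_mono)
  qed
  have sm: "summable (\<lambda>j. K * (\<alpha> j + 4 * \<gamma> j))"
    by (intro summable_mult summable_add sums_summable[OF \<alpha>] \<gamma>s)
  have "osc_integral f \<phi> lam = (\<Sum>j. LINT x:S j|lborel. F x)"
    unfolding osc_eq D_def using S_sets disj Fint[unfolded D_def]
    by (intro lebesgue_integral_countable_add) (auto simp: disjoint_family_on_def)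
  hence "norm (osc_integral f \<phi> lam) \<le> (\<Sum>j. K * (\<alpha> j + 4 * \<gamma> j))"
    using norm_suminf_le[OF shell_le sm] by simp
  also have "\<dots> = K * (suminf \<alpha> + 4 * suminf \<gamma>)"
    using sums_summable[OF \<alpha>] \<gamma>s by (simp add: suminf_mult suminf_add[symmetric] summable_mult summable_add)
  also have "\<dots> = K * T1 + 4 * K * suminf \<gamma>" using sums_unique[OF \<alpha>] by (simp add: algebra_simps)
  finally show ?thesis unfolding T1_def \<gamma>sum[symmetric] An_def .
qed

end

theorem theorem3p1:
  fixes f :: "real ^ 'n \<Rightarrow> real" and U :: "(real ^ 'n) set" and b :: real
  assumes "0 < b" and "b \<le> 1"
    and "open U" and "cball 0 b \<subseteq> U"
    and "f real_analytic_on U"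
    and "\<not> f constant_on U"
    and "grad f 0 = 0"
  shows "\<exists>C::real. \<forall>(m0::int) (\<phi> :: real ^ 'n \<Rightarrow> complex) (lam::real).
    2 powi (- m0 + 1) < b \<longrightarrow>
    continuously_differentiable \<phi> \<longrightarrow>
    (\<forall>x. \<phi> x \<noteq> 0 \<longrightarrow> norm x < 2 powi (- m0 + 1)) \<longrightarrow>
    lam \<noteq> 0 \<longrightarrow>
    norm (osc_integral f \<phi> lam) \<le>
      C * (Linfty_norm \<phi> + Linfty_norm (grad \<phi>)) *
        (LINT x : {x. norm x < 2 powi (- m0 + 1)} | lborel.
           min_one_quot (radial_deriv2 f x) (lam * (radial_deriv f x)\<^sup>2))
      + C * (Linfty_norm \<phi> + Linfty_norm (grad \<phi>)) *
        (\<Sum>\<^sub>\<infinity>m\<in>{m0..}.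
           LINT x : {x. 2 powi (- m - 1) < norm x \<and> norm x < 2 powi (- m + 1)} | lborel.
             min_one_quot 1
               (\<bar>lam\<bar> * norm x * (SUP y\<in>radial_segment m x. \<bar>radial_deriv f y\<bar>)))"
proof -
  obtain N A where N: "N \<ge> 1" and A: "A \<ge> 0"
    and ode: "\<forall>x\<in>cball 0 b. (rad f (Suc N) x)\<^sup>2 \<le> A * (\<Sum>j<N. (rad f (Suc j) x)\<^sup>2)"
    using rad_finite_order[OF assms(5) compact_cball assms(4)] by blast
  have d: "rad f k differentiable (at y)" if "y \<in> U" for k y
    using rad_local[OF assms(5) that] by blast
  obtain C where C: "C \<ge> 0" and oscC: "\<forall>g \<psi> \<psi>' lam B. oscillation (g 0) (g 1) (g 2) \<psi> \<psi>' lam B 1 4 \<longrightarrow> derivs_on 1 4 g \<longrightarrow>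
    (\<forall>x\<in>{1..4}. (g (Suc N) x)\<^sup>2 \<le> A * (\<Sum>j<N. (g (Suc j) x)\<^sup>2)) \<longrightarrow>
    oscillation.osc (g 0) \<psi> lam 2 4 \<le>
      C * B * ((LINT t:{2..4}|lborel. min_one_quot (g 2 t) (lam * (g 1 t)\<^sup>2)) +
        (LINT t:{2..4::real}|lborel. min_one_quot 1 (\<bar>lam\<bar> * (SUP s\<in>{1..4}. \<bar>g 1 s\<bar>))))"
    using osc_bound[OF N A] by (elim exE conjE)
  interpret radial_phase_bound f U b A N C
    by unfold_locales (use assms d N A ode C oscC in \<open>blast+\<close>)
  \<comment> \<open>The second term needs the factor 4 lost in \<open>quot_on_ray\<close>; the first
    is enlarged to share the same constant.\<close>
  define C' where "C' = 4 * (C * (real CARD('n) * 4 ^ (CARD('n) - 1)))"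
  show ?thesis
  proof (intro exI[of _ C'] allI impI)
    fix m0 :: int and \<phi> :: "real ^ 'n \<Rightarrow> complex" and lam :: real
    assume m0: "2 powi (- m0 + 1) < b" and \<phi>: "continuously_differentiable \<phi>"
      and supp: "\<forall>x. \<phi> x \<noteq> 0 \<longrightarrow> norm x < 2 powi (- m0 + 1)" and lam: "lam \<noteq> 0"
    define P where "P = Linfty_norm \<phi> + Linfty_norm (grad \<phi>)"
    have P: "norm (\<phi> x) \<le> P" "norm (grad \<phi> x) \<le> P" for x
      unfolding P_def using Linfty_norm_bound[OF \<phi>, of "2 powi (- m0 + 1)"] supp by blast+
    have P0: "0 \<le> P" using order_trans[OF norm_ge_zero P(1)] .
    define T1 where "T1 = (LINT x : {x. norm x < 2 powi (- m0 + 1)} | lborel.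
           min_one_quot (radial_deriv2 f x) (lam * (radial_deriv f x)\<^sup>2))"
    define T2 where "T2 = (\<Sum>\<^sub>\<infinity>m\<in>{m0..}.
           LINT x : {x. 2 powi (- m - 1) < norm x \<and> norm x < 2 powi (- m + 1)} | lborel. quot2 lam m x)"
    define K where "K = C * (real CARD('n) * 4 ^ (CARD('n) - 1) * P)"
    have "norm (osc_integral f \<phi> lam) \<le> K * T1 + 4 * K * T2"
      unfolding K_def T1_def T2_def
      by (rule oscillatory_integral_bound[OF m0 lam \<phi> _ P]) (use supp in blast)
    also have "K * T1 \<le> 4 * K * T1"
    proof -
      have "0 \<le> K" using C P0 by (simp add: K_def)
      moreover have "0 \<le> T1" unfolding T1_def by (rule set_integral_min_one_quot_nonneg)
      ultimately show ?thesis by (intro mult_right_mono) auto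
    qed
    finally have "norm (osc_integral f \<phi> lam) \<le> C' * P * T1 + C' * P * T2" by (simp add: K_def C'_def mult_ac)
    thus "norm (osc_integral f \<phi> lam) \<le>
      C' * (Linfty_norm \<phi> + Linfty_norm (grad \<phi>)) *
        (LINT x : {x. norm x < 2 powi (- m0 + 1)} | lborel.
           min_one_quot (radial_deriv2 f x) (lam * (radial_deriv f x)\<^sup>2))
      + C' * (Linfty_norm \<phi> + Linfty_norm (grad \<phi>)) *
        (\<Sum>\<^sub>\<infinity>m\<in>{m0..}.
           LINT x : {x. 2 powi (- m - 1) < norm x \<and> norm x < 2 powi (- m + 1)} | lborel.
             min_one_quot 1
               (\<bar>lam\<bar> * norm x * (SUP y\<in>radial_segment m x. \<bar>radial_deriv f y\<bar>)))"
      unfolding P_def T1_def T2_def quot2_def segsup_def .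
  qed
qed

end
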